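(* Let $(X,T)$ be a topologically mixing subshift of finite type. Then there exists a dense subset $\mathcal{D}$ of $C(X)$ such that for every $\phi\in\mathcal{D}$ the set $M_{\max}(\phi)$ of $\phi$-maximizing measures contains uncountably many ergodic elements which are fully supported and have positive entropy.
   Context: A subshift of finite type is a closed shift-invariant set $X$ of (one-sided or two-sided) sequences over a finite alphabet, consisting of all sequences avoiding some finite list of forbidden words, with $T$ the left shift restricted to $X$. $C(X)$ is the Banach space of continuous functions $X\to\mathbb{R}$ with the supremum norm. $M(X,T)$ is the space of $T$-invariant Borel probability measures on $X$ with the weak*-topology. For $\phi\in C(X)$, a measure $\mu\in M(X,T)$ is $\phi$-maximizing if $\int\phi\,d\mu=\max_{\nu\in M(X,T)}\int\phi\,d\nu$; $M_{\max}(\phi)$ denotes the set of all $\phi$-maximizing measures. A measure is fully supported if its support is all of $X$; entropy means the measure-theoretic (Kolmogorov–Sinai) entropy with respect to $T$.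
   Formalization: The subshift X is additionally assumed to have at least two points; for an empty X or a single fixed point (a mixing subshift of finite type whose only invariant measure has zero entropy) the claim as stated is false. *)

theory Defs
  imports "HOL-Probability.Probability"
begin

section \<open>Subshifts of finite type\<close>

text \<open>
  One-sided sequences have type \<^typ>\<open>nat \<Rightarrow> 'a\<close>, two-sided ones \<^typ>\<open>int \<Rightarrow> 'a\<close>; the
  definitions below are generic in the index type and are meant for these two instances.
  Sequence spaces carry the library's product topology. Since the type of symbols is of class
  \<open>discrete_topology\<close>, this is the product of the discrete topologies. The alphabet is a finite
  subset of that type.
\<close>

definition left_shift :: "('i::semiring_1 \<Rightarrow> 'a) \<Rightarrow> 'i \<Rightarrow> 'a" where
  "left_shift x = (\<lambda>i. x (i + 1))"

definition occurs_in :: "'a list \<Rightarrow> ('i::semiring_1 \<Rightarrow> 'a) \<Rightarrow> bool" where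
  "occurs_in w x \<longleftrightarrow> (\<exists>i. \<forall>k<length w. x (i + of_nat k) = w ! k)"

text \<open>Closedness and (forward) shift-invariance follow from this definition, see the two lemmas below.\<close>

definition subshift_of_finite_type :: "'a set \<Rightarrow> ('i::semiring_1 \<Rightarrow> 'a) set \<Rightarrow> bool" where
  "subshift_of_finite_type A X \<longleftrightarrow>
     finite A \<and>
     (\<exists>F. finite F \<and> F \<subseteq> lists A \<and> X = {x. range x \<subseteq> A \<and> (\<forall>w\<in>F. \<not> occurs_in w x)})"

lemma subshift_of_finite_type_closed:
  fixes X :: "('i::semiring_1 \<Rightarrow> 'a::discrete_topology) set"
  assumes "subshift_of_finite_type A X"
  shows "closed X"
proof -
  obtain F where X: "X = {x. range x \<subseteq> A \<and> (\<forall>w\<in>F. \<not> occurs_in w x)}"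
    using assms by (auto simp: subshift_of_finite_type_def)
  have cyl: "open {x :: 'i \<Rightarrow> 'a. x j \<in> B}" for j B
    using open_vimage[OF Topological_Spaces.open_discrete continuous_on_product_coordinates[of j], of B]
    by (simp add: vimage_def)
  have "- X = (\<Union>j. {x. x j \<in> - A}) \<union>
     (\<Union>w\<in>F. \<Union>i. \<Inter>k\<in>{..<length w}. {x. x (i + of_nat k) \<in> {w ! k}})"
    unfolding X by (auto simp: occurs_in_def Bex_def)
  moreover have "open \<dots>"
    by (intro open_Un open_UN open_INT ballI cyl finite_lessThan)
  ultimately show ?thesis
    by (simp add: closed_def)
qed

lemma subshift_of_finite_type_invariant:
  assumes "subshift_of_finite_type A X" "x \<in> X"
  shows "left_shift x \<in> X"
proof -
  obtain F where X: "X = {x. range x \<subseteq> A \<and> (\<forall>w\<in>F. \<not> occurs_in w x)}"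
    using assms by (auto simp: subshift_of_finite_type_def)
  have "occurs_in w x" if "occurs_in w (left_shift x)" for w
    using that unfolding occurs_in_def left_shift_def by (metis add.assoc add.commute)
  moreover have "range (left_shift x) \<subseteq> range x"
    by (auto simp: left_shift_def)
  ultimately show ?thesis
    using assms(2) unfolding X by blast
qed

definition topologically_mixing :: "'b::topological_space set \<Rightarrow> ('b \<Rightarrow> 'b) \<Rightarrow> bool" where
  "topologically_mixing X T \<longleftrightarrow>
     (\<forall>U V. openin (top_of_set X) U \<and> U \<noteq> {} \<and> openin (top_of_set X) V \<and> V \<noteq> {}
        \<longrightarrow> (\<exists>N. \<forall>n\<ge>N. (T ^^ n) ` U \<inter> V \<noteq> {}))"

section \<open>Continuous functions and maximizing measures\<close>

text \<open>
  Elements of \<open>C_space X\<close> are real functions that are continuous on \<open>X\<close> and, by the convention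
  of \<^const>\<open>extensional\<close>, \<open>undefined\<close> outside \<open>X\<close>; the metric is the supremum distance on \<open>X\<close>.
\<close>

definition C_space :: "'b::topological_space set \<Rightarrow> ('b \<Rightarrow> real) metric" where
  "C_space X = cfunspace (top_of_set X) euclidean_metric"

definition invariant_measures :: "'b::topological_space set \<Rightarrow> ('b \<Rightarrow> 'b) \<Rightarrow> 'b measure set" where
  "invariant_measures X T =
     {\<mu>. prob_space \<mu> \<and> sets \<mu> = sets (restrict_space borel X) \<and>
         T \<in> measurable \<mu> \<mu> \<and> distr \<mu> \<mu> T = \<mu>}"

definition maximizing_measures ::
  "'b::topological_space set \<Rightarrow> ('b \<Rightarrow> 'b) \<Rightarrow> ('b \<Rightarrow> real) \<Rightarrow> 'b measure set" where
  "maximizing_measures X T \<phi> =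
     {\<mu> \<in> invariant_measures X T. \<forall>\<nu>\<in>invariant_measures X T. (\<integral>x. \<phi> x \<partial>\<nu>) \<le> (\<integral>x. \<phi> x \<partial>\<mu>)}"

text \<open>The following notions are used for measures that are already known to be invariant.\<close>

definition ergodic :: "('b \<Rightarrow> 'b) \<Rightarrow> 'b measure \<Rightarrow> bool" where
  "ergodic T \<mu> \<longleftrightarrow>
     (\<forall>A\<in>sets \<mu>. T -` A \<inter> space \<mu> = A \<longrightarrow> measure \<mu> A = 0 \<or> measure \<mu> A = 1)"

definition measure_support :: "'b::topological_space measure \<Rightarrow> 'b set" where
  "measure_support \<mu> = {x \<in> space \<mu>. \<forall>U. open U \<and> x \<in> U \<longrightarrow> emeasure \<mu> (U \<inter> space \<mu>) > 0}"

definition fully_supported :: "'b::topological_space set \<Rightarrow> 'b measure \<Rightarrow> bool" where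
  "fully_supported X \<mu> \<longleftrightarrow> measure_support \<mu> = X"

section \<open>Kolmogorov--Sinai entropy\<close>

definition finite_partition :: "'b measure \<Rightarrow> 'b set set \<Rightarrow> bool" where
  "finite_partition \<mu> P \<longleftrightarrow> finite P \<and> P \<subseteq> sets \<mu> \<and> partition_on (space \<mu>) P"

text \<open>The convention $0 \log 0 = 0$ is automatic, so an empty cell contributes nothing.\<close>

definition partition_entropy :: "'b measure \<Rightarrow> 'b set set \<Rightarrow> real" where
  "partition_entropy \<mu> P = - (\<Sum>A\<in>P. measure \<mu> A * ln (measure \<mu> A))"

text \<open>
  \<open>iterated_join T \<mu> P n\<close> is the common refinement of the preimages of \<open>P\<close> under
  \<open>T ^^ 0, \<dots>, T ^^ (n - 1)\<close>, possibly together with the empty set.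
\<close>

primrec iterated_join :: "('b \<Rightarrow> 'b) \<Rightarrow> 'b measure \<Rightarrow> 'b set set \<Rightarrow> nat \<Rightarrow> 'b set set" where
  "iterated_join T \<mu> P 0 = {space \<mu>}"
| "iterated_join T \<mu> P (Suc n) =
     {A \<inter> ((T ^^ n) -` B \<inter> space \<mu>) | A B. A \<in> iterated_join T \<mu> P n \<and> B \<in> P}"

definition entropy_wrt_partition :: "('b \<Rightarrow> 'b) \<Rightarrow> 'b measure \<Rightarrow> 'b set set \<Rightarrow> real" where
  "entropy_wrt_partition T \<mu> P = lim (\<lambda>n. partition_entropy \<mu> (iterated_join T \<mu> P n) / real n)"

definition KS_entropy :: "('b \<Rightarrow> 'b) \<Rightarrow> 'b measure \<Rightarrow> ereal" where
  "KS_entropy T \<mu> = (SUP P\<in>{P. finite_partition \<mu> P}. ereal (entropy_wrt_partition T \<mu> P))"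

end

theory Submission
  imports Defs
begin

text \<open>
  The argument is a variational one. Near \<open>\<phi>\<^sub>0\<close> one finds, for each \<open>\<delta> > 0\<close>, an injective family
  \<open>\<mu> t\<close>, \<open>t\<close> in an interval, of ergodic, fully supported measures of positive entropy whose
  integrals of \<open>\<phi>\<^sub>0\<close> are within \<open>\<delta>\<close> of the maximum \<open>\<beta> \<phi>\<^sub>0\<close>. Ekeland's principle (in the manner of Bishop
  and Phelps), applied to \<open>\<phi> \<mapsto> \<beta> \<phi> - \<integral>\<integral>\<phi> d(\<mu> t) dt\<close>, yields a nearby \<open>\<phi>\<close> at which this function decreases with slope
  at most \<open>1/4\<close> in every direction. If only countably many \<open>\<mu> t\<close> maximized \<open>\<phi>\<close>, then by the mean ergodic theorem,
  for most \<open>t\<close>, the Birkhoff averages \<open>A\<close> of \<open>\<phi>\<close> would fall below \<open>\<beta> \<phi> - c\<close> with \<open>\<mu> t\<close>-probability close to one;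
  adding \<open>c\<close> times the truncation of \<open>(\<beta> \<phi> - A) / c\<close> to \<open>[0, 1]\<close> would then raise the averaged integral by
  about \<open>c\<close> but the maximum only negligibly, a contradiction.

  The measures \<open>\<mu> t\<close> are Markov. Some periodic orbit of the subshift almost maximizes \<open>\<phi>\<^sub>0\<close>. On
  sufficiently long blocks a preferred successor map leads to this orbit and then follows it, and with probability
  \<open>t\<close> the chain moves along a random successor map instead. Driven by independent random maps,
  the chain can be run from the infinite past, since the maps coalesce almost surely. This makes \<open>\<mu> t\<close> a factor of
  a Bernoulli shift, hence invariant and ergodic, for one-sided and two-sided sequences alike.
\<close>

section \<open>Maximal Birkhoff means and their perturbation\<close>

text \<open>The measures are averaged over t because the slope bound has to be tested against one
  fixed linear functional. Averaging over a nonatomic parameter makes countably many maximizing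
  parameters negligible, so that parameters with a definite shortfall fill a set of measure above
  1/2. The slope 1/4 is chosen to leave a gap: with a tolerance of 1/16 it bounds the averaged
  integral of the test function by 5/16, whereas that set pushes it above 1/2 in the limit. The law
  of the random letters does not depend on t, which is only the threshold at which they are read.
  All \<mu> t are thus images of one probability measure, and measurability in t follows by Fubini's
  theorem. Every edge keeps positive probability, which gives full support, and some state branches,
  which gives positive entropy. Branching is where two distinct points of X are needed: a one-point
  X is mixing, but its only invariant measure has entropy zero.\<close>

text \<open>The slices \<open>S x\<close> are nested along the relation "y lies in the slice of x".
  Picking near-minimizers of f in successive slices makes f decrease to a limit, and distances are
  controlled by the drop of f, so the sequence is Cauchy. The Lipschitz bound makes f continuous at
  its limit x, which lies in all slices. A point violating the conclusion at x would lie in all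
  slices too, hence could not be lower than x.\<close>

lemma (in Metric_space) ekeland_variational_principle:
  fixes f :: "'a \<Rightarrow> real"
  assumes compl: mcomplete
    and lip: "\<And>x y. x \<in> M \<Longrightarrow> y \<in> M \<Longrightarrow> \<bar>f x - f y\<bar> \<le> L * d x y"
    and lower: "\<And>x. x \<in> M \<Longrightarrow> b \<le> f x"
    and e: "0 < e" and x0: "x0 \<in> M"
  shows "\<exists>x\<in>M. f x + e * d x0 x \<le> f x0 \<and> (\<forall>y\<in>M. f x \<le> f y + e * d x y)"
proof -
  define S where "S x = {y \<in> M. f y + e * d x y \<le> f x}" for x
  have S_self: "x \<in> S x" if "x \<in> M" for x
    using that by (simp add: S_def)
  have S_trans: "z \<in> S x" if "y \<in> S x" "z \<in> S y" "x \<in> M" for x y z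
  proof -
    have "d x z \<le> d x y + d y z"
      using that by (intro triangle) (auto simp: S_def)
    hence "e * d x z \<le> e * d x y + e * d y z"
      using e by (simp flip: distrib_left)
    thus ?thesis using that by (auto simp: S_def)
  qed
  have "\<exists>z\<in>S x. \<forall>y\<in>S x. f z \<le> f y + (1/2)^n" if x: "x \<in> M" for x and n :: nat
  proof -
    have ne: "f ` S x \<noteq> {}" using S_self[OF x] by auto
    have bdd: "bdd_below (f ` S x)"
      using lower by (intro bdd_belowI[of _ b]) (auto simp: S_def)
    have "Inf (f ` S x) < Inf (f ` S x) + (1/2)^n" by simp
    then obtain z where "z \<in> S x" "f z < Inf (f ` S x) + (1/2)^n"
      using cInf_lessD[OF ne] by blast
    moreover have "Inf (f ` S x) \<le> f y" if "y \<in> S x" for y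
      using bdd that by (intro cInf_lower) auto
    ultimately show ?thesis by (intro bexI[of _ z]) (auto, fastforce)
  qed
  note ex = this
  \<comment> \<open>The tolerance shrinks with the step number n, so that in the limit no point
    common to all slices lies below x.\<close>
  define nxt where "nxt n x = (SOME z. z \<in> S x \<and> (\<forall>y\<in>S x. f z \<le> f y + (1/2)^n))" for n :: nat and x
  have nxt: "nxt n x \<in> S x" "\<And>y. y \<in> S x \<Longrightarrow> f (nxt n x) \<le> f y + (1/2)^n" if "x \<in> M" for n x
    using someI_ex[OF ex[OF that, of n, unfolded Bex_def]] by (auto simp: nxt_def)
  define s where "s = rec_nat x0 nxt"
  have s_Suc: "s (Suc n) = nxt n (s n)" and s_0: "s 0 = x0" for n
    by (simp_all add: s_def)
  have sM: "s n \<in> M" for n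
    by (induction n) (use x0 nxt(1) in \<open>auto simp: s_0 s_Suc S_def\<close>)
  have step: "s (n + k) \<in> S (s n)" for n k
  proof (induction k)
    case 0 show ?case using S_self sM by simp
  next
    case (Suc k)
    have "s (n + Suc k) \<in> S (s (n + k))" using nxt(1)[OF sM, of "n + k"] by (simp add: s_Suc)
    from S_trans[OF Suc this sM] show ?case .
  qed
  have dec: "decseq (\<lambda>n. f (s n))"
  proof (rule decseq_SucI)
    fix n
    have "f (s (Suc n)) + e * d (s n) (s (Suc n)) \<le> f (s n)"
      using step[of n 1] by (simp add: S_def)
    moreover have "0 \<le> e * d (s n) (s (Suc n))" using e by simp
    ultimately show "f (s (Suc n)) \<le> f (s n)" by simp
  qed
  obtain l where l: "(\<lambda>n. f (s n)) \<longlonglongrightarrow> l"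
    by (rule decseq_convergent[OF dec, of b]) (use lower sM in auto)
  hence Cf: "Cauchy (\<lambda>n. f (s n))" by (rule LIMSEQ_imp_Cauchy)
  \<comment> \<open>The slice condition reads
    \<open>e * d (s n) (s n') \<le> f (s n) - f (s n')\<close>, so the Cauchy property is inherited
    from the real sequence.\<close>
  have "MCauchy s"
    unfolding MCauchy_def
  proof (intro conjI allI impI)
    show "range s \<subseteq> M" using sM by auto
    fix r :: real assume r: "0 < r"
    obtain N where N: "\<And>m n. m \<ge> N \<Longrightarrow> n \<ge> N \<Longrightarrow> dist (f (s m)) (f (s n)) < e * r"
      using CauchyD[OF Cf, of "e * r"] e r by (auto simp: dist_real_def)
    have le: "d (s n) (s n') < r" if "N \<le> n" "n \<le> n'" for n n'
    proof -
      have "f (s n') + e * d (s n) (s n') \<le> f (s n)"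
        using step[of n "n' - n"] that by (simp add: S_def)
      hence "e * d (s n) (s n') < e * r" using N[of n n'] that by (simp add: dist_real_def)
      thus ?thesis using e by simp
    qed
    show "\<exists>N. \<forall>n n'. N \<le> n \<longrightarrow> N \<le> n' \<longrightarrow> d (s n) (s n') < r"
      using le by (metis commute nle_le)
  qed
  then obtain x where x: "limitin mtopology s x sequentially"
    using compl by (auto simp: mcomplete_def)
  hence xM: "x \<in> M" and dx: "(\<lambda>n. d (s n) x) \<longlonglongrightarrow> 0"
    using limitin_metric_dist_null by auto
  have fx: "(\<lambda>n. f (s n)) \<longlonglongrightarrow> f x"
  proof (rule Lim_transform_bound[where g = "\<lambda>n. L * d (s n) x" , THEN LIM_zero_cancel])
    show "\<forall>\<^sub>F n in sequentially. norm (f (s n) - f x) \<le> norm (L * d (s n) x)"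
      using lip[OF sM xM] by (auto intro!: always_eventually order.trans[OF lip[OF sM xM]])
    show "(\<lambda>n. L * d (s n) x) \<longlonglongrightarrow> 0" using tendsto_mult_right_zero[OF dx] by simp
  qed
  have xS: "x \<in> S (s n)" for n
  proof -
    have "f x + e * d (s n) x \<le> f (s n)"
    proof (rule LIMSEQ_le_const2)
      have "(\<lambda>k. f (s (k + n)) + (e * d (s n) x - e * d (s (k+n)) x)) \<longlonglongrightarrow> f x + (e * d (s n) x - e * 0)"
        by (intro tendsto_intros LIMSEQ_ignore_initial_segment[OF fx] LIMSEQ_ignore_initial_segment[OF dx])
      thus "(\<lambda>k. f (s (k + n)) + (e * d (s n) x - e * d (s (k+n)) x)) \<longlonglongrightarrow> f x + e * d (s n) x" by simp
      have "f (s (k + n)) + (e * d (s n) x - e * d (s (k+n)) x) \<le> f (s n)" for k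
      proof -
        have "e * d (s n) x \<le> e * (d (s n) (s (k+n)) + d (s (k+n)) x)"
          using e sM xM by (intro mult_left_mono triangle) auto
        thus ?thesis using step[of n k] by (simp add: S_def algebra_simps)
      qed
      thus "\<exists>N. \<forall>k\<ge>N. f (s (k + n)) + (e * d (s n) x - e * d (s (k+n)) x) \<le> f (s n)" by blast
    qed
    thus ?thesis using xM by (simp add: S_def)
  qed
  show ?thesis
  proof (intro bexI[OF _ xM] conjI ballI)
    show "f x + e * d x0 x \<le> f x0" using xS[of 0] by (simp add: S_def s_0)
    fix y assume y: "y \<in> M"
    show "f x \<le> f y + e * d x y"
    proof (rule ccontr)
      assume neg: "\<not> ?thesis"
      hence "y \<in> S x" using y by (simp add: S_def)
      hence yS: "y \<in> S (s n)" for n using S_trans[OF xS _ sM] by blast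
      have "f x \<le> f y + (1/2)^n" for n
      proof -
        have "0 \<le> e * d (s (Suc n)) x" using e by simp
        hence "f x \<le> f (s (Suc n))" using xS[of "Suc n"] unfolding S_def by simp
        thus ?thesis using nxt(2)[OF sM yS[of n], of n] by (simp add: s_Suc)
      qed
      moreover have "(\<lambda>n. f y + (1/2::real)^n) \<longlonglongrightarrow> f y + 0"
        by (intro tendsto_intros LIMSEQ_power_zero) simp
      ultimately have "f x \<le> f y + 0" by (intro LIMSEQ_le_const[where X = "\<lambda>n. f y + (1/2)^n"]) auto
      moreover have "0 \<le> e * d x y" using e by simp
      ultimately show False using neg by simp
    qed
  qed
qed

text \<open>Division by zero makes the value 0 for \<open>n = 0\<close>; statements about means
  therefore carry \<open>1 \<le> n\<close>.\<close>

definition birkhoff :: "('b \<Rightarrow> 'b) \<Rightarrow> ('b \<Rightarrow> real) \<Rightarrow> nat \<Rightarrow> 'b \<Rightarrow> real" where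
  "birkhoff T f n x = (\<Sum>k<n. f ((T ^^ k) x)) / real n"

text \<open>
  The supremum of \<open>\<integral>f d\<nu>\<close> over invariant measures \<open>\<nu>\<close>, expressed without measures; this
  makes weak* compactness of the space of invariant measures unnecessary.
\<close>

definition max_mean :: "'b set \<Rightarrow> ('b \<Rightarrow> 'b) \<Rightarrow> ('b \<Rightarrow> real) \<Rightarrow> real" where
  "max_mean X T f = (INF n\<in>{1..}. SUP x\<in>X. birkhoff T f n x)"

section \<open>Maximal means of a continuous map on a compact space\<close>

locale topological_system =
  fixes X :: "'b::topological_space set" and T :: "'b \<Rightarrow> 'b"
  assumes compact_X: "compact X" and X_nonempty: "X \<noteq> {}"
    and T_continuous: "continuous_on X T" and T_into: "\<And>x. x \<in> X \<Longrightarrow> T x \<in> X"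
begin

lemma funpow_into: "x \<in> X \<Longrightarrow> (T ^^ n) x \<in> X"
  by (induction n) (auto intro: T_into)

lemma continuous_on_funpow: "continuous_on X (T ^^ n)"
proof (induction n)
  case (Suc n)
  have "continuous_on X (\<lambda>x. T ((T ^^ n) x))"
    using continuous_on_compose2[OF T_continuous Suc] funpow_into by blast
  thus ?case by (simp add: o_def)
qed (simp add: id_def)

lemma continuous_on_birkhoff:
  assumes "continuous_on X f" shows "continuous_on X (birkhoff T f n)"
proof -
  have "continuous_on X (\<lambda>x. f ((T ^^ k) x))" for k
    using continuous_on_compose2[OF assms continuous_on_funpow] funpow_into by blast
  hence "continuous_on X (\<lambda>x. (\<Sum>k<n. f ((T ^^ k) x)) * inverse (real n))"
    by (intro continuous_intros)
  thus ?thesis by (simp add: birkhoff_def[abs_def] divide_inverse)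
qed

lemma continuous_bounded:
  fixes f :: "'b \<Rightarrow> real"
  assumes "continuous_on X f"
  obtains B where "0 \<le> B" "\<And>x. x \<in> X \<Longrightarrow> \<bar>f x\<bar> \<le> B"
proof -
  have "bounded (f ` X)"
    using assms compact_X by (intro compact_imp_bounded compact_continuous_image)
  then obtain B where "\<And>x. x \<in> X \<Longrightarrow> \<bar>f x\<bar> \<le> B" by (auto simp: bounded_iff)
  thus ?thesis using that[of "max 0 B"] by fastforce
qed

lemma birkhoff_bounded:
  assumes "\<And>x. x \<in> X \<Longrightarrow> \<bar>f x\<bar> \<le> B" "x \<in> X" "0 \<le> B"
  shows "\<bar>birkhoff T f n x\<bar> \<le> B"
proof -
  have "\<bar>\<Sum>k<n. f ((T ^^ k) x)\<bar> \<le> (\<Sum>k<n. B)"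
    using assms funpow_into by (intro order.trans[OF sum_abs] sum_mono) auto
  thus ?thesis using assms(3)
    by (cases "n = 0") (auto simp: birkhoff_def abs_divide divide_le_eq mult.commute)
qed

context
  fixes f :: "'b \<Rightarrow> real"
  assumes cont: "continuous_on X f"
begin

private lemma bdd_above_birkhoff: "bdd_above (birkhoff T f n ` X)"
proof -
  obtain B where "\<And>x. x \<in> X \<Longrightarrow> \<bar>birkhoff T f n x\<bar> \<le> B"
    using continuous_bounded[OF continuous_on_birkhoff[OF cont]] by metis
  thus ?thesis by (intro bdd_aboveI[of _ B]) (auto, fastforce)
qed

private lemma bdd_below_SUP: "bdd_below ((\<lambda>n. SUP x\<in>X. birkhoff T f n x) ` {1..})"
proof -
  obtain B where B: "0 \<le> B" "\<And>x. x \<in> X \<Longrightarrow> \<bar>f x\<bar> \<le> B"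
    using continuous_bounded[OF cont] by metis
  obtain x where x: "x \<in> X" using X_nonempty by auto
  have "-B \<le> (SUP x\<in>X. birkhoff T f n x)" for n
    using birkhoff_bounded[of f B x n, OF B(2) x B(1)]
    by (intro cSUP_upper2[OF bdd_above_birkhoff x]) linarith
  thus ?thesis by (intro bdd_belowI[of _ "-B"]) auto
qed

lemma max_mean_le:
  assumes "1 \<le> n" "\<And>x. x \<in> X \<Longrightarrow> birkhoff T f n x \<le> c"
  shows "max_mean X T f \<le> c"
  unfolding max_mean_def using assms X_nonempty
  by (intro cINF_lower2[OF bdd_below_SUP, of n] cSUP_least) auto

lemma max_mean_approx_above:
  assumes "0 < e"
  obtains n where "1 \<le> n" "\<And>x. x \<in> X \<Longrightarrow> birkhoff T f n x \<le> max_mean X T f + e"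
proof -
  have "\<exists>n\<in>{1..}. (SUP x\<in>X. birkhoff T f n x) < max_mean X T f + e"
    unfolding max_mean_def using assms
    by (subst cINF_less_iff[symmetric, OF _ bdd_below_SUP]) auto
  then obtain n where "1 \<le> n" "(SUP x\<in>X. birkhoff T f n x) < max_mean X T f + e" by auto
  thus ?thesis
    using cSUP_upper[OF _ bdd_above_birkhoff, of _ n] by (intro that[of n]) (auto, fastforce)
qed

lemma max_mean_approx_below:
  assumes "0 < e" "1 \<le> n"
  obtains x where "x \<in> X" "max_mean X T f - e \<le> birkhoff T f n x"
proof -
  have "\<not> (\<forall>x\<in>X. birkhoff T f n x \<le> max_mean X T f - e)"
    using max_mean_le[OF assms(2), of "max_mean X T f - e"] assms(1) by auto
  thus ?thesis using that by (meson nle_le)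
qed

lemma max_mean_abs_le:
  assumes B: "\<And>x. x \<in> X \<Longrightarrow> \<bar>f x\<bar> \<le> B" and "0 \<le> B"
  shows "\<bar>max_mean X T f\<bar> \<le> B"
proof (rule abs_leI)
  show "max_mean X T f \<le> B"
    using birkhoff_bounded[of f B _ 1, OF B _ \<open>0 \<le> B\<close>] by (intro max_mean_le[of 1]) (auto, fastforce)
  show "- max_mean X T f \<le> B"
  proof (rule field_le_epsilon)
    fix e :: real assume "0 < e"
    then obtain n where n: "\<And>x. x \<in> X \<Longrightarrow> birkhoff T f n x \<le> max_mean X T f + e"
      using max_mean_approx_above by metis
    obtain x where x: "x \<in> X" using X_nonempty by auto
    show "- max_mean X T f \<le> B + e"
      using n[OF x] birkhoff_bounded[of f B x n, OF B x \<open>0 \<le> B\<close>] by linarith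
  qed
qed

end

lemma max_mean_lipschitz:
  assumes f: "continuous_on X f" and g: "continuous_on X g"
    and fg: "\<And>x. x \<in> X \<Longrightarrow> f x \<le> g x + c"
  shows "max_mean X T f \<le> max_mean X T g + c"
proof (rule field_le_epsilon)
  fix e :: real assume "0 < e"
  then obtain n where n: "1 \<le> n" "\<And>x. x \<in> X \<Longrightarrow> birkhoff T g n x \<le> max_mean X T g + e"
    using max_mean_approx_above[OF g] by metis
  have "birkhoff T f n x \<le> birkhoff T g n x + c" if "x \<in> X" for x
  proof -
    have "(\<Sum>k<n. f ((T ^^ k) x)) \<le> (\<Sum>k<n. g ((T ^^ k) x) + c)"
      using fg funpow_into that by (intro sum_mono) auto
    also have "\<dots> = (\<Sum>k<n. g ((T ^^ k) x)) + n * c" by (simp add: sum.distrib)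
    finally show ?thesis using n(1) by (simp add: birkhoff_def field_simps)
  qed
  thus "max_mean X T f \<le> max_mean X T g + c + e"
    using n by (intro max_mean_le[OF f n(1)]) (force intro: order.trans)
qed

lemma birkhoff_sum_telescope:
  "(\<Sum>k<n. g ((T ^^ k) (T x)) - g ((T ^^ k) x)) = g ((T ^^ n) x) - (g x :: real)"
proof (induction n)
  case (Suc n)
  have "(T ^^ n) (T x) = (T ^^ Suc n) x" by (simp add: funpow_swap1)
  thus ?case using Suc by simp
qed simp

text \<open>\<open>f\<close> and its Birkhoff average differ by a coboundary, which does not change the maximal mean.\<close>

lemma birkhoff_minus_self_coboundary:
  assumes f: "continuous_on X f" and n: "1 \<le> n"
  obtains B where "0 \<le> B" "\<And>m x. x \<in> X \<Longrightarrow> \<bar>\<Sum>k<m. birkhoff T f n ((T ^^ k) x) - f ((T ^^ k) x)\<bar> \<le> B"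
proof -
  obtain K where K: "0 \<le> K" "\<And>x. x \<in> X \<Longrightarrow> \<bar>f x\<bar> \<le> K"
    using continuous_bounded[OF f] by metis
  show thesis
  proof (rule that[of "2 * real n * K"])
    show "0 \<le> 2 * real n * K" using K by simp
    fix m x assume x: "x \<in> X"
    \<comment> \<open>\<open>s j\<close> is the Birkhoff sum of length m started at time j. Moving
      the start by one exchanges a single term for another, at a cost of at most 2 K.\<close>
    define s where "s j = (\<Sum>k<m. f ((T ^^ k) ((T ^^ j) x)))" for j
    have s: "\<bar>s j - s 0\<bar> \<le> 2 * real j * K" for j
    proof (induction j)
      case (Suc j)
      have "s (Suc j) - s j = f ((T ^^ m) ((T ^^ j) x)) - f ((T ^^ j) x)"
        using birkhoff_sum_telescope[of f "(T ^^ j) x" m] by (simp add: s_def sum_subtractf)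
      moreover have "\<bar>f ((T ^^ m) ((T ^^ j) x))\<bar> \<le> K" "\<bar>f ((T ^^ j) x)\<bar> \<le> K"
        using x K funpow_into by auto
      ultimately show ?case using Suc by (simp add: algebra_simps)
    qed simp
    have "(\<Sum>k<m. birkhoff T f n ((T ^^ k) x)) = (\<Sum>j<n. s j) / n"
    proof -
      have "(\<Sum>k<m. \<Sum>j<n. f ((T ^^ j) ((T ^^ k) x))) = (\<Sum>j<n. s j)"
        unfolding s_def
        by (subst sum.swap) (simp add: add.commute flip: funpow_add[unfolded o_def fun_eq_iff, rule_format])
      thus ?thesis by (simp add: birkhoff_def flip: sum_divide_distrib)
    qed
    hence "(\<Sum>k<m. birkhoff T f n ((T ^^ k) x) - f ((T ^^ k) x)) = (\<Sum>j<n. s j - s 0) / n"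
      using n by (simp add: sum_subtractf s_def diff_divide_distrib)
    moreover have "\<bar>\<Sum>j<n. s j - s 0\<bar> \<le> (\<Sum>j<n. 2 * real n * K)"
      using K(1) by (intro order.trans[OF sum_abs] sum_mono order.trans[OF s]) (auto intro!: mult_right_mono)
    ultimately show "\<bar>\<Sum>k<m. birkhoff T f n ((T ^^ k) x) - f ((T ^^ k) x)\<bar> \<le> 2 * real n * K"
      using n by (simp add: abs_divide divide_le_eq mult.commute mult.left_commute)
  qed
qed

text \<open>The coboundary contributes at most B to Birkhoff sums of any length m, hence less than e
  to the means as soon as m exceeds B / e. The gain is that only f has to be averaged: g enters
  pointwise.\<close>

lemma max_mean_cohomologous_le:
  assumes f: "continuous_on X f" and g: "continuous_on X g" and n: "1 \<le> n"
    and le: "\<And>x. x \<in> X \<Longrightarrow> birkhoff T f n x + g x \<le> c"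
  shows "max_mean X T (\<lambda>x. f x + g x) \<le> c"
proof (rule field_le_epsilon)
  fix e :: real assume e: "0 < e"
  obtain B where B: "0 \<le> B" "\<And>m x. x \<in> X \<Longrightarrow> \<bar>\<Sum>k<m. birkhoff T f n ((T ^^ k) x) - f ((T ^^ k) x)\<bar> \<le> B"
    using birkhoff_minus_self_coboundary[OF f n] by metis
  obtain m where m: "B / e < real m" using reals_Archimedean2 by blast
  have m1: "1 \<le> m" using m B(1) e by (cases m) (auto simp: field_simps)
  show "max_mean X T (\<lambda>x. f x + g x) \<le> c + e"
  proof (rule max_mean_le[OF _ m1])
    show "continuous_on X (\<lambda>x. f x + g x)" using f g by (intro continuous_intros)
    fix x assume x: "x \<in> X"
    have "(\<Sum>k<m. f ((T ^^ k) x) + g ((T ^^ k) x)) =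
       (\<Sum>k<m. birkhoff T f n ((T ^^ k) x) + g ((T ^^ k) x)) - (\<Sum>k<m. birkhoff T f n ((T ^^ k) x) - f ((T ^^ k) x))"
      by (simp add: sum.distrib sum_subtractf)
    also have "\<dots> \<le> (\<Sum>k<m. c) + B"
      using B(2)[OF x, of m] sum_mono[of "{..<m}" "\<lambda>k. birkhoff T f n ((T ^^ k) x) + g ((T ^^ k) x)" "\<lambda>_. c"]
        le funpow_into[OF x] by force
    also have "\<dots> \<le> m * (c + e)" using m e by (simp add: field_simps)
    finally show "birkhoff T (\<lambda>x. f x + g x) m x \<le> c + e"
      using m1 by (simp add: birkhoff_def divide_le_eq mult.commute)
  qed
qed

lemma invariant_measuresD:
  assumes "\<nu> \<in> invariant_measures X T"
  shows "prob_space \<nu>" "sets \<nu> = sets (restrict_space borel X)" "T \<in> measurable \<nu> \<nu>" "distr \<nu> \<nu> T = \<nu>"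
  using assms unfolding invariant_measures_def mem_Collect_eq by - (elim conjE, assumption)+

lemma continuous_measurable:
  fixes f :: "'b \<Rightarrow> real"
  assumes "continuous_on X f" "\<nu> \<in> invariant_measures X T"
  shows "f \<in> borel_measurable \<nu>"
proof -
  from measurable_cong_sets[OF invariant_measuresD(2)[OF assms(2)] refl, of borel] show ?thesis
    using borel_measurable_continuous_on_restrict[OF assms(1)] by blast
qed

lemma invariant_measure_space:
  assumes "\<nu> \<in> invariant_measures X T" shows "space \<nu> = X"
  using sets_eq_imp_space_eq[OF invariant_measuresD(2)[OF assms]] by (simp add: space_restrict_space)

lemma continuous_integrable:
  fixes f :: "'b \<Rightarrow> real"
  assumes f: "continuous_on X f" and \<nu>: "\<nu> \<in> invariant_measures X T"
  shows "integrable \<nu> f"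
proof -
  interpret prob_space \<nu> by (rule invariant_measuresD(1)[OF \<nu>])
  obtain B where "\<And>x. x \<in> X \<Longrightarrow> \<bar>f x\<bar> \<le> B"
    using continuous_bounded[OF f] by metis
  thus ?thesis
    by (intro integrable_const_bound[of _ B]) (auto simp: invariant_measure_space[OF \<nu>] continuous_measurable[OF f \<nu>])
qed

lemma integral_funpow:
  fixes f :: "'b \<Rightarrow> real"
  assumes f: "continuous_on X f" and \<nu>: "\<nu> \<in> invariant_measures X T"
  shows "(\<integral>x. f ((T ^^ k) x) \<partial>\<nu>) = (\<integral>x. f x \<partial>\<nu>)"
proof (induction k)
  case (Suc k)
  note T = invariant_measuresD(3)[OF \<nu>] and d = invariant_measuresD(4)[OF \<nu>]
  have "continuous_on X (\<lambda>x. f ((T ^^ k) x))"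
    using continuous_on_compose2[OF f continuous_on_funpow] funpow_into by blast
  hence "(\<integral>x. f ((T ^^ k) (T x)) \<partial>\<nu>) = (\<integral>x. f ((T ^^ k) x) \<partial>distr \<nu> \<nu> T)"
    by (intro integral_distr[symmetric] T continuous_measurable[OF _ \<nu>])
  thus ?case using Suc unfolding d by (simp add: funpow_swap1)
qed simp

lemma integral_birkhoff:
  assumes f: "continuous_on X f" and \<nu>: "\<nu> \<in> invariant_measures X T" and n: "1 \<le> n"
  shows "(\<integral>x. birkhoff T f n x \<partial>\<nu>) = (\<integral>x. f x \<partial>\<nu>)"
proof -
  have "continuous_on X (\<lambda>x. f ((T ^^ k) x))" for k
    using continuous_on_compose2[OF f continuous_on_funpow] funpow_into by blast
  hence "integrable \<nu> (\<lambda>x. f ((T ^^ k) x))" for k by (rule continuous_integrable[OF _ \<nu>])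
  thus ?thesis using n by (simp add: birkhoff_def integral_funpow[OF f \<nu>])
qed

text \<open>By invariance f may be replaced by a Birkhoff average, which is uniformly below
  \<open>max_mean X T f + e\<close> for a suitable length.\<close>

lemma integral_le_max_mean:
  assumes f: "continuous_on X f" and \<nu>: "\<nu> \<in> invariant_measures X T"
  shows "(\<integral>x. f x \<partial>\<nu>) \<le> max_mean X T f"
proof (rule field_le_epsilon)
  fix e :: real assume "0 < e"
  then obtain n where n: "1 \<le> n" "\<And>x. x \<in> X \<Longrightarrow> birkhoff T f n x \<le> max_mean X T f + e"
    using max_mean_approx_above[OF f] by metis
  interpret prob_space \<nu> by (rule invariant_measuresD(1)[OF \<nu>])
  have "(\<integral>x. birkhoff T f n x \<partial>\<nu>) \<le> (\<integral>x. max_mean X T f + e \<partial>\<nu>)"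
    using n(2) by (intro integral_mono continuous_integrable[OF continuous_on_birkhoff[OF f] \<nu>])
      (auto simp: invariant_measure_space[OF \<nu>])
  thus "(\<integral>x. f x \<partial>\<nu>) \<le> max_mean X T f + e"
    by (simp add: integral_birkhoff[OF f \<nu> n(1)] prob_space)
qed

text \<open>All invariant integrals are dominated by \<open>max_mean\<close>, so attaining it
  suffices. That it is attained will come from the family of measures itself.\<close>

lemma maximizing_measureI:
  assumes "continuous_on X f" "\<nu> \<in> invariant_measures X T" "(\<integral>x. f x \<partial>\<nu>) = max_mean X T f"
  shows "\<nu> \<in> maximizing_measures X T f"
  using assms(2,3) integral_le_max_mean[OF assms(1)] unfolding maximizing_measures_def by simp

text \<open>An orbit segment of length k n splits into k segments of length n. A uniform upper bound
  found at one length thus persists along lengths tending to infinity, where the mean ergodic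
  theorem applies.\<close>

lemma birkhoff_mult_le:
  assumes "\<And>x. x \<in> X \<Longrightarrow> birkhoff T f n x \<le> c" "x \<in> X" "1 \<le> n" "1 \<le> k"
  shows "birkhoff T f (k * n) x \<le> c"
proof -
  have split: "(\<Sum>i<a + b. F i) = (\<Sum>i<a. F i) + (\<Sum>i<b. F (i + a))" for a b and F :: "nat \<Rightarrow> real"
    by (induction b) (auto simp: add.commute)
  have "(\<Sum>i<k*n. f ((T ^^ i) x)) \<le> real k * (real n * c)" for k
  proof (induction k)
    case (Suc k)
    have "(\<Sum>i<Suc k*n. f ((T ^^ i) x)) = (\<Sum>i<k*n. f ((T ^^ i) x)) + (\<Sum>i<n. f ((T ^^ i) ((T ^^ (k*n)) x)))"
      using split[of _ "k*n" n] by (simp add: add.commute funpow_add)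
    moreover have "(\<Sum>i<n. f ((T ^^ i) ((T ^^ (k*n)) x))) \<le> n * c"
      using assms(1)[OF funpow_into[OF assms(2)], of "k*n"] assms(3)
      by (simp add: birkhoff_def divide_le_eq mult.commute)
    ultimately show ?case using Suc by (simp add: algebra_simps)
  qed simp
  from this[of k] show ?thesis using assms(3,4) by (simp add: birkhoff_def divide_le_eq mult_ac)
qed

section \<open>C(X) as a complete metric space\<close>

lemma mspace_C_space: "mspace (C_space X) = {f. f \<in> extensional X \<and> continuous_on X f}"
  using compact_X compactin_mspace_cfunspace[of "top_of_set X" euclidean_metric]
  by (auto simp: C_space_def compactin_subtopology Abstract_Metric_Spaces.mtopology_of_euclidean)

lemma mdist_C_space:
  assumes "f \<in> mspace (C_space X)" "g \<in> mspace (C_space X)" "x \<in> X"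
  shows "\<bar>f x - g x\<bar> \<le> mdist (C_space X) f g"
  using mdist_cfunspace_imp_mdist_le[of f "top_of_set X" euclidean_metric g "mdist (C_space X) f g" x] assms
  by (simp add: C_space_def dist_real_def)

lemma mdist_C_space_le:
  assumes "\<And>x. x \<in> X \<Longrightarrow> \<bar>f x - g x\<bar> \<le> B" "0 \<le> B"
  shows "mdist (C_space X) f g \<le> B"
  using assms unfolding C_space_def by (intro mdist_cfunspace_le) (auto simp: dist_real_def)

lemma mcomplete_C_space: "mcomplete_of (C_space X :: ('b \<Rightarrow> real) metric)"
proof -
  have "Metric_space.mcomplete (UNIV :: real set) dist"
    by (simp add: complete_UNIV)
  from Met_TC.mcomplete_cfunspace[OF this] show ?thesis
    unfolding C_space_def by (simp add: Met_TC.Self_def euclidean_metric_def)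
qed

end

section \<open>Perturbation of a potential against an averaged family of measures\<close>

text \<open>\<open>nonatomic\<close> lets countable sets of parameters be discarded,
  \<open>measurable_integral\<close> gives sense to the average over Q, and
  \<open>mean_ergodic\<close> is the only form in which ergodicity of the measures enters the
  perturbation argument.\<close>

locale ergodic_family = topological_system X T
  for X :: "'b::topological_space set" and T +
  fixes Q :: "'q measure" and \<mu> :: "'q \<Rightarrow> 'b measure"
  assumes prob_Q: "prob_space Q"
    and nonatomic: "\<And>B. countable B \<Longrightarrow> B \<subseteq> space Q \<Longrightarrow> B \<in> null_sets Q"
    and invariant: "\<And>q. q \<in> space Q \<Longrightarrow> \<mu> q \<in> invariant_measures X T"
    and measurable_integral:
      "\<And>f :: 'b \<Rightarrow> real. continuous_on X f \<Longrightarrow> (\<lambda>q. \<integral>x. f x \<partial>\<mu> q) \<in> borel_measurable Q"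
    and mean_ergodic: "\<And>q f. q \<in> space Q \<Longrightarrow> continuous_on X f \<Longrightarrow>
      (\<lambda>n. \<integral>x. \<bar>birkhoff T f n x - (\<integral>y. f y \<partial>\<mu> q)\<bar> \<partial>\<mu> q) \<longlonglongrightarrow> 0"
begin

interpretation Q: prob_space Q by (rule prob_Q)

abbreviation bary :: "('b \<Rightarrow> real) \<Rightarrow> real" where
  "bary f \<equiv> \<integral>q. (\<integral>x. f x \<partial>\<mu> q) \<partial>Q"

lemma integral_abs_le:
  fixes f :: "'b \<Rightarrow> real"
  assumes "continuous_on X f" "\<And>x. x \<in> X \<Longrightarrow> \<bar>f x\<bar> \<le> B" "q \<in> space Q"
  shows "\<bar>\<integral>x. f x \<partial>\<mu> q\<bar> \<le> B"
proof -
  note inv = invariant[OF assms(3)]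
  interpret prob_space "\<mu> q" by (rule invariant_measuresD(1)[OF inv])
  have "\<bar>\<integral>x. f x \<partial>\<mu> q\<bar> \<le> (\<integral>x. \<bar>f x\<bar> \<partial>\<mu> q)"
    using integral_norm_bound[of "\<mu> q" f] by simp
  also have "\<dots> \<le> (\<integral>x. B \<partial>\<mu> q)"
    using assms by (intro integral_mono integrable_abs continuous_integrable[OF _ inv])
      (auto simp: invariant_measure_space[OF inv])
  finally show ?thesis by (simp add: prob_space)
qed

lemma integrable_integral:
  fixes f :: "'b \<Rightarrow> real"
  assumes "continuous_on X f"
  shows "integrable Q (\<lambda>q. \<integral>x. f x \<partial>\<mu> q)"
proof -
  obtain B where "\<And>x. x \<in> X \<Longrightarrow> \<bar>f x\<bar> \<le> B"
    using continuous_bounded[OF assms] by metis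
  thus ?thesis
    using integral_abs_le[OF assms]
    by (intro Q.integrable_const_bound[of _ B] measurable_integral assms) auto
qed

lemma bary_add:
  assumes "continuous_on X f" "continuous_on X g"
  shows "bary (\<lambda>x. f x + g x) = bary f + bary g"
proof -
  have "bary (\<lambda>x. f x + g x) = (\<integral>q. (\<integral>x. f x \<partial>\<mu> q) + (\<integral>x. g x \<partial>\<mu> q) \<partial>Q)"
    using assms by (intro Bochner_Integration.integral_cong Bochner_Integration.integral_add continuous_integrable invariant) auto
  also have "\<dots> = bary f + bary g"
    using assms by (intro Bochner_Integration.integral_add integrable_integral)
  finally show ?thesis .
qed

lemma bary_le:
  assumes f: "continuous_on X f" "continuous_on X g" and fg: "\<And>x. x \<in> X \<Longrightarrow> f x \<le> g x + c"
  shows "bary f \<le> bary g + c"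
proof -
  have "(\<integral>x. f x \<partial>\<mu> q) \<le> (\<integral>x. g x \<partial>\<mu> q) + c" if q: "q \<in> space Q" for q
  proof -
    note inv = invariant[OF q]
    interpret prob_space "\<mu> q" by (rule invariant_measuresD(1)[OF inv])
    have "(\<integral>x. f x \<partial>\<mu> q) \<le> (\<integral>x. g x + c \<partial>\<mu> q)"
      using assms by (intro integral_mono continuous_integrable[OF _ inv] continuous_intros)
         (auto simp: invariant_measure_space[OF inv])
    also have "\<dots> = (\<integral>x. g x \<partial>\<mu> q) + c"
      using continuous_integrable[OF f(2) inv] by (simp add: prob_space)
    finally show ?thesis .
  qed
  hence "bary f \<le> (\<integral>q. (\<integral>x. g x \<partial>\<mu> q) + c \<partial>Q)"
    using f by (intro integral_mono integrable_integral Bochner_Integration.integrable_add) auto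
  also have "\<dots> = bary g + c" using integrable_integral[OF f(2)] by (simp add: Q.prob_space)
  finally show ?thesis .
qed

lemma bary_le_max_mean:
  assumes f: "continuous_on X f" shows "bary f \<le> max_mean X T f"
proof -
  have "bary f \<le> (\<integral>q. max_mean X T f \<partial>Q)"
    using integral_le_max_mean[OF f invariant] by (intro integral_mono integrable_integral f) auto
  thus ?thesis by (simp add: Q.prob_space)
qed

text \<open>
  The witness of the descent step: adding \<open>c * g\<close> with \<open>g\<close> a truncation of \<open>(\<beta> - birkhoff T \<phi> n) / c\<close>
  raises the maximal mean hardly at all, because \<open>birkhoff T \<phi> n + c * g \<le> max \<beta> (birkhoff T \<phi> n)\<close>.
\<close>

lemma uncountable_of_slope:
  assumes \<phi>: "continuous_on X \<phi>"
    and slope: "\<And>g B. continuous_on X g \<Longrightarrow> (\<And>x. x \<in> X \<Longrightarrow> \<bar>g x\<bar> \<le> B) \<Longrightarrow> 0 \<le> B \<Longrightarrow>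
      max_mean X T \<phi> + bary g - B / 4 \<le> max_mean X T (\<lambda>x. \<phi> x + g x)"
  shows "uncountable {q \<in> space Q. (\<integral>x. \<phi> x \<partial>\<mu> q) = max_mean X T \<phi>}"
proof
  assume count: "countable {q \<in> space Q. (\<integral>x. \<phi> x \<partial>\<mu> q) = max_mean X T \<phi>}"
  define \<beta> where "\<beta> = max_mean X T \<phi>"
  define m where "m q = (\<integral>x. \<phi> x \<partial>\<mu> q)" for q
  \<comment> \<open>These sets of parameters with a definite shortfall increase to the complement of
    a set that is countable by assumption, hence null. One of them therefore has measure above
    1/2.\<close>
  define S where "S k = {q \<in> space Q. m q \<le> \<beta> - 2 / real (Suc k)}" for k
  have m_meas [measurable]: "m \<in> borel_measurable Q"
    unfolding m_def by (rule measurable_integral[OF \<phi>])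
  have S_sets: "S k \<in> sets Q" for k unfolding S_def by measurable
  have "incseq S"
  proof (rule incseq_SucI)
    fix k
    have "2 / real (Suc (Suc k)) \<le> 2 / real (Suc k)" by (intro frac_le) auto
    thus "S k \<subseteq> S (Suc k)" by (auto simp: S_def simp del: of_nat_Suc)
  qed
  hence "(\<lambda>k. measure Q (S k)) \<longlonglongrightarrow> measure Q (\<Union>k. S k)"
    using S_sets by (intro Q.finite_Lim_measure_incseq) auto
  moreover have "measure Q (\<Union>k. S k) = 1"
  proof (subst Q.prob_eq_1)
    have null: "{q \<in> space Q. m q = \<beta>} \<in> null_sets Q"
      using count by (intro nonatomic) (auto simp: m_def \<beta>_def)
    show "AE q in Q. q \<in> (\<Union>k. S k)"
    proof (rule AE_I'[OF null], safe)
      fix q assume q: "q \<in> space Q" "q \<notin> (\<Union>k. S k)"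
      show "m q = \<beta>"
      proof (rule ccontr)
        assume "m q \<noteq> \<beta>"
        hence "0 < \<beta> - m q"
          using integral_le_max_mean[OF \<phi> invariant[OF q(1)]] by (simp add: m_def \<beta>_def)
        then obtain k where "inverse (real (Suc k)) < (\<beta> - m q) / 2"
          using reals_Archimedean[of "(\<beta> - m q) / 2"] by auto
        hence "q \<in> S k" using q(1) by (simp add: S_def field_simps)
        thus False using q(2) by blast
      qed
    qed
  qed (use S_sets in auto)
  ultimately have "\<forall>\<^sub>F k in sequentially. 1 / 2 < measure Q (S k)"
    by (intro order_tendstoD(1)) auto
  then obtain k where k: "1 / 2 < measure Q (S k)"
    by (meson eventually_happens sequentially_bot)
  \<comment> \<open>Half the shortfall on \<open>S k\<close>: the threshold \<beta> - c for the
    Birkhoff averages lies at distance c above the means \<open>m q\<close>, which are at most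
    \<beta> - 2 c.\<close>
  define c where "c = 1 / real (Suc k)"
  have c: "0 < c" by (simp add: c_def)
  have Sk: "m q \<le> \<beta> - 2 * c" if "q \<in> S k" for q using that by (simp add: S_def c_def)
  obtain N where N: "1 \<le> N" "\<And>x. x \<in> X \<Longrightarrow> birkhoff T \<phi> N x \<le> \<beta> + c / 16"
    using max_mean_approx_above[OF \<phi>, of "c / 16"] c by (auto simp: \<beta>_def)
  \<comment> \<open>Only multiples of N are used as lengths, because for them the upper bound
    \<beta> + c / 16 holds at every point of X.\<close>
  define A where "A j = birkhoff T \<phi> (Suc j * N)" for j
  have A_le: "A j x \<le> \<beta> + c / 16" if "x \<in> X" for j x
    unfolding A_def using birkhoff_mult_le[OF N(2) that N(1), of "Suc j"] by simp
  have A_cont: "continuous_on X (A j)" for j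
    unfolding A_def by (rule continuous_on_birkhoff[OF \<phi>])
  define g where "g j x = min 1 (max 0 ((\<beta> - A j x) / c))" for j x
  have g_cont: "continuous_on X (g j)" for j
    unfolding g_def[abs_def] divide_inverse by (intro continuous_intros A_cont)
  have g01: "0 \<le> g j x" "g j x \<le> 1" for j x by (auto simp: g_def)
  \<comment> \<open>The slope hypothesis for \<open>c * g j\<close>, whose norm is at most c, costs
    c / 4, and the maximal mean rises by at most c / 16. Together these make 5 / 16.\<close>
  have upper: "bary (g j) \<le> 5 / 16" for j
  proof -
    have bc: "bary (\<lambda>x. c * g j x) = c * bary (g j)" by simp
    have "\<beta> + c * bary (g j) - c / 4 \<le> max_mean X T (\<lambda>x. \<phi> x + c * g j x)"
      unfolding \<beta>_def bc[symmetric] using c g01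
      by (intro slope continuous_intros g_cont) (auto simp: abs_mult mult_le_cancel_left1)
    also have "\<dots> \<le> \<beta> + c / 16"
    proof (rule max_mean_cohomologous_le[OF \<phi>])
      show "1 \<le> Suc j * N" using N(1) by simp
      fix x assume x: "x \<in> X"
      have "c * g j x \<le> max 0 (\<beta> - A j x)"
        using c by (auto simp: g_def min_def max_def field_simps)
      thus "birkhoff T \<phi> (Suc j * N) x + c * g j x \<le> \<beta> + c / 16"
        using A_le[OF x, of j] c by (auto simp: A_def max_def split: if_splits)
    qed (intro continuous_intros g_cont)
    finally have "c * bary (g j) \<le> c * (5 / 16)" by simp
    thus ?thesis using c by (simp only: mult_le_cancel_left_pos)
  qed
  have h_bound: "0 \<le> (\<integral>x. g j x \<partial>\<mu> q)" "(\<integral>x. g j x \<partial>\<mu> q) \<le> 1" if "q \<in> space Q" for j q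
    using integral_abs_le[OF g_cont _ that, of j 1] g01 by (auto intro!: Bochner_Integration.integral_nonneg)
  have h_lim: "(\<lambda>j. \<integral>x. g j x \<partial>\<mu> q) \<longlonglongrightarrow> 1" if q: "q \<in> S k" for q
  proof (rule tendsto_sandwich)
    have qQ: "q \<in> space Q" using q by (simp add: S_def)
    note inv = invariant[OF qQ]
    interpret prob_space "\<mu> q" by (rule invariant_measuresD(1)[OF inv])
    let ?a = "\<lambda>n. \<integral>x. \<bar>birkhoff T \<phi> n x - m q\<bar> \<partial>\<mu> q"
    have "?a \<longlonglongrightarrow> 0" unfolding m_def by (rule mean_ergodic[OF qQ \<phi>])
    moreover have "filterlim (\<lambda>j. Suc j * N) at_top sequentially"
      using N(1) by (intro filterlim_subseq) (auto simp: strict_mono_Suc_iff)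
    ultimately have "(\<lambda>j. ?a (Suc j * N)) \<longlonglongrightarrow> 0"
      by (rule filterlim_compose)
    hence "(\<lambda>j. 1 - ?a (Suc j * N) / c) \<longlonglongrightarrow> 1 - 0 / c"
      by (intro tendsto_intros) (use c in auto)
    thus "(\<lambda>j. 1 - ?a (Suc j * N) / c) \<longlonglongrightarrow> 1" by simp
    show "\<forall>\<^sub>F j in sequentially. 1 - ?a (Suc j * N) / c \<le> (\<integral>x. g j x \<partial>\<mu> q)"
    proof (intro always_eventually allI)
      fix j
      have int: "integrable (\<mu> q) (\<lambda>x. \<bar>A j x - m q\<bar>)"
        by (intro integrable_abs continuous_integrable[OF _ inv] continuous_intros A_cont)
      have "1 - ?a (Suc j * N) / c = (\<integral>x. 1 - \<bar>A j x - m q\<bar> / c \<partial>\<mu> q)"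
        using int by (simp add: A_def prob_space)
      also have "\<dots> \<le> (\<integral>x. g j x \<partial>\<mu> q)"
      proof (intro integral_mono)
        show "integrable (\<mu> q) (\<lambda>x. 1 - \<bar>A j x - m q\<bar> / c)" using int by simp
        show "integrable (\<mu> q) (\<lambda>x. g j x)" by (intro continuous_integrable[OF _ inv] g_cont)
        fix x assume "x \<in> space (\<mu> q)"
        \<comment> \<open>Where the average is at most \<beta> - c the truncation equals 1;
          elsewhere the average deviates from \<open>m q\<close> by at least c and the left side is
          not positive.\<close>
        show "1 - \<bar>A j x - m q\<bar> / c \<le> g j x"
        proof (cases "A j x \<le> \<beta> - c")
          case True
          hence "1 \<le> (\<beta> - A j x) / c" using c by (simp add: field_simps)
          thus ?thesis using c by (simp add: g_def)
        next
          case False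
          hence "c \<le> \<bar>A j x - m q\<bar>" using Sk[OF q] by simp
          hence "1 \<le> \<bar>A j x - m q\<bar> / c" using c by (simp add: field_simps)
          thus ?thesis using g01(1)[of j x] by linarith
        qed
      qed
      finally show "1 - ?a (Suc j * N) / c \<le> (\<integral>x. g j x \<partial>\<mu> q)" .
    qed
    show "\<forall>\<^sub>F j in sequentially. (\<integral>x. g j x \<partial>\<mu> q) \<le> 1"
      using h_bound(2)[OF qQ] by simp
  qed simp
  \<comment> \<open>The limit is the measure of \<open>S k\<close>, above 1/2, while every term is
    at most 5/16.\<close>
  have "(\<lambda>j. \<integral>q. indicator (S k) q * (\<integral>x. g j x \<partial>\<mu> q) \<partial>Q) \<longlonglongrightarrow> (\<integral>q. indicator (S k) q \<partial>Q)"
  proof (rule integral_dominated_convergence[where w = "\<lambda>_. 1"])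
    show "AE q in Q. (\<lambda>j. indicator (S k) q * (\<integral>x. g j x \<partial>\<mu> q)) \<longlonglongrightarrow> indicator (S k) q"
      using h_lim by (intro AE_I2) (auto simp: indicator_def)
    show "AE q in Q. norm (indicator (S k) q * (\<integral>x. g j x \<partial>\<mu> q)) \<le> 1" for j
      using h_bound by (intro AE_I2) (auto simp: indicator_def)
  qed (use S_sets measurable_integral[OF g_cont] in auto)
  moreover have "(\<integral>q. indicator (S k) q * (\<integral>x. g j x \<partial>\<mu> q) \<partial>Q) \<le> 5 / 16" for j
  proof -
    have "(\<integral>q. indicator (S k) q * (\<integral>x. g j x \<partial>\<mu> q) \<partial>Q) \<le> bary (g j)"
    proof (rule integral_mono)
      show "integrable Q (\<lambda>q. indicator (S k) q * (\<integral>x. g j x \<partial>\<mu> q))"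
        using integrable_real_mult_indicator[OF S_sets integrable_integral[OF g_cont]] by (simp add: mult.commute)
    qed (use h_bound in \<open>auto simp: indicator_def intro!: integrable_integral g_cont\<close>)
    thus ?thesis using upper[of j] by simp
  qed
  ultimately have "(\<integral>q. indicator (S k) q \<partial>Q) \<le> (5 / 16 :: real)"
    by (intro LIMSEQ_le_const2) auto
  thus False using k S_sets by simp
qed

text \<open>Ekeland's principle with slope 1/4 descends from a value at most \<delta> to a
  nonnegative one, so it moves by at most 4 \<delta>. The minimality of the point reached is the
  slope hypothesis of \<open>uncountable_of_slope\<close>.\<close>

theorem perturbation:
  assumes \<phi>0: "\<phi>0 \<in> mspace (C_space X)" and \<delta>: "0 < \<delta>"
    and near: "\<And>q. q \<in> space Q \<Longrightarrow> max_mean X T \<phi>0 - \<delta> \<le> (\<integral>x. \<phi>0 x \<partial>\<mu> q)"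
  shows "\<exists>\<phi>\<in>mspace (C_space X). mdist (C_space X) \<phi>0 \<phi> \<le> 4 * \<delta> \<and>
    uncountable {q \<in> space Q. (\<integral>x. \<phi> x \<partial>\<mu> q) = max_mean X T \<phi>}"
proof -
  let ?M = "mspace (C_space X) :: ('b \<Rightarrow> real) set" and ?d = "mdist (C_space X) :: ('b \<Rightarrow> real) \<Rightarrow> _"
  interpret C: Metric_space ?M ?d by simp
  \<comment> \<open>F is nonnegative because no invariant integral exceeds the maximal mean, and
    2-Lipschitz because both of its terms are 1-Lipschitz.\<close>
  define F where "F f = max_mean X T f - bary f" for f
  have cont: "continuous_on X f" if "f \<in> ?M" for f using that by (simp add: mspace_C_space)
  have F_le: "F f \<le> F g + 2 * ?d f g" if fg: "f \<in> ?M" "g \<in> ?M" for f g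
  proof -
    note d = mdist_C_space[OF fg]
    have "max_mean X T f \<le> max_mean X T g + ?d f g"
      using d by (intro max_mean_lipschitz cont fg) (auto simp: abs_le_iff algebra_simps)
    moreover have "bary g \<le> bary f + ?d f g"
      using d by (intro bary_le cont fg) (force simp: abs_le_iff)
    ultimately show ?thesis by (simp add: F_def)
  qed
  have "\<exists>\<phi>\<in>?M. F \<phi> + 1/4 * ?d \<phi>0 \<phi> \<le> F \<phi>0 \<and> (\<forall>\<psi>\<in>?M. F \<phi> \<le> F \<psi> + 1/4 * ?d \<phi> \<psi>)"
  proof (rule C.ekeland_variational_principle[where L = 2 and b = 0])
    show "C.mcomplete" using mcomplete_C_space by (simp add: mcomplete_of_def)
    show "\<bar>F f - F g\<bar> \<le> 2 * ?d f g" if "f \<in> ?M" "g \<in> ?M" for f g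
      using F_le[OF that] F_le[OF that(2,1)] C.commute[of f g] by linarith
    show "0 \<le> F f" if "f \<in> ?M" for f
      using bary_le_max_mean[OF cont[OF that]] by (simp add: F_def)
  qed (use \<phi>0 in auto)
  then obtain \<phi> where \<phi>: "\<phi> \<in> ?M" "F \<phi> + 1/4 * ?d \<phi>0 \<phi> \<le> F \<phi>0"
    and min: "\<And>\<psi>. \<psi> \<in> ?M \<Longrightarrow> F \<phi> \<le> F \<psi> + 1/4 * ?d \<phi> \<psi>" by blast
  have "F \<phi>0 \<le> \<delta>"
  proof -
    have "(\<integral>q. max_mean X T \<phi>0 - \<delta> \<partial>Q) \<le> bary \<phi>0"
      using near by (intro integral_mono integrable_integral cont \<phi>0) auto
    thus ?thesis by (simp add: F_def Q.prob_space)
  qed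
  moreover have "0 \<le> F \<phi>"
    using bary_le_max_mean[OF cont[OF \<phi>(1)]] by (simp add: F_def)
  ultimately have "?d \<phi>0 \<phi> \<le> 4 * \<delta>" using \<phi>(2) by simp
  moreover have "uncountable {q \<in> space Q. (\<integral>x. \<phi> x \<partial>\<mu> q) = max_mean X T \<phi>}"
  proof (rule uncountable_of_slope[OF cont[OF \<phi>(1)]])
    fix g :: "'b \<Rightarrow> real" and B assume g: "continuous_on X g" "\<And>x. x \<in> X \<Longrightarrow> \<bar>g x\<bar> \<le> B" "0 \<le> B"
    \<comment> \<open>Elements of \<open>C_space X\<close> must be \<open>undefined\<close> outside
      X, so the sum is restricted; both versions agree on X, which is all that
      \<open>max_mean\<close> and \<open>bary\<close> see.\<close>
    define \<psi> where "\<psi> = restrict (\<lambda>x. \<phi> x + g x) X"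
    have c\<psi>: "continuous_on X (\<lambda>x. \<phi> x + g x)"
      using g(1) cont[OF \<phi>(1)] by (intro continuous_intros)
    hence \<psi>: "\<psi> \<in> ?M" by (simp add: mspace_C_space \<psi>_def)
    have "?d \<phi> \<psi> \<le> B" using g by (intro mdist_C_space_le) (auto simp: \<psi>_def)
    hence "F \<phi> \<le> F \<psi> + B / 4" using min[OF \<psi>] by simp
    moreover have "max_mean X T \<psi> \<le> max_mean X T (\<lambda>x. \<phi> x + g x) + 0"
      by (intro max_mean_lipschitz cont[OF \<psi>] c\<psi>) (simp add: \<psi>_def)
    moreover have "bary (\<lambda>x. \<phi> x + g x) \<le> bary \<psi> + 0"
      by (intro bary_le cont[OF \<psi>] c\<psi>) (simp add: \<psi>_def)
    ultimately show "max_mean X T \<phi> + bary g - B / 4 \<le> max_mean X T (\<lambda>x. \<phi> x + g x)"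
      using bary_add[OF cont[OF \<phi>(1)] g(1)] by (simp add: F_def)
  qed
  ultimately show ?thesis using \<phi>(1) by blast
qed

end

section \<open>Mixing systems and Bernoulli shifts\<close>

lemma birkhoff_linear_combination:
  "birkhoff T (\<lambda>x. \<Sum>j\<in>J. c j * g j x) n x = (\<Sum>j\<in>J. c j * birkhoff T (g j) n x)"
  unfolding birkhoff_def by (subst sum.swap) (simp add: sum_divide_distrib sum_distrib_left)

text \<open>The sets A with the asserted limit form a Dynkin class. Both f and C may vary with n, so
  that the lemma extends either argument of the mixing property: with f the identity and C a shifted
  preimage, or with f a power of the shift and C constant.\<close>

lemma (in prob_space) tendsto_prob_Dynkin:
  assumes gen: "Int_stable G" "G \<subseteq> Pow (space M)" "sets M = sigma_sets (space M) G"
    and f [measurable]: "\<And>n :: nat. f n \<in> measurable M M"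
    and pres: "\<And>n A. A \<in> sets M \<Longrightarrow> prob {x \<in> space M. f n x \<in> A} = prob A"
    and C [measurable]: "\<And>n. C n \<in> sets M" and space: "(\<lambda>n. prob (C n)) \<longlonglongrightarrow> c"
    and basic: "\<And>A. A \<in> G \<Longrightarrow> (\<lambda>n. prob {x \<in> C n. f n x \<in> A}) \<longlonglongrightarrow> prob A * c"
    and A: "A \<in> sets M"
  shows "(\<lambda>n. prob {x \<in> C n. f n x \<in> A}) \<longlonglongrightarrow> prob A * c"
proof -
  have sets: "{x \<in> C n. f n x \<in> A} \<in> sets M" if "A \<in> sets M" for A n
  proof -
    have "{x \<in> C n. f n x \<in> A} = C n \<inter> (f n -` A \<inter> space M)"
      using sets.sets_into_space[OF C] by blast
    thus ?thesis using measurable_sets[OF f that] by simp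
  qed
  show ?thesis
    using A[unfolded gen(3)]
  proof (induction A rule: sigma_sets_induct_disjoint[OF gen(1,2), consumes 1])
    case (3 A)
    hence A: "A \<in> sets M" by (simp add: gen(3))
    have "{x \<in> C n. f n x \<in> space M - A} = C n - {x \<in> C n. f n x \<in> A}" for n
      using sets.sets_into_space[OF C] measurable_space[OF f] by blast
    hence "prob {x \<in> C n. f n x \<in> space M - A} = prob (C n) - prob {x \<in> C n. f n x \<in> A}" for n
      using sets[OF A] by (simp add: finite_measure_Diff)
    moreover have "(\<lambda>n. prob (C n) - prob {x \<in> C n. f n x \<in> A}) \<longlonglongrightarrow> c - prob A * c"
      by (intro tendsto_intros space 3)
    moreover have "prob (space M - A) * c = c - prob A * c"
      using prob_compl[OF A] by (simp add: left_diff_distrib)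
    ultimately show ?case by simp
  next
    case (4 F)
    hence F: "range F \<subseteq> sets M" "disjoint_family F" by (auto simp: gen(3))
    have s: "(\<lambda>i. prob (F i)) sums prob (\<Union>i. F i)" by (rule finite_measure_UNION[OF F])
    \<comment> \<open>Limit and infinite sum are exchanged by Tannery's theorem; since f n preserves
      the measure, the summable sequence \<open>prob (F i)\<close> dominates.\<close>
    have "(\<lambda>n. \<Sum>i. prob {x \<in> C n. f n x \<in> F i}) \<longlonglongrightarrow> (\<Sum>i. prob (F i) * c)"
    proof (rule conjunct2[OF conjunct2[OF tannerys_theorem[where M = "\<lambda>i. prob (F i)"]]])
      have "prob {x \<in> C n. f n x \<in> F i} \<le> prob (F i)" for i n
      proof -
        have "F i \<in> sets M" using F(1) by auto
        hence "prob {x \<in> C n. f n x \<in> F i} \<le> prob {x \<in> space M. f n x \<in> F i}"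
          using sets.sets_into_space[OF C] by (intro finite_measure_mono) auto
        thus ?thesis using pres[OF \<open>F i \<in> sets M\<close>] by simp
      qed
      thus "\<forall>\<^sub>F (i, n) in at_top \<times>\<^sub>F sequentially. norm (prob {x \<in> C n. f n x \<in> F i}) \<le> prob (F i)"
        by (intro always_eventually) auto
    qed (use 4 s in \<open>auto simp: sums_iff\<close>)
    moreover have "(\<Sum>i. prob {x \<in> C n. f n x \<in> F i}) = prob {x \<in> C n. f n x \<in> (\<Union>i. F i)}" for n
    proof -
      have "(\<lambda>i. prob {x \<in> C n. f n x \<in> F i}) sums prob (\<Union>i. {x \<in> C n. f n x \<in> F i})"
        using F sets by (intro finite_measure_UNION) (auto simp: disjoint_family_on_def)
      moreover have "(\<Union>i. {x \<in> C n. f n x \<in> F i}) = {x \<in> C n. f n x \<in> (\<Union>i. F i)}" by auto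
      ultimately show ?thesis by (simp add: sums_iff)
    qed
    moreover have "(\<Sum>i. prob (F i) * c) = prob (\<Union>i. F i) * c"
      using s by (simp add: suminf_mult2[symmetric] sums_iff)
    ultimately show ?case by simp
  qed (use basic in auto)
qed

lemma cesaro_null:
  fixes a :: "nat \<Rightarrow> real"
  assumes "a \<longlonglongrightarrow> 0"
  shows "(\<lambda>n. (\<Sum>k<n. a k) / real n) \<longlonglongrightarrow> 0"
proof (rule LIMSEQ_I)
  fix e :: real assume e: "0 < e"
  obtain N where N: "\<And>k. k \<ge> N \<Longrightarrow> \<bar>a k\<bar> < e / 2"
    using LIMSEQ_D[OF assms, of "e / 2"] e by auto
  define C where "C = (\<Sum>k<N. \<bar>a k\<bar>)"
  obtain m where m: "2 * C / e < real m" using reals_Archimedean2 by blast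
  show "\<exists>n0. \<forall>n\<ge>n0. norm ((\<Sum>k<n. a k) / real n - 0) < e"
  proof (intro exI allI impI)
    fix n assume n: "max (Suc N) m \<le> n"
    have un: "{..<n} = {..<N} \<union> {N..<n}" using n by auto
    have "(\<Sum>k<n. \<bar>a k\<bar>) = C + (\<Sum>k=N..<n. \<bar>a k\<bar>)"
      unfolding un C_def by (rule sum.union_disjoint) auto
    also have "\<dots> \<le> C + (\<Sum>k=N..<n. e / 2)"
      using N by (intro add_left_mono sum_mono) (auto intro: less_imp_le)
    also have "\<dots> \<le> C + n * (e / 2)" using e by (auto intro!: mult_right_mono)
    also have "C < n * (e / 2)"
    proof -
      have "2 * C / e < real n" using m n by linarith
      thus ?thesis using e by (simp add: field_simps)
    qed
    finally have "(\<Sum>k<n. \<bar>a k\<bar>) < n * e" by (simp add: field_simps)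
    hence "\<bar>\<Sum>k<n. a k\<bar> < n * e" using sum_abs[of a "{..<n}"] by linarith
    thus "norm ((\<Sum>k<n. a k) / real n - 0) < e" using n by (simp add: abs_divide field_simps)
  qed
qed

section \<open>The mean ergodic theorem for mixing transformations\<close>

locale mixing_system = prob_space M for M :: "'b measure" +
  fixes T :: "'b \<Rightarrow> 'b"
  assumes T_measurable [measurable]: "T \<in> measurable M M"
    and T_preserves: "distr M M T = M"
    and mixing: "\<And>A B. A \<in> sets M \<Longrightarrow> B \<in> sets M \<Longrightarrow>
      (\<lambda>n. prob {x \<in> space M. x \<in> A \<and> (T ^^ n) x \<in> B}) \<longlonglongrightarrow> prob A * prob B"
begin

lemma funpow_measurable [measurable]: "(T ^^ n) \<in> measurable M M"
  by (induction n) (auto simp: id_def intro: measurable_comp[OF _ T_measurable])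

lemma distr_funpow: "distr M M (T ^^ n) = M"
proof (induction n)
  case (Suc n)
  have "distr M M (T \<circ> (T ^^ n)) = distr (distr M M (T ^^ n)) M T"
    by (rule distr_distr[symmetric]) measurable
  thus ?case unfolding funpow.simps Suc T_preserves .
qed (simp add: id_def)

lemma integral_funpow:
  fixes f :: "'b \<Rightarrow> real"
  assumes "f \<in> borel_measurable M"
  shows "(\<integral>x. f ((T ^^ n) x) \<partial>M) = (\<integral>x. f x \<partial>M)"
  using integral_distr[OF funpow_measurable[of n] assms] unfolding distr_funpow by simp

lemma prob_funpow:
  assumes "A \<in> sets M"
  shows "prob {x \<in> space M. (T ^^ n) x \<in> A} = prob A"
  using measure_distr[OF funpow_measurable[of n] assms] unfolding distr_funpow
  by (simp add: vimage_def Int_def conj_commute)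

text \<open>A point of A stays in A, so mixing of A with itself reads
  \<open>prob A = prob A * prob A\<close>.\<close>

lemma prob_forward_invariant:
  assumes A: "A \<in> sets M" and inv: "\<And>x. x \<in> A \<Longrightarrow> T x \<in> A"
  shows "prob A = 0 \<or> prob A = 1"
proof -
  have "(T ^^ n) x \<in> A" if "x \<in> A" for n x by (induction n) (use that inv in auto)
  hence "{x \<in> space M. x \<in> A \<and> (T ^^ n) x \<in> A} = A" for n
    using sets.sets_into_space[OF A] by auto
  hence "(\<lambda>_::nat. prob A) \<longlonglongrightarrow> prob A * prob A" using mixing[OF A A] by simp
  hence "prob A = prob A * prob A" by (simp add: LIMSEQ_const_iff)
  thus ?thesis by auto
qed

lemma integrable_bounded:
  fixes f :: "'b \<Rightarrow> real"
  assumes "f \<in> borel_measurable M" "\<And>x. x \<in> space M \<Longrightarrow> \<bar>f x\<bar> \<le> B"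
  shows "integrable M f"
  using assms by (intro integrable_const_bound[of _ B]) auto

lemma integrable_indicator_set: "A \<in> sets M \<Longrightarrow> integrable M (indicator A :: 'b \<Rightarrow> real)"
  by (intro integrable_bounded[of _ 1]) auto

lemma birkhoff_measurable [measurable]:
  assumes [measurable]: "f \<in> borel_measurable M"
  shows "birkhoff T f n \<in> borel_measurable M"
  unfolding birkhoff_def[abs_def] by measurable

text \<open>A second moment estimate: mixing makes the correlations at lag k tend to 0, and the
  variance of the average is at most twice the Cesaro mean of their absolute values.\<close>

lemma mean_ergodic_indicator:
  assumes A [measurable]: "A \<in> sets M"
  shows "(\<lambda>n. \<integral>x. \<bar>birkhoff T (indicator A) n x - prob A\<bar> \<partial>M) \<longlonglongrightarrow> 0"
proof -
  define a where "a = prob A"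
  define r where "r k = \<bar>prob {x \<in> space M. x \<in> A \<and> (T ^^ k) x \<in> A} - a * a\<bar>" for k
  have a01: "0 \<le> a" "a \<le> 1" by (auto simp: a_def)
  have r0: "0 \<le> r k" for k by (simp add: r_def)
  have "(\<lambda>k. prob {x \<in> space M. x \<in> A \<and> (T ^^ k) x \<in> A} - a * a) \<longlonglongrightarrow> 0"
    using mixing[OF A A] by (auto simp: a_def intro: LIM_zero)
  hence "r \<longlonglongrightarrow> 0" unfolding r_def by (intro tendsto_rabs_zero)
  hence ces: "(\<lambda>n. (\<Sum>k<n. r k) / real n) \<longlonglongrightarrow> 0" by (rule cesaro_null)
  define u where "u i x = indicator A ((T ^^ i) x) - a" for i x
  have u_meas [measurable]: "u i \<in> borel_measurable M" for i unfolding u_def[abs_def] by measurable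
  have u_bd: "\<bar>u i x\<bar> \<le> 1" for i x using a01 by (auto simp: u_def indicator_def)
  have uu_int: "integrable M (\<lambda>x. u i x * u j x)" for i j
    using u_bd by (intro integrable_bounded[of _ 1]) (auto simp: abs_mult intro!: mult_le_one)
  have corr0: "\<bar>\<integral>x. u i x * u (i + k) x \<partial>M\<bar> = r k" for i k
  proof -
    define C where "C = {x \<in> space M. x \<in> A \<and> (T ^^ k) x \<in> A}"
    have C [measurable]: "C \<in> sets M" unfolding C_def by measurable
    have "(\<integral>x. u i x * u (i + k) x \<partial>M) = (\<integral>x. u 0 ((T ^^ i) x) * u k ((T ^^ i) x) \<partial>M)"
    proof -
      have "(T ^^ (i + k)) x = (T ^^ k) ((T ^^ i) x)" for x
        by (subst add.commute) (simp add: funpow_add)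
      thus ?thesis by (simp add: u_def)
    qed
    also have "\<dots> = (\<integral>x. u 0 x * u k x \<partial>M)"
      by (rule integral_funpow) measurable
    also have "\<dots> = (\<integral>x. indicator C x - a * indicator A x - a * indicator A ((T ^^ k) x) + a * a \<partial>M)"
      by (intro Bochner_Integration.integral_cong) (auto simp: C_def u_def algebra_simps indicator_def)
    also have "\<dots> = prob C - a * a - a * (\<integral>x. indicator A ((T ^^ k) x) \<partial>M) + a * a"
    proof -
      have "integrable M (\<lambda>x. indicator A ((T ^^ k) x) :: real)"
        by (intro integrable_bounded[of _ 1]) auto
      thus ?thesis
        using integrable_indicator_set[OF C] integrable_indicator_set[OF A] by (simp add: prob_space a_def)
    qed
    also have "(\<integral>x. indicator A ((T ^^ k) x) \<partial>M) = a"
      using integral_funpow[of "indicator A" k] by (simp add: a_def)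
    finally show ?thesis by (simp add: r_def C_def)
  qed
  have corr: "\<bar>\<integral>x. u i x * u j x \<partial>M\<bar> \<le> r (max i j - min i j)" for i j
    using corr0[of "min i j" "max i j - min i j"]
    by (cases "i \<le> j") (auto simp: max_def min_def mult.commute)
  let ?v = "\<lambda>n x. birkhoff T (indicator A) n x - a"
  have v: "?v n x = (\<Sum>i<n. u i x) / n" if "1 \<le> n" for n x
    using that by (simp add: birkhoff_def u_def sum_subtractf field_simps)
  have var: "(\<integral>x. (?v n x)\<^sup>2 \<partial>M) \<le> 2 * ((\<Sum>k<n. r k) / n)" if n: "1 \<le> n" for n
  proof -
    \<comment> \<open>For fixed i, every lag below n occurs at most once among \<open>j < i\<close>
      and at most once among \<open>i \<le> j\<close>, whence the factor 2.\<close>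
    have row: "(\<Sum>j<n. r (max i j - min i j)) \<le> 2 * (\<Sum>k<n. r k)" if "i < n" for i
    proof -
      have un: "{..<n} = {..<i} \<union> {i..<n}" using that by auto
      have "(\<Sum>j<n. r (max i j - min i j)) =
          (\<Sum>j<i. r (max i j - min i j)) + (\<Sum>j=i..<n. r (max i j - min i j))"
        unfolding un by (rule sum.union_disjoint) auto
      also have "(\<Sum>j<i. r (max i j - min i j)) = (\<Sum>j<i. r (i - j))"
        by (intro sum.cong) (auto simp: max_def min_def)
      also have "(\<Sum>j=i..<n. r (max i j - min i j)) = (\<Sum>j=i..<n. r (j - i))"
        by (intro sum.cong) (auto simp: max_def min_def)
      also have "(\<Sum>j<i. r (i - j)) = sum r ((\<lambda>j. i - j) ` {..<i})"
        by (subst sum.reindex) (auto simp: inj_on_def)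
      also have "\<dots> \<le> (\<Sum>k<n. r k)"
        using that r0 by (intro sum_mono2) auto
      also have "(\<Sum>j=i..<n. r (j - i)) = sum r ((\<lambda>j. j - i) ` {i..<n})"
        by (subst sum.reindex) (auto simp: inj_on_def)
      also have "\<dots> \<le> (\<Sum>k<n. r k)"
        using that r0 by (intro sum_mono2) auto
      finally show ?thesis by simp
    qed
    have "(\<integral>x. (?v n x)\<^sup>2 \<partial>M) = (\<integral>x. (\<Sum>i<n. \<Sum>j<n. u i x * u j x) / (real n)\<^sup>2 \<partial>M)"
      using n by (simp add: v power_divide power2_eq_square sum_product)
    also have "\<dots> = (\<Sum>i<n. \<Sum>j<n. (\<integral>x. u i x * u j x \<partial>M)) / (real n)\<^sup>2"
      using uu_int by simp
    also have "\<dots> \<le> (\<Sum>i<n. \<Sum>j<n. r (max i j - min i j)) / (real n)\<^sup>2"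
      using corr by (intro divide_right_mono sum_mono) (auto intro: order.trans[OF abs_ge_self])
    also have "\<dots> \<le> (\<Sum>i<n. 2 * (\<Sum>k<n. r k)) / (real n)\<^sup>2"
      using row by (intro divide_right_mono sum_mono) auto
    also have "\<dots> = 2 * ((\<Sum>k<n. r k) / n)" using n by (simp add: power2_eq_square)
    finally show ?thesis .
  qed
  have v_meas: "?v n \<in> borel_measurable M" for n by measurable
  have v_bd: "\<bar>?v n x\<bar> \<le> 1" if "1 \<le> n" for n x
  proof -
    have "\<bar>\<Sum>i<n. u i x\<bar> \<le> (\<Sum>i<n. 1)"
      using u_bd by (intro order.trans[OF sum_abs] sum_mono)
    thus ?thesis using that by (simp add: v abs_divide divide_le_eq)
  qed
  have L1: "(\<integral>x. \<bar>?v n x\<bar> \<partial>M) \<le> sqrt (2 * ((\<Sum>k<n. r k) / n))" if n: "1 \<le> n" for n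
  proof (rule real_le_rsqrt)
    have i1: "integrable M (\<lambda>x. \<bar>?v n x\<bar>)"
      using v_bd[OF n] v_meas by (intro integrable_bounded[of _ 1]) auto
    have i2: "integrable M (\<lambda>x. \<bar>?v n x\<bar>\<^sup>2)"
      using v_bd[OF n] v_meas by (intro integrable_bounded[of _ 1]) (auto simp: abs_square_le_1)
    \<comment> \<open>Nonnegativity of the variance of the absolute value plays the part of the
      Cauchy-Schwarz inequality.\<close>
    have "0 \<le> (\<integral>x. \<bar>?v n x\<bar>\<^sup>2 \<partial>M) - (\<integral>x. \<bar>?v n x\<bar> \<partial>M)\<^sup>2"
      using variance_positive[of "\<lambda>x. \<bar>?v n x\<bar>"] variance_eq[OF i1 i2] by simp
    thus "(\<integral>x. \<bar>?v n x\<bar> \<partial>M)\<^sup>2 \<le> 2 * ((\<Sum>k<n. r k) / n)" using var[OF n] by simp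
  qed
  have "(\<lambda>n. sqrt (2 * ((\<Sum>k<n. r k) / n))) \<longlonglongrightarrow> sqrt (2 * 0)"
    by (intro tendsto_intros ces)
  hence "(\<lambda>n. sqrt (2 * ((\<Sum>k<n. r k) / n))) \<longlonglongrightarrow> 0" by simp
  thus ?thesis
    unfolding a_def[symmetric]
  proof (rule tendsto_sandwich[OF _ _ tendsto_const, rotated 2])
    show "\<forall>\<^sub>F n in sequentially. (\<integral>x. \<bar>?v n x\<bar> \<partial>M) \<le> sqrt (2 * ((\<Sum>k<n. r k) / n))"
      by (intro eventually_sequentiallyI[of 1] L1)
  qed simp
qed

text \<open>A bounded function is uniformly close to a finite combination of indicators, and both
  the averages and the integral are contractions for the uniform norm.\<close>

theorem mean_ergodic:
  fixes f :: "'b \<Rightarrow> real"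
  assumes f [measurable]: "f \<in> borel_measurable M" and B: "\<And>x. x \<in> space M \<Longrightarrow> \<bar>f x\<bar> \<le> B"
  shows "(\<lambda>n. \<integral>x. \<bar>birkhoff T f n x - (\<integral>y. f y \<partial>M)\<bar> \<partial>M) \<longlonglongrightarrow> 0"
proof (rule LIMSEQ_I)
  fix e :: real assume "0 < e"
  \<comment> \<open>One share of d pays for the averages of the step function s, one for replacing f
    by s in the average and one for replacing it in the integral; the fourth makes the inequality
    strict.\<close>
  define d where "d = e / 4"
  have d: "0 < d" using \<open>0 < e\<close> by (simp add: d_def)
  define K where "K = \<lceil>B / d\<rceil> + 1"
  define A where "A j = {x \<in> space M. \<lfloor>f x / d\<rfloor> = j}" for j :: int
  have [measurable]: "A j \<in> sets M" for j unfolding A_def by measurable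
  define s where "s x = (\<Sum>j=-K..K. (d * of_int j) * indicator (A j) x)" for x
  have [measurable]: "s \<in> borel_measurable M" unfolding s_def[abs_def] by measurable
  have s_eq: "s x = d * \<lfloor>f x / d\<rfloor>" if x: "x \<in> space M" for x
  proof -
    have "-(B/d) \<le> f x / d" "f x / d \<le> B / d"
      using B[OF x] d by (auto simp: abs_le_iff field_simps)
    hence in_K: "\<lfloor>f x / d\<rfloor> \<in> {-K..K}" unfolding K_def by simp linarith
    have "s x = (\<Sum>j=-K..K. if j = \<lfloor>f x / d\<rfloor> then d * of_int j else 0)"
      using x unfolding s_def by (intro sum.cong) (auto simp: A_def indicator_def)
    thus ?thesis using in_K by (simp add: sum.delta)
  qed
  have fs: "\<bar>f x - s x\<bar> \<le> d" if x: "x \<in> space M" for x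
  proof -
    have "of_int \<lfloor>f x / d\<rfloor> \<le> f x / d" "f x / d \<le> of_int \<lfloor>f x / d\<rfloor> + 1" by linarith+
    hence "d * of_int \<lfloor>f x / d\<rfloor> \<le> d * (f x / d)" "d * (f x / d) \<le> d * (of_int \<lfloor>f x / d\<rfloor> + 1)"
      using d mult_left_mono[OF _ less_imp_le[OF d]] by blast+
    thus ?thesis using s_eq[OF x] d by (simp add: abs_le_iff algebra_simps)
  qed
  have f_int: "integrable M f" by (rule integrable_bounded[OF f B])
  have s_bd: "\<bar>s x\<bar> \<le> B + d" if "x \<in> space M" for x using fs[OF that] B[OF that] by linarith
  have s_int: "integrable M s" by (rule integrable_bounded[OF _ s_bd]) measurable
  have int_fs: "\<bar>(\<integral>x. f x \<partial>M) - (\<integral>x. s x \<partial>M)\<bar> \<le> d"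
  proof -
    have "\<bar>\<integral>x. f x - s x \<partial>M\<bar> \<le> (\<integral>x. \<bar>f x - s x\<bar> \<partial>M)"
      using integral_norm_bound[of M "\<lambda>x. f x - s x"] by simp
    also have "\<dots> \<le> (\<integral>x. d \<partial>M)" using fs f_int s_int by (intro integral_mono) auto
    finally show ?thesis using f_int s_int by (simp add: prob_space)
  qed
  have bir_int: "integrable M (birkhoff T g n)" if g: "integrable M g" for g :: "'b \<Rightarrow> real" and n
  proof -
    have "integrable M (\<lambda>x. g ((T ^^ k) x))" for k
      using integrable_distr[OF funpow_measurable[of k], of g] g unfolding distr_funpow by simp
    thus ?thesis unfolding birkhoff_def[abs_def] by (intro integrable_divide Bochner_Integration.integrable_sum)
  qed
  let ?I = "\<lambda>g n. \<integral>x. \<bar>birkhoff T g n x - (\<integral>y. g y \<partial>M)\<bar> \<partial>M"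
  have "(\<lambda>n. \<Sum>j=-K..K. \<bar>d * of_int j\<bar> * ?I (indicator (A j)) n) \<longlonglongrightarrow> (\<Sum>j=-K..K. \<bar>d * of_int j\<bar> * 0)"
    using mean_ergodic_indicator by (intro tendsto_intros) simp
  hence "\<forall>\<^sub>F n in sequentially. (\<Sum>j=-K..K. \<bar>d * of_int j\<bar> * ?I (indicator (A j)) n) < d"
    using d by (intro order_tendstoD(2)) auto
  moreover have "?I s n \<le> (\<Sum>j=-K..K. \<bar>d * of_int j\<bar> * ?I (indicator (A j)) n)" for n
  proof -
    have ind_int: "integrable M (indicator (A j) :: _ \<Rightarrow> real)" for j
      by (rule integrable_indicator_set) measurable
    have si: "(\<integral>x. s x \<partial>M) = (\<Sum>j=-K..K. d * of_int j * prob (A j))"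
      unfolding s_def[abs_def]
      by (subst Bochner_Integration.integral_sum) (use ind_int in auto)
    have "birkhoff T s n x = (\<Sum>j=-K..K. d * of_int j * birkhoff T (indicator (A j)) n x)" for x
      unfolding s_def[abs_def] by (rule birkhoff_linear_combination)
    hence "?I s n = (\<integral>x. \<bar>\<Sum>j=-K..K. d * of_int j * (birkhoff T (indicator (A j)) n x - prob (A j))\<bar> \<partial>M)"
      by (simp add: si right_diff_distrib sum_subtractf)
    also have "\<dots> \<le> (\<integral>x. (\<Sum>j=-K..K. \<bar>d * of_int j\<bar> * \<bar>birkhoff T (indicator (A j)) n x - prob (A j)\<bar>) \<partial>M)"
      using bir_int[OF ind_int]
      by (intro integral_mono order.trans[OF sum_abs] sum_mono) (auto simp: abs_mult intro!: integrable_abs)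
    also have "\<dots> = (\<Sum>j=-K..K. \<bar>d * of_int j\<bar> * ?I (indicator (A j)) n)"
      using bir_int[OF ind_int] by simp
    finally show ?thesis .
  qed
  ultimately have "\<forall>\<^sub>F n in sequentially. ?I s n < d"
    by (auto elim!: eventually_mono intro: le_less_trans)
  then obtain N where N: "\<And>n. n \<ge> N \<Longrightarrow> ?I s n < d" by (auto simp: eventually_sequentially)
  show "\<exists>N. \<forall>n\<ge>N. norm (?I f n - 0) < e"
  proof (intro exI allI impI)
    fix n assume n: "N \<le> n"
    have "?I f n \<le> (\<integral>x. \<bar>birkhoff T s n x - (\<integral>y. s y \<partial>M)\<bar> + 2 * d \<partial>M)"
    proof (rule integral_mono)
      fix x assume x: "x \<in> space M"
      have "(T ^^ k) x \<in> space M" for k using measurable_space[OF funpow_measurable x] .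
      hence "\<bar>(\<Sum>k<n. f ((T ^^ k) x) - s ((T ^^ k) x))\<bar> \<le> (\<Sum>k<n. d)"
        using fs by (intro order.trans[OF sum_abs] sum_mono) auto
      hence "\<bar>birkhoff T f n x - birkhoff T s n x\<bar> \<le> d"
        using d by (cases "n = 0")
          (auto simp: birkhoff_def sum_subtractf abs_divide divide_le_eq mult.commute simp flip: diff_divide_distrib)
      thus "\<bar>birkhoff T f n x - (\<integral>y. f y \<partial>M)\<bar> \<le> \<bar>birkhoff T s n x - (\<integral>y. s y \<partial>M)\<bar> + 2 * d"
        using int_fs by linarith
    qed (use bir_int[OF f_int] bir_int[OF s_int] in \<open>auto intro!: integrable_abs\<close>)
    also have "\<dots> = ?I s n + 2 * d"
      using bir_int[OF s_int] by (simp add: prob_space)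
    also have "\<dots> < e" using N[OF n] d by (simp add: d_def)
    finally have "?I f n < e" .
    moreover have "0 \<le> ?I f n" by simp
    ultimately show "norm (?I f n - 0) < e" by simp
  qed
qed

end

lemma funpow_left_shift: "(left_shift ^^ n) x = (\<lambda>i. x (i + of_nat n))"
  by (induction n arbitrary: x) (auto simp: left_shift_def algebra_simps funpow_swap1)

section \<open>Mixing of Bernoulli shifts\<close>

text \<open>Two cylinders depend on finite sets of coordinates, which a large shift makes disjoint;
  from then on they are exactly independent. A Dynkin argument in each variable carries the limit to
  all measurable sets.\<close>

theorem bernoulli_mixing:
  assumes "prob_space D"
  shows "mixing_system (PiM (UNIV :: int set) (\<lambda>_. D)) left_shift"
proof -
  interpret D: prob_space D by fact
  let ?W = "PiM (UNIV :: int set) (\<lambda>_. D)"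
  interpret W: prob_space ?W by (intro prob_space_PiM) (rule assms)
  interpret product_prob_space "\<lambda>_. D" "UNIV :: int set" by unfold_locales
  have meas [measurable]: "(left_shift ^^ n) \<in> measurable ?W ?W" for n
    unfolding funpow_left_shift[abs_def] by (intro measurable_PiM_single') (auto simp: space_PiM)
  have pres: "distr ?W ?W (left_shift ^^ n) = ?W" for n
    using distr_PiM_reindex[of "UNIV :: int set" "\<lambda>_. D" "\<lambda>i. i + of_nat n" UNIV] assms
    unfolding funpow_left_shift[abs_def] by (simp add: inj_on_def restrict_UNIV)
  define G where "G = prod_algebra (UNIV :: int set) (\<lambda>_. D)"
  have gen: "Int_stable G" "G \<subseteq> Pow (space ?W)" "sets ?W = sigma_sets (space ?W) G"
    unfolding G_def using prod_algebra_sets_into_space[of "UNIV :: int set" "\<lambda>_. D"]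
    by (auto simp: Int_stable_prod_algebra sets_PiM space_PiM)
  define \<nu> where "\<nu> A B n = W.prob {x \<in> space ?W. x \<in> A \<and> (left_shift ^^ n) x \<in> B}" for A B n
  have prob_pre: "W.prob {x \<in> space ?W. (left_shift ^^ n) x \<in> B} = W.prob B" if "B \<in> sets ?W" for B n
    using measure_distr[OF meas[of n] that] unfolding pres by (simp add: vimage_def Int_def conj_commute)
  have GG: "\<nu> A B \<longlonglongrightarrow> W.prob A * W.prob B" if AB: "A \<in> G" "B \<in> G" for A B
  proof -
    obtain I E where A: "A = prod_emb UNIV (\<lambda>_. D) I (Pi\<^sub>E I E)" "finite I" "\<And>i. i \<in> I \<Longrightarrow> E i \<in> sets D"
      using prod_algebraE[OF AB(1)[unfolded G_def]] by metis
    obtain J E' where B: "B = prod_emb UNIV (\<lambda>_. D) J (Pi\<^sub>E J E')" "finite J" "\<And>i. i \<in> J \<Longrightarrow> E' i \<in> sets D"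
      using prod_algebraE[OF AB(2)[unfolded G_def]] by metis
    \<comment> \<open>All coordinates lie strictly between -b and b, so translating J by at least 2
      b separates it from I.\<close>
    obtain b where b: "\<And>i. i \<in> I \<union> J \<Longrightarrow> \<bar>i\<bar> < b"
    proof
      fix i assume "i \<in> I \<union> J"
      hence "\<bar>i\<bar> \<le> Max (abs ` (I \<union> J))" using A(2) B(2) by (intro Max_ge) auto
      thus "\<bar>i\<bar> < Max (abs ` (I \<union> J)) + 1" by simp
    qed
    have "\<nu> A B n = W.prob A * W.prob B" if n: "nat (2 * b) \<le> n" for n
    proof -
      define J' where "J' = (\<lambda>j. j + int n) ` J"
      define F where "F i = (if i \<in> I then E i else E' (i - int n))" for i
      have disj: "I \<inter> J' = {}"
      proof (rule ccontr)
        assume "I \<inter> J' \<noteq> {}"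
        then obtain j where "j \<in> J" "j + int n \<in> I" by (auto simp: J'_def)
        thus False using b[of j] b[of "j + int n"] n by auto
      qed
      have fin: "finite J'" using B(2) by (simp add: J'_def)
      have FI: "F i = E i" if "i \<in> I" for i using that by (simp add: F_def)
      have FJ: "F (j + int n) = E' j" if "j \<in> J" for j
        using that disj by (auto simp: F_def J'_def)
      have "{x \<in> space ?W. x \<in> A \<and> (left_shift ^^ n) x \<in> B} = prod_emb UNIV (\<lambda>_. D) (I \<union> J') (Pi\<^sub>E (I \<union> J') F)"
        unfolding A(1) B(1) funpow_left_shift
        by (auto simp: prod_emb_def space_PiM PiE_iff J'_def FI FJ ball_Un)
      hence "\<nu> A B n = (\<Prod>i\<in>I \<union> J'. D.prob (F i))"
        unfolding \<nu>_def using A B fin FI FJ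
        by (subst measure_PiM_emb[symmetric]) (auto simp: J'_def)
      also have "\<dots> = (\<Prod>i\<in>I. D.prob (F i)) * (\<Prod>i\<in>J'. D.prob (F i))"
        using A(2) fin disj by (intro prod.union_disjoint)
      also have "(\<Prod>i\<in>J'. D.prob (F i)) = (\<Prod>j\<in>J. D.prob (E' j))"
        unfolding J'_def by (subst prod.reindex) (auto simp: FJ inj_on_def intro!: prod.cong)
      also have "(\<Prod>i\<in>I. D.prob (F i)) = (\<Prod>i\<in>I. D.prob (E i))"
        by (simp add: FI)
      finally show ?thesis using A B by (simp add: measure_PiM_emb)
    qed
    hence "\<forall>\<^sub>F n in sequentially. \<nu> A B n = W.prob A * W.prob B"
      by (intro eventually_sequentiallyI)
    thus ?thesis by (rule tendsto_eventually)
  qed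
  \<comment> \<open>The first argument is made general while B is still a cylinder; the second
    follows in \<open>AB\<close>.\<close>
  have AG: "\<nu> A B \<longlonglongrightarrow> W.prob A * W.prob B" if A: "A \<in> sets ?W" and B: "B \<in> G" for A B
  proof -
    let ?C = "\<lambda>n. {x \<in> space ?W. (left_shift ^^ n) x \<in> B}"
    have Bs [measurable]: "B \<in> sets ?W" using B by (auto simp: gen(3))
    have eq: "\<nu> A B = (\<lambda>n. W.prob {x \<in> ?C n. x \<in> A})" for A
      unfolding \<nu>_def by (intro ext arg_cong[where f = W.prob]) blast
    have "(\<lambda>n. W.prob {x \<in> ?C n. x \<in> A}) \<longlonglongrightarrow> W.prob A * W.prob B"
    proof (rule W.tendsto_prob_Dynkin[OF gen, of "\<lambda>_ x. x"])
      show "W.prob {x \<in> space ?W. x \<in> A} = W.prob A" if "A \<in> sets ?W" for A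
        using sets.sets_into_space[OF that] by (intro arg_cong[where f = W.prob]) blast
    qed (use A GG[OF _ B, unfolded eq] prob_pre[OF Bs] in auto)
    thus ?thesis unfolding eq .
  qed
  have AB: "\<nu> A B \<longlonglongrightarrow> W.prob A * W.prob B" if A: "A \<in> sets ?W" and B: "B \<in> sets ?W" for A B
  proof -
    have eq: "\<nu> A B = (\<lambda>n. W.prob {x \<in> A. (left_shift ^^ n) x \<in> B})" for B
      unfolding \<nu>_def using sets.sets_into_space[OF A] by (intro ext arg_cong[where f = W.prob]) blast
    have "(\<lambda>n. W.prob {x \<in> A. (left_shift ^^ n) x \<in> B}) \<longlonglongrightarrow> W.prob B * W.prob A"
      by (rule W.tendsto_prob_Dynkin[OF gen meas prob_pre _ _ _ B])
        (use A AG[OF A, unfolded eq] in \<open>simp_all add: mult.commute\<close>)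
    thus ?thesis unfolding eq by (simp only: mult.commute)
  qed
  show ?thesis
  proof
    show "left_shift \<in> measurable ?W ?W" using meas[of 1] by simp
    show "distr ?W ?W left_shift = ?W" using pres[of 1] by simp
  qed (use AB in \<open>simp add: \<nu>_def[abs_def]\<close>)
qed

section \<open>Block graphs of mixing subshifts\<close>

text \<open>\<open>\<iota>\<close> embeds the index type \<open>nat\<close> or \<open>int\<close> into \<open>int\<close>, so that both kinds of shifts are treated at once.\<close>

locale shift_index =
  fixes \<iota> :: "'i::semiring_1 \<Rightarrow> int"
  assumes inj: "inj \<iota>" and zero: "\<iota> 0 = 0" and add_one: "\<iota> (i + 1) = \<iota> i + 1"
    and window_start: "\<exists>i0. \<forall>i. \<bar>\<iota> i\<bar> \<le> int n \<longrightarrow> (\<exists>k. i = i0 + of_nat k)"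
begin

lemma add_of_nat: "\<iota> (i + of_nat k) = \<iota> i + int k"
proof (induction k)
  case (Suc k)
  have "i + of_nat (Suc k) = (i + of_nat k) + 1" by (simp add: ac_simps)
  thus ?case unfolding add_one Suc[symmetric] by (simp add: add_one Suc)
qed simp

lemma of_nat_index: "\<iota> (of_nat k) = int k"
  using add_of_nat[of 0 k] by (simp add: zero)

text \<open>This is [0, n] for one-sided and [-n, n] for two-sided sequences.\<close>

definition window :: "nat \<Rightarrow> 'i set" where "window n = {i. \<bar>\<iota> i\<bar> \<le> int n}"

lemma finite_window: "finite (window n)"
proof (rule finite_imageD)
  have "\<iota> ` window n \<subseteq> {- int n..int n}" by (auto simp: window_def)
  thus "finite (\<iota> ` window n)" by (rule finite_subset) simp
qed (use inj in \<open>auto intro: inj_on_subset\<close>)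

lemma window_mono: "m \<le> n \<Longrightarrow> window m \<subseteq> window n"
  by (auto simp: window_def)

lemma open_contains_cylinder:
  fixes U :: "('i \<Rightarrow> 'a::topological_space) set"
  assumes "open U" "x \<in> U"
  shows "\<exists>n. {y. \<forall>i\<in>window n. y i = x i} \<subseteq> U"
proof -
  have "openin (product_topology (\<lambda>_::'i. euclidean) UNIV) U"
    using assms(1) by (simp add: euclidean_product_topology)
  from product_topology_open_contains_basis[OF this assms(2)]
  obtain B where B: "x \<in> (\<Pi>\<^sub>E i\<in>UNIV. B i)" "finite {i. B i \<noteq> UNIV}" "(\<Pi>\<^sub>E i\<in>UNIV. B i) \<subseteq> U"
    by auto
  define n where "n = Max (insert 0 ((\<lambda>i. nat \<bar>\<iota> i\<bar>) ` {i. B i \<noteq> UNIV}))"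
  have n: "i \<in> window n" if "B i \<noteq> UNIV" for i
  proof -
    have "nat \<bar>\<iota> i\<bar> \<le> n" unfolding n_def using B(2) that by (intro Max_ge) auto
    thus ?thesis by (simp add: window_def)
  qed
  have "y \<in> (\<Pi>\<^sub>E i\<in>UNIV. B i)" if y: "\<forall>i\<in>window n. y i = x i" for y
  proof -
    have "y i \<in> B i" for i
      using B(1) n[of i] y by (cases "B i = UNIV") (auto simp: PiE_iff)
    thus ?thesis by auto
  qed
  thus ?thesis using B(3) by blast
qed

lemma open_cylinder:
  fixes x :: "'j \<Rightarrow> 'a::discrete_topology"
  assumes "finite J"
  shows "open {y. \<forall>i\<in>J. y i = x i}"
  using product_topology_basis'[OF assms, of "\<lambda>i. {x i}" "\<lambda>i. i"] by (simp add: Topological_Spaces.open_discrete)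

text \<open>As A is finite, an open set meets X in a countable union of cylinders over windows, so
  events on single coordinates suffice. Nothing is asked of the cardinality of the type of
  symbols.\<close>

lemma measurable_to_subshift:
  fixes F :: "'z \<Rightarrow> 'i \<Rightarrow> 'a::topological_space"
  assumes A: "finite A" and X: "\<And>x. x \<in> X \<Longrightarrow> range x \<subseteq> A"
    and into: "\<And>z. z \<in> space Z \<Longrightarrow> F z \<in> X"
    and coord: "\<And>i a. {z \<in> space Z. F z i = a} \<in> sets Z"
  shows "F \<in> measurable Z (restrict_space borel X)"
proof (rule measurable_restrict_space2)
  show "F \<in> space Z \<rightarrow> X" using into by auto
  show "F \<in> borel_measurable Z"
  proof (rule borel_measurableI)
    fix S :: "('i \<Rightarrow> 'a) set" assume S: "open S"
    define P where "P n = {w \<in> window n \<rightarrow>\<^sub>E A. {y \<in> X. \<forall>i\<in>window n. y i = w i} \<subseteq> S}" for n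
    have "finite (P n)" for n
      unfolding P_def using finite_PiE[OF finite_window, of n "\<lambda>_. A"] A by simp
    moreover have "{z \<in> space Z. \<forall>i\<in>window n. F z i = w i} \<in> sets Z" for n w
      using coord by (intro sets.sets_Collect_finite_All finite_window)
    ultimately have "(\<Union>n. \<Union>w\<in>P n. {z \<in> space Z. \<forall>i\<in>window n. F z i = w i}) \<in> sets Z"
      by (intro sets.countable_UN sets.finite_UN) auto
    also have "(\<Union>n. \<Union>w\<in>P n. {z \<in> space Z. \<forall>i\<in>window n. F z i = w i}) = F -` S \<inter> space Z"
    proof (intro equalityI subsetI)
      fix z assume z: "z \<in> F -` S \<inter> space Z"
      then obtain n where n: "{y. \<forall>i\<in>window n. y i = F z i} \<subseteq> S"
        using open_contains_cylinder[OF S, of "F z"] by auto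
      have "F z i \<in> A" for i using X[OF into] z by blast
      hence "restrict (F z) (window n) \<in> P n"
        using n by (auto simp: P_def)
      thus "z \<in> (\<Union>n. \<Union>w\<in>P n. {z \<in> space Z. \<forall>i\<in>window n. F z i = w i})"
        using z by (intro UN_I[of n] UN_I) auto
    qed (use into in \<open>fastforce simp: P_def\<close>)
    finally show "F -` S \<inter> space Z \<in> sets Z" .
  qed
qed

end

interpretation nat_index: shift_index "int :: nat \<Rightarrow> int"
  by standard (auto simp: inj_def intro: exI[of _ 0])

interpretation int_index: shift_index "\<lambda>i::int. i"
proof
  fix n :: nat
  have "i = - int n + of_nat (nat (i + int n))" if "\<bar>i\<bar> \<le> int n" for i :: int using that by simp
  thus "\<exists>i0. \<forall>i::int. \<bar>i\<bar> \<le> int n \<longrightarrow> (\<exists>k. i = i0 + of_nat k)" by blast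
qed auto

section \<open>Blocks, the graph of overlapping blocks and periodic orbits\<close>

definition block :: "nat \<Rightarrow> ('i::semiring_1 \<Rightarrow> 'a) \<Rightarrow> 'i \<Rightarrow> 'a list" where
  "block M x i = map (\<lambda>k. x (i + of_nat k)) [0..<M]"

lemma length_block [simp]: "length (block M x i) = M" by (simp add: block_def)
lemma block_nth [simp]: "k < M \<Longrightarrow> block M x i ! k = x (i + of_nat k)" by (simp add: block_def)

lemma block_translate: "block M (\<lambda>j. x (i + j)) j = block M x (i + j)"
  by (simp add: block_def add.assoc)

lemma tl_block: "tl (block M x i) = butlast (block M x (i + 1))"
  by (intro nth_equalityI) (auto simp: nth_tl nth_butlast ac_simps)

lemma hd_block: "1 \<le> M \<Longrightarrow> hd (block M x i) = x i"
  using block_nth[of 0 M x i] by (subst hd_conv_nth) (auto simp flip: length_greater_0_conv)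

locale mixing_sft = shift_index \<iota> for \<iota> :: "'i::semiring_1 \<Rightarrow> int" +
  fixes A :: "'a::discrete_topology set" and X :: "('i \<Rightarrow> 'a) set"
  assumes sft: "subshift_of_finite_type A X"
    and mixing: "topologically_mixing X left_shift"
    and nontrivial: "\<exists>x\<in>X. \<exists>y\<in>X. x \<noteq> y"
begin

lemma finite_alphabet: "finite A" using sft by (simp add: subshift_of_finite_type_def)

lemma range_subset: "x \<in> X \<Longrightarrow> range x \<subseteq> A"
  using sft by (auto simp: subshift_of_finite_type_def)

lemma symbol_in: "x \<in> X \<Longrightarrow> x i \<in> A"
  using range_subset by blast

lemma translate_in:
  assumes "x \<in> X" shows "(\<lambda>j. x (i + j)) \<in> X"
proof -
  obtain F where X: "X = {x. range x \<subseteq> A \<and> (\<forall>w\<in>F. \<not> occurs_in w x)}"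
    using sft by (auto simp: subshift_of_finite_type_def)
  have "occurs_in w x" if "occurs_in w (\<lambda>j. x (i + j))" for w
    using that unfolding occurs_in_def by (metis add.assoc)
  thus ?thesis using assms unfolding X by blast
qed

sublocale topological_system X left_shift
proof
  have "compactin (product_topology (\<lambda>_::'i. euclidean) UNIV) (PiE UNIV (\<lambda>_. A))"
    using finite_alphabet by (subst compactin_PiE) (auto intro: finite_imp_compact)
  hence "compact (PiE (UNIV :: 'i set) (\<lambda>_. A))" by (simp add: euclidean_product_topology)
  moreover have "X = X \<inter> PiE UNIV (\<lambda>_. A)" using range_subset by auto
  ultimately show "compact X"
    using subshift_of_finite_type_closed[OF sft] closed_Int_compact by metis
  show "X \<noteq> {}" using nontrivial by auto
  show "continuous_on X left_shift"
    unfolding left_shift_def[abs_def]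
    by (intro continuous_on_coordinatewise_then_product continuous_on_subset[OF continuous_on_product_coordinates]) auto
  show "left_shift x \<in> X" if "x \<in> X" for x
    using subshift_of_finite_type_invariant[OF sft that] .
qed

text \<open>Uniform continuity in terms of coordinates: finitely many of the cylinders given by
  pointwise continuity cover X, and the largest of their windows serves everywhere.\<close>

lemma uniformly_continuous_window:
  fixes f :: "('i \<Rightarrow> 'a) \<Rightarrow> real"
  assumes f: "continuous_on X f" and e: "0 < e"
  obtains n where "\<And>x y. x \<in> X \<Longrightarrow> y \<in> X \<Longrightarrow> (\<And>i. i \<in> window n \<Longrightarrow> x i = y i) \<Longrightarrow> \<bar>f x - f y\<bar> < e"
proof -
  have "\<exists>n. \<forall>y\<in>X. (\<forall>i\<in>window n. y i = x i) \<longrightarrow> \<bar>f y - f x\<bar> < e / 2" if x: "x \<in> X" for x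
  proof -
    have "\<exists>U. open U \<and> x \<in> U \<and> (\<forall>y\<in>X \<inter> U. f y \<in> ball (f x) (e / 2))"
      using f x e unfolding continuous_on_topological by (metis IntE centre_in_ball half_gt_zero open_ball)
    then obtain U where U: "open U" "x \<in> U" "\<And>y. y \<in> X \<Longrightarrow> y \<in> U \<Longrightarrow> dist (f x) (f y) < e / 2" by auto
    obtain n where "{y. \<forall>i\<in>window n. y i = x i} \<subseteq> U" using open_contains_cylinder[OF U(1,2)] by blast
    thus ?thesis using U(3) by (intro exI[of _ n]) (auto simp: dist_real_def abs_minus_commute)
  qed
  then obtain N where N: "\<And>x y. x \<in> X \<Longrightarrow> y \<in> X \<Longrightarrow> (\<forall>i\<in>window (N x). y i = x i) \<Longrightarrow> \<bar>f y - f x\<bar> < e / 2"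
    by metis
  let ?C = "\<lambda>x. {y. \<forall>i\<in>window (N x). y i = x i}"
  obtain K where K: "K \<subseteq> X" "finite K" "X \<subseteq> (\<Union>x\<in>K. ?C x)"
    by (rule compactE_image[OF compact_X, of X ?C]) (auto intro: open_cylinder[OF finite_window])
  show ?thesis
  proof (rule that[of "Max (N ` K)"])
    fix x y assume xy: "x \<in> X" "y \<in> X" "\<And>i. i \<in> window (Max (N ` K)) \<Longrightarrow> x i = y i"
    obtain z where z: "z \<in> K" "\<forall>i\<in>window (N z). x i = z i" using K xy(1) by blast
    have "window (N z) \<subseteq> window (Max (N ` K))" using z(1) K(2) by (intro window_mono Max_ge) auto
    hence "\<forall>i\<in>window (N z). y i = z i" using z(2) xy(3) by fastforce
    hence "\<bar>f x - f z\<bar> < e / 2" "\<bar>f y - f z\<bar> < e / 2" using N z xy K(1) by auto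
    thus "\<bar>f x - f y\<bar> < e" by linarith
  qed
qed

definition states :: "nat \<Rightarrow> 'a list set" where "states M = (\<lambda>x. block M x 0) ` X"

text \<open>The edges of the higher block graph. Mere overlap of two blocks is required, not that
  the joined word of length M + 1 occur in X; for \<open>memory \<le> M\<close> bi-infinite paths
  spell points of X all the same, see \<open>path_point\<close>.\<close>

definition edges :: "nat \<Rightarrow> ('a list \<times> 'a list) set" where
  "edges M = {(u, v). u \<in> states M \<and> v \<in> states M \<and> tl u = butlast v}"

lemma finite_states: "finite (states M)"
proof (rule finite_subset)
  show "states M \<subseteq> {w. set w \<subseteq> A \<and> length w = M}"
    using symbol_in by (auto simp: states_def block_def)
  show "finite {w. set w \<subseteq> A \<and> length w = M}" by (rule finite_lists_length_eq[OF finite_alphabet])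
qed

lemma length_states: "u \<in> states M \<Longrightarrow> length u = M" by (auto simp: states_def)

lemma block_in_states: "x \<in> X \<Longrightarrow> block M x i \<in> states M"
  unfolding states_def using block_translate[of M x i 0] translate_in[of x i]
  by (intro image_eqI[of _ _ "\<lambda>j. x (i + j)"]) simp_all

lemma block_edge: "x \<in> X \<Longrightarrow> (block M x i, block M x (i + 1)) \<in> edges M"
  by (simp add: edges_def block_in_states tl_block)

lemma states_nonempty: "states M \<noteq> {}" using X_nonempty by (simp add: states_def)

text \<open>Blocks longer than all forbidden words decide membership: a forbidden word in x would
  lie within one block and thus occur in a point of X.\<close>

lemma memory_exists: "\<exists>m\<ge>1. \<forall>M\<ge>m. \<forall>x. (\<forall>i. block M x i \<in> states M) \<longrightarrow> x \<in> X"
proof -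
  obtain F where F: "finite F" and X: "X = {x. range x \<subseteq> A \<and> (\<forall>w\<in>F. \<not> occurs_in w x)}"
    using sft by (auto simp: subshift_of_finite_type_def)
  define m where "m = Suc (Max (insert 0 (length ` F)))"
  have len: "length w < m" if "w \<in> F" for w
    unfolding m_def less_Suc_eq_le using F that by (intro Max_ge) auto
  have "x \<in> X" if M: "m \<le> M" and x: "\<And>i. block M x i \<in> states M" for M x
  proof -
    have M0: "0 < M" using M by (simp add: m_def)
    have ex: "\<exists>y\<in>X. \<forall>k<M. x (i + of_nat k) = y (of_nat k)" for i
    proof -
      obtain y where "y \<in> X" "block M x i = block M y 0" using x[of i] by (auto simp: states_def)
      thus ?thesis using block_nth[of _ M x i] block_nth[of _ M y 0] by (metis add_0)
    qed
    have "x i \<in> A" for i using ex[of i] symbol_in M0 by fastforce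
    moreover have "\<not> occurs_in w x" if w: "w \<in> F" for w
    proof
      assume "occurs_in w x"
      then obtain i where i: "\<And>k. k < length w \<Longrightarrow> x (i + of_nat k) = w ! k" by (auto simp: occurs_in_def)
      obtain y where y: "y \<in> X" "\<And>k. k < M \<Longrightarrow> x (i + of_nat k) = y (of_nat k)" using ex by blast
      have "\<forall>k<length w. y (0 + of_nat k) = w ! k"
        using i y(2) len[OF w] M by (metis add_0 le_trans less_imp_le_nat order_less_le_trans)
      hence "occurs_in w y" unfolding occurs_in_def by blast
      thus False using y(1) w by (auto simp: X)
    qed
    ultimately show ?thesis by (auto simp: X)
  qed
  thus ?thesis by (intro exI[of _ m]) (auto simp: m_def)
qed

definition memory :: nat where
  "memory = (SOME m. 1 \<le> m \<and> (\<forall>M\<ge>m. \<forall>x. (\<forall>i. block M x i \<in> states M) \<longrightarrow> x \<in> X))"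

lemma memory_ge: "1 \<le> memory"
  and in_X_of_blocks: "memory \<le> M \<Longrightarrow> (\<And>i. block M x i \<in> states M) \<Longrightarrow> x \<in> X"
  using someI_ex[OF memory_exists] unfolding memory_def by blast+

text \<open>The overlap carries the letter at place k of \<open>y n\<close> to the front of
  \<open>y (n + k)\<close>. Paths have integer times even for one-sided subshifts, whose points read
  only the times in the range of \<iota>.\<close>

lemma path_point:
  assumes M: "memory \<le> M" and y: "\<And>n. (y n, y (n + 1)) \<in> edges M"
  shows "block M (\<lambda>i. hd (y (\<iota> i))) i = y (\<iota> i)" and "(\<lambda>i. hd (y (\<iota> i))) \<in> X"
proof -
  have M1: "1 \<le> M" using M memory_ge by simp
  have len: "length (y n) = M" for n using y[of n] length_states by (auto simp: edges_def)
  have nth: "y n ! k = hd (y (n + int k))" if "k < M" for n k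
    using that
  proof (induction k arbitrary: n)
    case 0
    thus ?case using len[of n] by (simp add: hd_conv_nth flip: length_greater_0_conv)
  next
    case (Suc k)
    have "y n ! Suc k = tl (y n) ! k" using Suc.prems len[of n] by (simp add: nth_tl)
    also have "tl (y n) = butlast (y (n + 1))" using y[of n] by (simp add: edges_def)
    also have "butlast (y (n + 1)) ! k = y (n + 1) ! k"
      using Suc.prems len[of "n + 1"] by (simp add: nth_butlast)
    also have "\<dots> = hd (y (n + 1 + int k))" using Suc by simp
    finally show ?case by (simp add: ac_simps)
  qed
  show eq: "block M (\<lambda>i. hd (y (\<iota> i))) i = y (\<iota> i)" for i
    using len nth by (intro nth_equalityI) (auto simp: add_of_nat)
  show "(\<lambda>i. hd (y (\<iota> i))) \<in> X"
    using y by (intro in_X_of_blocks[OF M]) (auto simp: eq edges_def)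
qed

text \<open>Mixing, applied to the cylinders of u and v, gives walks of every large length, and
  there are finitely many pairs. So the block graph is primitive.\<close>

lemma edges_mixing: "\<exists>N\<ge>1. \<forall>n\<ge>N. \<forall>u\<in>states M. \<forall>v\<in>states M. (u, v) \<in> edges M ^^ n"
proof -
  have "\<exists>N. \<forall>n\<ge>N. (u, v) \<in> edges M ^^ n" if u: "u \<in> states M" and v: "v \<in> states M" for u v
  proof -
    have openC: "openin (top_of_set X) {x \<in> X. block M x 0 = u}" for u
    proof -
      have "{x \<in> X. block M x 0 = u} = X \<inter> (\<Union>x0\<in>{x. block M x 0 = u}. {x. \<forall>i\<in>of_nat ` {..<M}. x i = x0 i})"
        by (auto simp: block_def)
      moreover have "open (\<Union>x0\<in>{x. block M x 0 = u}. {x :: 'i \<Rightarrow> 'a. \<forall>i\<in>of_nat ` {..<M}. x i = x0 i})"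
        by (intro open_UN ballI open_cylinder) simp
      ultimately show ?thesis by (simp only: openin_open_Int)
    qed
    have ne: "{x \<in> X. block M x 0 = u} \<noteq> {}" if "u \<in> states M" for u using that by (auto simp: states_def)
    have "\<exists>N. \<forall>n\<ge>N. (left_shift ^^ n) ` {x \<in> X. block M x 0 = u} \<inter> {x \<in> X. block M x 0 = v} \<noteq> {}"
      by (intro mixing[unfolded topologically_mixing_def, rule_format] conjI openC ne u v)
    then obtain N where N: "\<And>n. n \<ge> N \<Longrightarrow> (left_shift ^^ n) ` {x \<in> X. block M x 0 = u} \<inter> {x \<in> X. block M x 0 = v} \<noteq> {}"
      by blast
    have "(u, v) \<in> edges M ^^ n" if n: "n \<ge> N" for n
    proof -
      obtain x where x: "x \<in> X" "block M x 0 = u" "block M ((left_shift ^^ n) x) 0 = v"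
        using N[OF n] by auto
      have "(block M x 0, block M x (of_nat k)) \<in> edges M ^^ k" for k
      proof (induction k)
        case (Suc k)
        thus ?case using block_edge[OF x(1), of M "of_nat k"] by (auto simp: add.commute)
      qed simp
      moreover have "block M ((left_shift ^^ n) x) 0 = block M x (of_nat n)"
        unfolding funpow_left_shift by (simp add: block_def add.commute)
      ultimately show ?thesis using x by metis
    qed
    thus ?thesis by blast
  qed
  then obtain N where N: "\<And>u v n. u \<in> states M \<Longrightarrow> v \<in> states M \<Longrightarrow> n \<ge> N u v \<Longrightarrow> (u, v) \<in> edges M ^^ n"
    by metis
  define K where "K = Max (insert 1 ((\<lambda>(u, v). N u v) ` (states M \<times> states M)))"
  have "N u v \<le> K" if "u \<in> states M" "v \<in> states M" for u v
    unfolding K_def using that finite_states by (intro Max_ge) auto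
  moreover have "1 \<le> K" unfolding K_def using finite_states by (intro Max_ge) auto
  ultimately show ?thesis using N order.trans by (intro exI[of _ K]) blast
qed

text \<open>Without branching a walk is determined by its start, so the N-step walks from u all end
  in one state. Since they reach every state, there is only one, and all coordinates of all points
  agree.\<close>

lemma edges_branching:
  assumes M: "1 \<le> M"
  shows "\<exists>u v v'. (u, v) \<in> edges M \<and> (u, v') \<in> edges M \<and> v \<noteq> v'"
proof (rule ccontr)
  assume "\<not> ?thesis"
  hence det: "\<And>u v v'. (u, v) \<in> edges M \<Longrightarrow> (u, v') \<in> edges M \<Longrightarrow> v = v'" by blast
  obtain N where N: "\<And>u v. u \<in> states M \<Longrightarrow> v \<in> states M \<Longrightarrow> (u, v) \<in> edges M ^^ N"
    using edges_mixing by blast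
  have "v = v'" if "(u, v) \<in> edges M ^^ n" "(u, v') \<in> edges M ^^ n" for u v v' n
    using that by (induction n arbitrary: v v') (auto dest: det)
  hence eq: "u = v" if "u \<in> states M" "v \<in> states M" for u v
    using N that by blast
  obtain x y where xy: "x \<in> X" "y \<in> X" "x \<noteq> y" using nontrivial by auto
  have "x i = y i" for i
    using eq[OF block_in_states[OF xy(1), of M i] block_in_states[OF xy(2), of M i]] hd_block[OF M] by metis
  thus False using xy(3) by auto
qed

text \<open>A long orbit segment with a good Birkhoff mean is closed up by a walk of fixed length
  N0. The values of f change little along the segment, except near its ends and on the connecting
  walk, and the number of these exceptions does not grow with N.\<close>

lemma periodic_approximation:
  fixes f :: "('i \<Rightarrow> 'a) \<Rightarrow> real"
  assumes f: "continuous_on X f" and e: "0 < e"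
  obtains p c where "1 \<le> p" "\<And>j. c (j + int p) = c j" "\<And>j. (\<lambda>i. c (\<iota> i + j)) \<in> X"
    "max_mean X left_shift f - e \<le> birkhoff left_shift f p (\<lambda>i. c (\<iota> i))"
proof -
  define \<beta> where "\<beta> = max_mean X left_shift f"
  obtain K where K: "0 \<le> K" "\<And>x. x \<in> X \<Longrightarrow> \<bar>f x\<bar> \<le> K" using continuous_bounded[OF f] by metis
  have \<beta>K: "\<beta> \<le> K" using max_mean_abs_le[OF f K(2,1)] by (simp add: \<beta>_def)
  obtain r where r: "\<And>x y. x \<in> X \<Longrightarrow> y \<in> X \<Longrightarrow> (\<And>i. i \<in> window r \<Longrightarrow> x i = y i) \<Longrightarrow> \<bar>f x - f y\<bar> < e / 4"
    by (rule uniformly_continuous_window[OF f, of "e / 4"]) (use e in auto)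
  define M where "M = memory"
  have M1: "1 \<le> M" unfolding M_def by (rule memory_ge)
  obtain N0 where N0: "1 \<le> N0" "\<And>u v. u \<in> states M \<Longrightarrow> v \<in> states M \<Longrightarrow> (u, v) \<in> edges M ^^ N0"
    using edges_mixing by blast
  \<comment> \<open>The 2 r times near the ends lose up to 2 K each. The N0 connecting steps lose up
    to K each in the sum and another K because they also count in the period. All this must fit into
    N e / 2.\<close>
  obtain N where N: "(4 * r * K + 2 * N0 * K) * 2 / e < real N" using reals_Archimedean2 by blast
  have "0 \<le> (4 * r * K + 2 * N0 * K) * 2 / e" using K(1) e by simp
  hence N1: "1 \<le> N" using N by linarith
  obtain x where x: "x \<in> X" "\<beta> - e / 4 \<le> birkhoff left_shift f N x"
    unfolding \<beta>_def by (rule max_mean_approx_below[OF f _ N1, of "e / 4"]) (use e in auto)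
  define b where "b k = block M x (of_nat k)" for k
  obtain q where q: "q 0 = b N" "q N0 = b 0" "\<And>i. i < N0 \<Longrightarrow> (q i, q (Suc i)) \<in> edges M"
    using N0(2)[of "b N" "b 0"] block_in_states[OF x(1)] by (auto simp: b_def relpow_fun_conv)
  define p where "p = N + N0"
  define s where "s k = (if k < N then b k else q (k - N))" for k
  have s_edge: "(s k, s (Suc k mod p)) \<in> edges M" if k: "k < p" for k
  proof -
    consider "Suc k < N" | "Suc k = N" | "N \<le> k" "Suc k < p" | "N \<le> k" "Suc k = p" using k by linarith
    thus ?thesis
    proof cases
      case 1
      thus ?thesis using block_edge[OF x(1), of M "of_nat k"] by (simp add: s_def b_def p_def add.commute)
    next
      case 2
      hence "s k = b k" "s (Suc k mod p) = b (Suc k)" using N0(1) q(1) by (auto simp: s_def p_def)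
      thus ?thesis using block_edge[OF x(1), of M "of_nat k"] by (simp add: b_def add.commute)
    next
      case 3
      thus ?thesis using q(3)[of "k - N"] by (simp add: s_def p_def Suc_diff_le)
    next
      case 4
      hence "Suc (k - N) = N0" by (simp add: p_def)
      thus ?thesis using 4 q(3)[of "k - N"] q(2) N1 by (simp add: s_def p_def Suc_diff_le)
    qed
  qed
  have p1: "1 \<le> p" using N1 by (simp add: p_def)
  \<comment> \<open>The closed walk is repeated over all integers, past included, whatever the index
    type.\<close>
  define y where "y n = s (nat (n mod int p))" for n :: int
  have y_edge: "(y n, y (n + 1)) \<in> edges M" for n
  proof -
    define a where "a = nat (n mod int p)"
    have a: "n mod int p = int a" "a < p" using p1 by (auto simp: a_def nat_less_iff)
    have "(n + 1) mod int p = (n mod int p + 1) mod int p" by (simp add: mod_add_left_eq)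
    also have "\<dots> = int (Suc a mod p)" by (simp add: a(1) of_nat_mod add.commute)
    finally have "y (n + 1) = s (Suc a mod p)" by (simp add: y_def)
    thus ?thesis using s_edge[OF a(2)] by (simp add: y_def a(1))
  qed
  define c where "c n = hd (y n)" for n
  have c_X: "(\<lambda>i. c (\<iota> i + j)) \<in> X" for j
    using path_point(2)[of M "\<lambda>n. y (n + j)"] y_edge[of "_ + j"] by (simp add: M_def c_def ac_simps)
  have c_per: "c (j + int p) = c j" for j by (simp add: c_def y_def)
  define z where "z = (\<lambda>i. c (\<iota> i))"
  have zX: "z \<in> X" using c_X[of 0] by (simp add: z_def)
  have c_x: "c (int k) = x (of_nat k)" if "k < N" for k
    using that hd_block[OF M1] by (simp add: c_def y_def s_def b_def p_def flip: of_nat_mod)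
  have close: "f ((left_shift ^^ k) x) - e / 4 \<le> f ((left_shift ^^ k) z)" if k: "r \<le> k" "k + r < N" for k
  proof -
    have "\<bar>f ((left_shift ^^ k) x) - f ((left_shift ^^ k) z)\<bar> < e / 4"
    proof (rule r)
      fix i assume i: "i \<in> window r"
      define l where "l = nat (\<iota> i + int k)"
      have l: "\<iota> i + int k = int l" "l < N" using i k by (auto simp: window_def l_def)
      have "\<iota> (i + of_nat k) = \<iota> (of_nat l)" using add_of_nat[of 0 l] by (simp add: add_of_nat zero l)
      hence "i + of_nat k = of_nat l" using inj by (simp add: inj_eq)
      thus "(left_shift ^^ k) x i = (left_shift ^^ k) z i"
        using l c_x[OF l(2)] by (simp add: funpow_left_shift z_def add_of_nat)
    qed (use funpow_into x zX in auto)
    thus ?thesis by linarith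
  qed
  \<comment> \<open>The times whose window of radius r may leave the copied segment.\<close>
  let ?S = "{k. k < N \<and> (k < r \<or> N \<le> k + r)}"
  have low: "f ((left_shift ^^ k) x) - e / 4 - (if k \<in> ?S then 2 * K else 0) \<le> f ((left_shift ^^ k) z)" if "k < N" for k
    using close[of k] K(2)[OF funpow_into[OF x(1)], of k] K(2)[OF funpow_into[OF zX], of k] e that
    by (auto simp: not_less not_le abs_le_iff)
  have cardS: "card ?S \<le> 2 * r"
  proof -
    have "card ?S \<le> card ({..<r} \<union> {N - r..<N})" by (intro card_mono) auto
    also have "\<dots> \<le> card {..<r} + card {N - r..<N}" by (rule card_Un_le)
    finally show ?thesis by simp
  qed
  have "N * (\<beta> - e / 4) \<le> (\<Sum>k<N. f ((left_shift ^^ k) x))"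
    using x(2) N1 by (simp add: birkhoff_def field_simps)
  also have "\<dots> \<le> (\<Sum>k<N. f ((left_shift ^^ k) z)) + N * (e / 4) + 2 * r * (2 * K)"
  proof -
    have "(\<Sum>k<N. f ((left_shift ^^ k) x) - e / 4 - (if k \<in> ?S then 2 * K else 0)) \<le> (\<Sum>k<N. f ((left_shift ^^ k) z))"
      using low by (intro sum_mono) auto
    moreover have "(\<Sum>k<N. if k \<in> ?S then 2 * K else 0) = card ?S * (2 * K)"
      by (subst sum.inter_restrict[symmetric]) (auto simp: Int_def)
    moreover have "card ?S * (2 * K) \<le> 2 * r * (2 * K)"
    proof (rule mult_right_mono)
      show "real (card ?S) \<le> real (2 * r)" using cardS by (simp only: of_nat_le_iff)
    qed (use K(1) in simp)
    ultimately show ?thesis unfolding sum_subtractf by (simp add: algebra_simps)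
  qed
  also have "(\<Sum>k<N. f ((left_shift ^^ k) z)) \<le> (\<Sum>k<p. f ((left_shift ^^ k) z)) + N0 * K"
  proof -
    have un: "{..<p} = {..<N} \<union> {N..<p}" by (auto simp: p_def)
    have "(\<Sum>k<p. f ((left_shift ^^ k) z)) = (\<Sum>k<N. f ((left_shift ^^ k) z)) + (\<Sum>k=N..<p. f ((left_shift ^^ k) z))"
      unfolding un by (rule sum.union_disjoint) auto
    moreover have "(\<Sum>k=N..<p. - K) \<le> (\<Sum>k=N..<p. f ((left_shift ^^ k) z))"
    proof (rule sum_mono)
      fix k show "- K \<le> f ((left_shift ^^ k) z)"
        using K(2)[OF funpow_into[OF zX], of k] by linarith
    qed
    ultimately show ?thesis by (simp add: p_def)
  qed
  finally have "N * (\<beta> - e / 2) - 4 * r * K - N0 * K \<le> (\<Sum>k<p. f ((left_shift ^^ k) z))"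
    by (simp add: algebra_simps)
  moreover have "p * (\<beta> - e) \<le> N * (\<beta> - e / 2) - 4 * r * K - N0 * K"
  proof -
    have "4 * r * K + 2 * N0 * K \<le> N * (e / 2)" using N e by (simp add: field_simps)
    moreover have "N0 * \<beta> \<le> N0 * K" using \<beta>K by (intro mult_left_mono) auto
    moreover have "0 \<le> N0 * e" using e by simp
    ultimately show ?thesis by (simp add: p_def algebra_simps)
  qed
  ultimately have "\<beta> - e \<le> birkhoff left_shift f p z"
    using p1 by (simp add: birkhoff_def field_simps)
  thus ?thesis using that[OF p1 c_per c_X] by (simp add: \<beta>_def z_def)
qed

end

section \<open>Coupling from the past\<close>

text \<open>
  The map \<open>g n\<close> moves the state at time \<open>n - 1\<close> to the state at time \<open>n\<close>. The state at time \<open>n\<close>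
  is settled if it does not depend on the initial state, when started early enough.
\<close>

primrec fwd :: "(int \<Rightarrow> 's \<Rightarrow> 's) \<Rightarrow> int \<Rightarrow> nat \<Rightarrow> 's \<Rightarrow> 's" where
  "fwd g m 0 u = u"
| "fwd g m (Suc k) u = g (m + int k + 1) (fwd g m k u)"

definition settled :: "'s set \<Rightarrow> (int \<Rightarrow> 's \<Rightarrow> 's) \<Rightarrow> int \<Rightarrow> 's \<Rightarrow> bool" where
  "settled V g n v \<longleftrightarrow> (\<exists>k. \<forall>u\<in>V. fwd g (n - int k) k u = v)"

definition state :: "'s set \<Rightarrow> (int \<Rightarrow> 's \<Rightarrow> 's) \<Rightarrow> int \<Rightarrow> 's" where
  "state V g n = (THE v. settled V g n v)"

lemma fwd_add: "fwd g m (j + k) u = fwd g (m + int j) k (fwd g m j u)"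
  by (induction k) (auto simp: algebra_simps)

lemma fwd_in: "(\<And>n u. u \<in> V \<Longrightarrow> g n u \<in> V) \<Longrightarrow> u \<in> V \<Longrightarrow> fwd g m k u \<in> V"
  by (induction k) auto

lemma fwd_cong:
  assumes "\<And>j u. j \<in> {m<..m + int k} \<Longrightarrow> u \<in> V \<Longrightarrow> g j u = g' j u"
    "\<And>j u. j \<in> {m<..m + int k} \<Longrightarrow> u \<in> V \<Longrightarrow> g' j u \<in> V" "u \<in> V"
  shows "fwd g m k u = fwd g' m k u \<and> fwd g' m k u \<in> V"
  using assms by (induction k) auto

lemma fwd_shift: "fwd (\<lambda>i. g (i + c)) m k u = fwd g (m + c) k u"
  by (induction k) (auto simp: algebra_simps)

lemma settled_shift: "settled V (\<lambda>i. g (i + c)) n v \<longleftrightarrow> settled V g (n + c) v"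
  by (simp add: settled_def fwd_shift algebra_simps)

lemma state_shift: "state V (\<lambda>i. g (i + c)) n = state V g (n + c)"
  by (simp add: state_def settled_shift)

locale map_sequence =
  fixes V :: "'s set" and g :: "int \<Rightarrow> 's \<Rightarrow> 's"
  assumes nonempty: "V \<noteq> {}" and into: "\<And>n u. u \<in> V \<Longrightarrow> g n u \<in> V"
begin

lemma settled_in: "settled V g n v \<Longrightarrow> v \<in> V"
  using nonempty fwd_in[of V g, OF into] by (auto simp: settled_def)

text \<open>Seen from the earlier time n - (k + k'), the two runs are the same run, which lies in V
  at both starting times.\<close>

lemma settled_unique:
  assumes "settled V g n v" "settled V g n v'"
  shows "v = v'"
proof -
  obtain k where k: "\<And>u. u \<in> V \<Longrightarrow> fwd g (n - int k) k u = v" using assms(1) by (auto simp: settled_def)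
  obtain k' where k': "\<And>u. u \<in> V \<Longrightarrow> fwd g (n - int k') k' u = v'" using assms(2) by (auto simp: settled_def)
  obtain u where u: "u \<in> V" using nonempty by auto
  have "fwd g (n - int (k + k')) (k' + k) u = fwd g (n - int k) k (fwd g (n - int (k + k')) k' u)"
    using fwd_add[of g "n - int (k + k')" k' k u] by simp
  moreover have "fwd g (n - int (k + k')) (k + k') u = fwd g (n - int k') k' (fwd g (n - int (k + k')) k u)"
    using fwd_add[of g "n - int (k + k')" k k' u] by simp
  ultimately show ?thesis
    using k k' fwd_in[of V g, OF into u] by (simp add: add.commute)
qed

lemma state_eq: "settled V g n v \<Longrightarrow> state V g n = v"
  unfolding state_def using settled_unique by blast

lemma settled_Suc:
  assumes "settled V g n v" shows "settled V g (n + 1) (g (n + 1) v)"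
proof -
  obtain k where k: "\<And>u. u \<in> V \<Longrightarrow> fwd g (n - int k) k u = v" using assms by (auto simp: settled_def)
  show ?thesis unfolding settled_def by (intro exI[of _ "Suc k"]) (auto simp: k)
qed

end

lemma fwd_sets:
  fixes g :: "'z \<Rightarrow> int \<Rightarrow> 's \<Rightarrow> 's"
  assumes "finite V"
    and "\<And>j u v. j \<in> {m<..m + int k} \<Longrightarrow> u \<in> V \<Longrightarrow> v \<in> V \<Longrightarrow> {z\<in>space Z. g z j u = v} \<in> sets Z"
    and "\<And>z j u. z \<in> space Z \<Longrightarrow> j \<in> {m<..m + int k} \<Longrightarrow> u \<in> V \<Longrightarrow> g z j u \<in> V"
    and "u \<in> V"
  shows "(\<forall>z\<in>space Z. fwd (g z) m k u \<in> V) \<and> (\<forall>v\<in>V. {z\<in>space Z. fwd (g z) m k u = v} \<in> sets Z)"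
  using assms(2,3)
proof (induction k)
  case 0
  have "{z\<in>space Z. u = v} \<in> sets Z" for v by (cases "u = v") auto
  thus ?case using \<open>u \<in> V\<close> by simp
next
  case (Suc k)
  have IH: "\<And>z. z \<in> space Z \<Longrightarrow> fwd (g z) m k u \<in> V"
      "\<And>v. v \<in> V \<Longrightarrow> {z\<in>space Z. fwd (g z) m k u = v} \<in> sets Z"
    using Suc.IH Suc.prems by auto
  have "{z\<in>space Z. fwd (g z) m (Suc k) u = v} \<in> sets Z" if v: "v \<in> V" for v
  proof -
    have "{z\<in>space Z. fwd (g z) m (Suc k) u = v} =
      (\<Union>v'\<in>V. {z\<in>space Z. fwd (g z) m k u = v'} \<inter> {z\<in>space Z. g z (m + int k + 1) v' = v})"
      using IH(1) by auto
    thus ?thesis using IH(2) Suc.prems(1) v \<open>finite V\<close> by (auto intro!: sets.finite_UN)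
  qed
  thus ?case using IH(1) Suc.prems(2) by auto
qed

lemma settled_sets:
  fixes g :: "'z \<Rightarrow> int \<Rightarrow> 's \<Rightarrow> 's"
  assumes "finite V" "v \<in> V"
    and "\<And>j u v. j \<le> n \<Longrightarrow> u \<in> V \<Longrightarrow> v \<in> V \<Longrightarrow> {z\<in>space Z. g z j u = v} \<in> sets Z"
    and "\<And>z j u. z \<in> space Z \<Longrightarrow> j \<le> n \<Longrightarrow> u \<in> V \<Longrightarrow> g z j u \<in> V"
  shows "{z\<in>space Z. settled V (g z) n v} \<in> sets Z"
proof -
  have [measurable]: "Measurable.pred Z (\<lambda>z. fwd (g z) (n - int k) k u = v)" if "u \<in> V" for k u
    unfolding pred_def using assms fwd_sets[of V "n - int k" k Z g u] that by auto
  show ?thesis unfolding settled_def pred_def[symmetric]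
    using \<open>finite V\<close> by measurable
qed

section \<open>The stationary chain driven by independent random maps\<close>

locale random_maps = prob_space D for D :: "'l measure" +
  fixes V :: "'s set" and h :: "'l \<Rightarrow> 's \<Rightarrow> 's"
  assumes finite_V: "finite V" and nonempty_V: "V \<noteq> {}"
    and h_into: "\<And>l u. l \<in> space D \<Longrightarrow> u \<in> V \<Longrightarrow> h l u \<in> V"
    and h_sets: "\<And>u v. u \<in> V \<Longrightarrow> v \<in> V \<Longrightarrow> {l \<in> space D. h l u = v} \<in> sets D"
    and coalescing: "\<exists>N s o'. (\<forall>j\<in>{0<..int N}. 0 < prob {l \<in> space D. \<forall>u\<in>V. h l u = s j u}) \<and>
      (\<forall>u\<in>V. fwd s 0 N u = o')"
begin

abbreviation W :: "(int \<Rightarrow> 'l) measure" where "W \<equiv> PiM (UNIV :: int set) (\<lambda>_. D)"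
abbreviation maps :: "(int \<Rightarrow> 'l) \<Rightarrow> int \<Rightarrow> 's \<Rightarrow> 's" where "maps \<omega> n \<equiv> h (\<omega> n)"

abbreviation settled_event :: "int \<Rightarrow> 's \<Rightarrow> (int \<Rightarrow> 'l) set" where
  "settled_event n v \<equiv> {\<omega> \<in> space W. settled V (maps \<omega>) n v}"
abbreviation path :: "(int \<Rightarrow> 'l) \<Rightarrow> int \<Rightarrow> 's" where "path \<omega> \<equiv> state V (maps \<omega>)"

definition trans :: "'s \<Rightarrow> 's \<Rightarrow> real" where "trans u v = prob {l \<in> space D. h l u = v}"
definition stat :: "'s \<Rightarrow> real" where "stat v = measure W (settled_event 0 v)"

sublocale W: mixing_system W left_shift
  by (rule bernoulli_mixing) unfold_locales

lemma map_sequence_maps: "\<omega> \<in> space W \<Longrightarrow> map_sequence V (maps \<omega>)"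
  by standard (auto simp: nonempty_V space_PiM intro: h_into)

lemma settled_in_V: "\<omega> \<in> space W \<Longrightarrow> settled V (maps \<omega>) n v \<Longrightarrow> v \<in> V"
  using map_sequence.settled_in[OF map_sequence_maps] by blast

text \<open>Being settled at time n involves the letters up to n only. I is either the whole line or
  a past, and the latter supplies the events that are independent of the next letter.\<close>

lemma settled_measurable:
  assumes "v \<in> V" "{..n} \<subseteq> I"
  shows "{\<omega> \<in> space (PiM I (\<lambda>_. D)). settled V (maps \<omega>) n v} \<in> sets (PiM I (\<lambda>_. D))"
proof (rule settled_sets[OF finite_V assms(1)])
  fix j u v assume j: "j \<le> n" and uv: "u \<in> V" "v \<in> V"
  have "(\<lambda>\<omega>. \<omega> j) \<in> measurable (PiM I (\<lambda>_. D)) D"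
    using j assms by (intro measurable_component_singleton) auto
  from measurable_sets[OF this h_sets[OF uv]]
  show "{z \<in> space (PiM I (\<lambda>_. D)). h (z j) u = v} \<in> sets (PiM I (\<lambda>_. D))"
    using j assms by (auto simp: space_PiM PiE_iff vimage_def Int_def conj_commute cong: conj_cong rev_conj_cong)
next
  fix z j u assume "z \<in> space (PiM I (\<lambda>_. D))" "j \<le> n" "u \<in> V"
  thus "h (z j) u \<in> V" using assms by (intro h_into) (auto simp: space_PiM PiE_iff)
qed

lemma settled_measurable_W: "settled_event n v \<in> sets W"
proof (cases "v \<in> V")
  case False
  hence "settled_event n v = {}" using settled_in_V by blast
  thus ?thesis by (simp only: sets.empty_sets)
qed (rule settled_measurable; simp)

lemma space_W_shift: "\<omega> \<in> space W \<Longrightarrow> (\<lambda>i. \<omega> (i + c)) \<in> space W"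
  by (auto simp: space_PiM)

lemma prob_settled: "measure W (settled_event n v) = stat v"
proof -
  have eq: "measure W (settled_event (n + int k) v) =
     measure W (settled_event n v)" for n k
  proof -
    have "settled_event (n + int k) v =
      {\<omega> \<in> space W. (left_shift ^^ k) \<omega> \<in> settled_event n v}"
      unfolding funpow_left_shift using space_W_shift
      by (auto simp: settled_shift[of V "\<lambda>i. h (_ i)"])
    thus ?thesis using W.prob_funpow[OF settled_measurable_W] by simp
  qed
  show ?thesis
    using eq[of 0 "nat n"] eq[of n "nat (- n)"] by (cases "0 \<le> n") (auto simp: stat_def)
qed

definition coupled :: "(int \<Rightarrow> 'l) set" where
  "coupled = {\<omega> \<in> space W. \<forall>n. \<exists>v. settled V (maps \<omega>) n v}"

lemma settled_some_sets: "{\<omega> \<in> space W. \<exists>v. settled V (maps \<omega>) n v} \<in> sets W"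
proof -
  have "{\<omega> \<in> space W. \<exists>v. settled V (maps \<omega>) n v} = (\<Union>v\<in>V. settled_event n v)"
    using settled_in_V by auto
  thus ?thesis using settled_measurable_W finite_V by auto
qed

lemma coupled_sets: "coupled \<in> sets W"
proof -
  have "coupled = (\<Inter>n. {\<omega> \<in> space W. \<exists>v. settled V (maps \<omega>) n v})"
    by (auto simp: coupled_def)
  thus ?thesis using settled_some_sets by auto
qed

text \<open>Having settled is a forward invariant event of positive probability, so it has probability one.\<close>

lemma AE_coupled: "AE \<omega> in W. \<omega> \<in> coupled"
proof -
  define S where "S n = {\<omega> \<in> space W. \<exists>v. settled V (maps \<omega>) n v}" for n
  have S_sets: "S n \<in> sets W" for n unfolding S_def by (rule settled_some_sets)
  have "measure W (S n) = (\<Sum>v\<in>V. stat v)" for n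
  proof -
    have "S n = (\<Union>v\<in>V. settled_event n v)"
      using settled_in_V by (auto simp: S_def)
    hence "measure W (S n) = (\<Sum>v\<in>V. measure W (settled_event n v))"
      using finite_V settled_measurable_W map_sequence.settled_unique[OF map_sequence_maps]
      by (auto simp: disjoint_family_on_def intro!: W.finite_measure_finite_Union)
    thus ?thesis by (simp add: prob_settled)
  qed
  hence S_eq: "measure W (S n) = measure W (S m)" for n m by simp
  have "measure W (S 0) = 0 \<or> measure W (S 0) = 1"
  proof (rule W.prob_forward_invariant[OF S_sets])
    fix \<omega> assume \<omega>: "\<omega> \<in> S 0"
    then obtain v where v: "settled V (maps \<omega>) 0 v" and sp: "\<omega> \<in> space W" by (auto simp: S_def)
    have "settled V (maps \<omega>) 1 (maps \<omega> 1 v)"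
      using map_sequence.settled_Suc[OF map_sequence_maps[OF sp] v] by simp
    hence "settled V (\<lambda>i. maps \<omega> (i + 1)) 0 (maps \<omega> 1 v)"
      by (subst settled_shift[of V "maps \<omega>" 1]) simp
    thus "left_shift \<omega> \<in> S 0"
      using space_W_shift[OF sp] by (auto simp: S_def left_shift_def)
  qed
  moreover have "0 < measure W (S 0)"
  proof -
    interpret product_prob_space "\<lambda>_. D" "UNIV :: int set" by unfold_locales
    obtain N s o' where s: "\<And>j. j \<in> {0<..int N} \<Longrightarrow> 0 < prob {l \<in> space D. \<forall>u\<in>V. h l u = s j u}"
      and o': "\<And>u. u \<in> V \<Longrightarrow> fwd s 0 N u = o'"
      using coalescing by (elim exE conjE) (rule that; blast)
    let ?E = "\<lambda>j. {l \<in> space D. \<forall>u\<in>V. h l u = s j u}"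
    \<comment> \<open>\<open>measure\<close> vanishes on nonmeasurable sets, so positivity already
      implies measurability.\<close>
    have E_sets: "?E j \<in> sets D" if "j \<in> {0<..int N}" for j
      using s[OF that] measure_notin_sets by fastforce
    \<comment> \<open>The letters at times 1, ..., N realise the coalescing pattern. By independence
      this has positive probability, and it settles the state at time N.\<close>
    let ?C = "prod_emb UNIV (\<lambda>_. D) {0<..int N} (Pi\<^sub>E {0<..int N} ?E)"
    have "0 < (\<Prod>j\<in>{0<..int N}. prob (?E j))" using s by (intro prod_pos) auto
    also have "\<dots> = measure W ?C"
      using E_sets by (intro measure_PiM_emb[symmetric]) auto
    also have "\<dots> \<le> measure W (S (int N))"
    proof (rule W.finite_measure_mono[OF _ S_sets], safe)
      fix \<omega> assume \<omega>: "\<omega> \<in> ?C"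
      hence sp: "\<omega> \<in> space W" by (auto simp: prod_emb_def space_PiM)
      have h: "maps \<omega> j u = s j u" if "j \<in> {0<..int N}" "u \<in> V" for j u
        using \<omega> that by (auto simp: prod_emb_def PiE_iff)
      have "fwd (maps \<omega>) (int N - int N) N u = o'" if u: "u \<in> V" for u
      proof -
        have "s j u \<in> V" if "j \<in> {0<..int N}" "u \<in> V" for j u
          using h[OF that] map_sequence.into[OF map_sequence_maps[OF sp] that(2)] by metis
        hence "fwd (maps \<omega>) 0 N u = fwd s 0 N u"
          using fwd_cong[of 0 N V "maps \<omega>" s u] h u by auto
        thus ?thesis using o'[OF u] by simp
      qed
      thus "\<omega> \<in> S (int N)" using sp unfolding S_def settled_def by blast
    qed
    finally show ?thesis by (simp add: S_eq[of 0 "int N"])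
  qed
  ultimately have "measure W (S n) = 1" for n using S_eq[of n 0] by simp
  hence "AE \<omega> in W. \<omega> \<in> S n" for n using W.prob_eq_1[OF S_sets] by blast
  hence "AE \<omega> in W. \<forall>n. \<omega> \<in> S n" by (simp add: AE_all_countable)
  thus ?thesis by eventually_elim (auto simp: coupled_def S_def)
qed

lemma coupled_shift: "\<omega> \<in> coupled \<Longrightarrow> (\<lambda>i. \<omega> (i + c)) \<in> coupled"
proof -
  have "settled V (\<lambda>i. maps \<omega> (i + c)) n = settled V (maps \<omega>) (n + c)" for n
    by (rule ext) (rule settled_shift)
  thus "\<omega> \<in> coupled \<Longrightarrow> (\<lambda>i. \<omega> (i + c)) \<in> coupled"
    unfolding coupled_def using space_W_shift by simp
qed

lemma settled_state: "\<omega> \<in> coupled \<Longrightarrow> settled V (maps \<omega>) n (path \<omega> n)"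
  using map_sequence.state_eq[OF map_sequence_maps] by (fastforce simp: coupled_def)

lemma settled_iff: "\<omega> \<in> coupled \<Longrightarrow> settled V (maps \<omega>) n v \<longleftrightarrow> path \<omega> n = v"
  using map_sequence.state_eq[OF map_sequence_maps] settled_state by (fastforce simp: coupled_def)

lemma state_in: "\<omega> \<in> coupled \<Longrightarrow> path \<omega> n \<in> V"
  using settled_in_V settled_state by (fastforce simp: coupled_def)

lemma state_Suc: "\<omega> \<in> coupled \<Longrightarrow> path \<omega> (n + 1) = maps \<omega> (n + 1) (path \<omega> n)"
  using map_sequence.settled_Suc[OF map_sequence_maps settled_state]
  by (subst settled_iff[symmetric]) (auto simp: coupled_def)

lemma state_shift_maps: "state V (maps (\<lambda>i. \<omega> (i + c))) n = path \<omega> (n + c)"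
  by (rule state_shift)

lemma state_sets: "{\<omega> \<in> coupled. path \<omega> n = v} \<in> sets W"
proof -
  have "{\<omega> \<in> coupled. path \<omega> n = v} = coupled \<inter> settled_event n v"
    using settled_iff by (auto simp: coupled_def)
  thus ?thesis using settled_measurable_W coupled_sets by auto
qed

lemma indep_past_present:
  assumes A: "A \<in> sets (PiM {..c} (\<lambda>_. D))" and B: "B \<in> sets D"
  shows "measure W {\<omega> \<in> space W. restrict \<omega> {..c} \<in> A \<and> \<omega> (c + 1) \<in> B} =
    measure W {\<omega> \<in> space W. restrict \<omega> {..c} \<in> A} * prob B"
proof -
  interpret product_prob_space "\<lambda>_. D" "UNIV :: int set" by unfold_locales
  have ind: "W.indep_vars (\<lambda>_. D) (\<lambda>i \<omega>. \<omega> i) (UNIV :: int set)"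
    by (subst W.indep_vars_iff_distr_eq_PiM') (auto simp: restrict_UNIV PiM_component distr_id2)
  have ind2: "W.indep_var (PiM {..c} (\<lambda>_. D)) (\<lambda>\<omega>. restrict \<omega> {..c}) (PiM {c + 1} (\<lambda>_. D)) (\<lambda>\<omega>. restrict \<omega> {c + 1})"
    by (rule W.indep_var_restrict[OF ind]) auto
  let ?B = "{f \<in> space (PiM {c + 1} (\<lambda>_. D)). f (c + 1) \<in> B}"
  have "?B \<in> sets (PiM {c + 1} (\<lambda>_. D))" using B by measurable
  from W.indep_varD[OF ind2 A this]
  have "measure W {\<omega> \<in> space W. restrict \<omega> {..c} \<in> A \<and> \<omega> (c + 1) \<in> B} =
     measure W {\<omega> \<in> space W. restrict \<omega> {..c} \<in> A} * measure W {\<omega> \<in> space W. \<omega> (c + 1) \<in> B}"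
    by (simp add: vimage_def Int_def conj_commute space_PiM PiE_iff cong: conj_cong rev_conj_cong)
  also have "measure W {\<omega> \<in> space W. \<omega> (c + 1) \<in> B} = prob B"
    using B by (simp add: measure_def emeasure_PiM_Collect_single)
  finally show ?thesis .
qed

text \<open>The Markov property. Almost surely the path up to time c is a function of the letters up
  to c, while the next move uses the independent letter at c + 1.\<close>

theorem prob_path:
  assumes w: "\<And>i. i \<le> n \<Longrightarrow> w i \<in> V"
  shows "measure W {\<omega> \<in> coupled. \<forall>i\<le>n. path \<omega> (a + int i) = w i} =
    stat (w 0) * (\<Prod>i<n. trans (w i) (w (Suc i)))"
  using w
proof (induction n)
  case 0
  have "measure W {\<omega> \<in> coupled. \<forall>i\<le>0. path \<omega> (a + int i) = w i} =
    measure W (settled_event a (w 0))"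
    using AE_coupled settled_iff state_sets[of a "w 0"] settled_measurable_W
    by (intro W.finite_measure_eq_AE) (auto elim!: eventually_mono)
  thus ?case by (simp add: prob_settled)
next
  case (Suc n)
  let ?c = "a + int n"
  let ?P = "PiM {..?c} (\<lambda>_. D)"
  \<comment> \<open>The event is phrased with \<open>settled\<close> because \<open>coupled\<close>
    looks at all times and is not an event of the past.\<close>
  define A where "A = {\<omega> \<in> space ?P. \<forall>i\<in>{..n}. settled V (maps \<omega>) (a + int i) (w i)}"
  let ?B = "{l \<in> space D. h l (w n) = w (Suc n)}"
  have A_sets: "A \<in> sets ?P"
  proof -
    have "A = (\<Inter>i\<in>{..n}. {\<omega> \<in> space ?P. settled V (maps \<omega>) (a + int i) (w i)})"
      by (auto simp: A_def)
    also have "\<dots> \<in> sets ?P"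
      using Suc.prems by (intro sets.finite_INT settled_measurable) auto
    finally show ?thesis .
  qed
  have B_sets: "?B \<in> sets D" using Suc.prems by (intro h_sets) auto
  have restr: "restrict \<omega> {..?c} \<in> A \<longleftrightarrow> (\<forall>i\<le>n. settled V (maps \<omega>) (a + int i) (w i))" if \<omega>: "\<omega> \<in> space W" for \<omega>
  proof -
    have "settled V (maps (restrict \<omega> {..?c})) m v \<longleftrightarrow> settled V (maps \<omega>) m v" if m: "m \<le> ?c" for m v
    proof -
      have "fwd (maps (restrict \<omega> {..?c})) (m - int k) k u = fwd (maps \<omega>) (m - int k) k u" if "u \<in> V" for k u
        using fwd_cong[of "m - int k" k V "maps (restrict \<omega> {..?c})" "maps \<omega>" u] m that
          map_sequence.into[OF map_sequence_maps[OF \<omega>]] by auto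
      thus ?thesis by (simp add: settled_def)
    qed
    moreover have "restrict \<omega> {..?c} \<in> space ?P" using \<omega> by (auto simp: space_PiM)
    ultimately show ?thesis by (auto simp: A_def)
  qed
  have meas_restr [measurable]: "(\<lambda>\<omega>. restrict \<omega> {..?c}) \<in> measurable W ?P"
    by (rule measurable_restrict_subset) simp
  have comp [measurable]: "(\<lambda>\<omega>. \<omega> (?c + 1)) \<in> measurable W D"
    by (rule measurable_component_singleton) simp
  have path_sets: "{\<omega> \<in> coupled. \<forall>i\<le>m. path \<omega> (a + int i) = w i} \<in> sets W" for m
  proof -
    have "{\<omega> \<in> coupled. \<forall>i\<le>m. path \<omega> (a + int i) = w i} =
      (\<Inter>i\<in>{..m}. {\<omega> \<in> coupled. path \<omega> (a + int i) = w i})" by auto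
    also have "\<dots> \<in> sets W" by (intro sets.finite_INT state_sets) auto
    finally show ?thesis .
  qed
  have "measure W {\<omega> \<in> coupled. \<forall>i\<le>Suc n. path \<omega> (a + int i) = w i} =
      measure W {\<omega> \<in> space W. restrict \<omega> {..?c} \<in> A \<and> \<omega> (?c + 1) \<in> ?B}"
  proof (rule W.finite_measure_eq_AE[OF _ path_sets])
    show "{\<omega> \<in> space W. restrict \<omega> {..?c} \<in> A \<and> \<omega> (?c + 1) \<in> ?B} \<in> sets W"
      using A_sets B_sets by measurable
    show "AE \<omega> in W. (\<omega> \<in> {\<omega> \<in> coupled. \<forall>i\<le>Suc n. path \<omega> (a + int i) = w i}) =
      (\<omega> \<in> {\<omega> \<in> space W. restrict \<omega> {..?c} \<in> A \<and> \<omega> (?c + 1) \<in> ?B})"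
      using AE_coupled
    proof eventually_elim
      case (elim \<omega>)
      hence sp: "\<omega> \<in> space W" by (simp add: coupled_def)
      hence "\<omega> (?c + 1) \<in> space D" by (auto simp: space_PiM)
      moreover have "path \<omega> (a + int (Suc n)) = maps \<omega> (?c + 1) (path \<omega> ?c)"
        using state_Suc[OF elim, of ?c] by (simp add: algebra_simps)
      ultimately show ?case using elim sp restr[OF sp] settled_iff[OF elim] by (auto simp: le_Suc_eq)
    qed
  qed
  also have "\<dots> = measure W {\<omega> \<in> space W. restrict \<omega> {..?c} \<in> A} * trans (w n) (w (Suc n))"
    using indep_past_present[OF A_sets B_sets] by (simp add: trans_def)
  also have "measure W {\<omega> \<in> space W. restrict \<omega> {..?c} \<in> A} =
      measure W {\<omega> \<in> coupled. \<forall>i\<le>n. path \<omega> (a + int i) = w i}"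
  proof (rule W.finite_measure_eq_AE[OF _ _ path_sets])
    show "{\<omega> \<in> space W. restrict \<omega> {..?c} \<in> A} \<in> sets W"
      using A_sets by measurable
    show "AE \<omega> in W. (\<omega> \<in> {\<omega> \<in> space W. restrict \<omega> {..?c} \<in> A}) =
      (\<omega> \<in> {\<omega> \<in> coupled. \<forall>i\<le>n. path \<omega> (a + int i) = w i})"
      using AE_coupled
      by eventually_elim (use restr settled_iff in \<open>auto simp: coupled_def\<close>)
  qed
  finally show ?case using Suc by (simp add: mult.assoc)
qed

lemma stat_nonneg: "0 \<le> stat v" and trans_nonneg: "0 \<le> trans u v"
  by (auto simp: stat_def trans_def)

lemma sum_trans: "u \<in> V \<Longrightarrow> (\<Sum>v\<in>V. trans u v) = 1"
proof -
  assume u: "u \<in> V"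
  have "space D = (\<Union>v\<in>V. {l \<in> space D. h l u = v})" using h_into[OF _ u] by auto
  hence "prob (space D) = (\<Sum>v\<in>V. trans u v)"
    unfolding trans_def using finite_V h_sets[OF u]
    by (subst finite_measure_finite_Union[symmetric]) (auto simp: disjoint_family_on_def)
  thus ?thesis by (simp add: prob_space)
qed

lemma sum_stat: "(\<Sum>v\<in>V. stat v) = 1"
proof -
  have "(\<Sum>v\<in>V. stat v) = (\<Sum>v\<in>V. measure W {\<omega> \<in> coupled. path \<omega> 0 = v})"
    using prob_path[of 0 "\<lambda>_. _" 0] by (intro sum.cong) auto
  also have "\<dots> = measure W (\<Union>v\<in>V. {\<omega> \<in> coupled. path \<omega> 0 = v})"
    using finite_V state_sets by (intro W.finite_measure_finite_Union[symmetric]) (auto simp: disjoint_family_on_def)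
  also have "(\<Union>v\<in>V. {\<omega> \<in> coupled. path \<omega> 0 = v}) = coupled" using state_in by auto
  also have "measure W coupled = 1" using AE_coupled coupled_sets by (simp add: W.prob_eq_1)
  finally show ?thesis .
qed

lemma stat_stationary:
  assumes "v \<in> V" shows "stat v = (\<Sum>u\<in>V. stat u * trans u v)"
proof -
  have sets: "{\<omega> \<in> coupled. path \<omega> 0 = u \<and> path \<omega> 1 = v} \<in> sets W" for u
    using sets.Int[OF state_sets[of 0 u] state_sets[of 1 v]] by (simp add: Int_def conj_ac)
  have "stat v = measure W {\<omega> \<in> coupled. path \<omega> 1 = v}"
    using prob_path[of 0 "\<lambda>_. v" 1] assms by simp
  also have "{\<omega> \<in> coupled. path \<omega> 1 = v} =
      (\<Union>u\<in>V. {\<omega> \<in> coupled. path \<omega> 0 = u \<and> path \<omega> 1 = v})"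
    using state_in by auto
  also have "measure W \<dots> = (\<Sum>u\<in>V. measure W {\<omega> \<in> coupled. path \<omega> 0 = u \<and> path \<omega> 1 = v})"
    using finite_V sets by (intro W.finite_measure_finite_Union) (auto simp: disjoint_family_on_def)
  also have "\<dots> = (\<Sum>u\<in>V. stat u * trans u v)"
  proof (rule sum.cong)
    fix u assume u: "u \<in> V"
    have "{\<omega> \<in> coupled. path \<omega> 0 = u \<and> path \<omega> 1 = v} =
       {\<omega> \<in> coupled. \<forall>i\<le>1. path \<omega> (0 + int i) = (if i = 0 then u else v)}"
      by (auto simp: le_Suc_eq)
    thus "measure W {\<omega> \<in> coupled. path \<omega> 0 = u \<and> path \<omega> 1 = v} = stat u * trans u v"
      using prob_path[of 1 "\<lambda>i. if i = 0 then u else v" 0] u assms by simp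
  qed simp
  finally show ?thesis .
qed

text \<open>Some state has positive weight as the weights sum to 1, and stationarity passes
  positivity on along the edges.\<close>

lemma stat_pos:
  assumes E: "\<And>u v. (u, v) \<in> E \<Longrightarrow> u \<in> V \<and> v \<in> V \<and> 0 < trans u v"
    and irr: "\<And>u v. u \<in> V \<Longrightarrow> v \<in> V \<Longrightarrow> (u, v) \<in> E\<^sup>*" and v: "v \<in> V"
  shows "0 < stat v"
proof -
  have "\<exists>u\<in>V. 0 < stat u"
  proof (rule ccontr)
    assume "\<not> ?thesis"
    hence "(\<Sum>u\<in>V. stat u) \<le> 0" by (intro sum_nonpos) auto
    thus False using sum_stat by simp
  qed
  then obtain u where u: "u \<in> V" "0 < stat u" by blast
  from irr[OF u(1) v] show ?thesis
  proof (induction rule: rtrancl_induct)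
    case (step y z)
    have yz: "y \<in> V" "z \<in> V" "0 < trans y z" using E[OF step(2)] by auto
    have "0 < stat y * trans y z" using step(3) yz by simp
    also have "\<dots> \<le> (\<Sum>u\<in>V. stat u * trans u z)"
      using yz finite_V stat_nonneg trans_nonneg by (intro member_le_sum) auto
    finally show ?case using stat_stationary[OF yz(2)] by simp
  qed (rule u)
qed

end

section \<open>Steering the chain towards a periodic orbit\<close>

context mixing_sft
begin

text \<open>The state at time -L is arbitrary and only the moves between -L and n must follow s.
  That is L + n moves, which fail with small probability if each of them does.\<close>

definition steers :: "nat \<Rightarrow> ('a list \<Rightarrow> 'a list) \<Rightarrow> nat \<Rightarrow> nat \<Rightarrow> (('i \<Rightarrow> 'a) \<Rightarrow> bool) \<Rightarrow> bool" where
  "steers M s L n P \<longleftrightarrow> (\<forall>x\<in>X. \<forall>y. y (- int L) \<in> states M \<longrightarrow>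
     (\<forall>j. - int L \<le> j \<and> j < int n \<longrightarrow> y (j + 1) = s (y j)) \<longrightarrow>
     (\<forall>i\<in>window n. x i = hd (y (\<iota> i))) \<longrightarrow> P x)"

text \<open>Off the set C of blocks of the periodic orbit, s lowers the graph distance to C; on C it
  moves along the orbit. Every state has thus joined the orbit after K steps, at an unknown
  phase.\<close>

lemma preferred_successor:
  fixes f :: "('i \<Rightarrow> 'a) \<Rightarrow> real"
  assumes f: "continuous_on X f" and e: "0 < e"
  obtains M s p n L where "memory \<le> M" "\<And>u. u \<in> states M \<Longrightarrow> (u, s u) \<in> edges M" "1 \<le> p"
    "steers M s L n (\<lambda>x. max_mean X left_shift f - e \<le> birkhoff left_shift f p x)"
proof -
  define \<beta> where "\<beta> = max_mean X left_shift f"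
  obtain p c where p: "1 \<le> p" and per: "\<And>j. c (j + int p) = c j" and cX: "\<And>j. (\<lambda>i. c (\<iota> i + j)) \<in> X"
    and best: "\<beta> - e / 2 \<le> birkhoff left_shift f p (\<lambda>i. c (\<iota> i))"
    unfolding \<beta>_def by (rule periodic_approximation[OF f, of "e / 2"]) (use e in auto)
  define z where "z j = (\<lambda>i. c (\<iota> i + j))" for j
  have T_z: "(left_shift ^^ k) (z j) = z (j + int k)" for k j
    by (simp add: funpow_left_shift z_def add_of_nat ac_simps)
  have z_per: "z (j + int p) = z j" for j
    using per[of "\<iota> _ + j"] by (simp add: z_def add.assoc)
  \<comment> \<open>The sum over one full period does not depend on the phase at which the orbit is
    joined.\<close>
  define S where "S j = (\<Sum>k<p. f (z (j + int k)))" for j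
  have S_Suc: "S (j + 1) = S j" for j
  proof -
    have "S (j + 1) + f (z j) = (\<Sum>k<Suc p. f (z (j + int k)))"
      unfolding S_def by (subst sum.lessThan_Suc_shift) (simp add: ac_simps)
    thus ?thesis by (simp add: S_def z_per)
  qed
  have S_const: "S j = S 0" for j
    by (induction j rule: int_induct[where k = 0]) (use S_Suc S_Suc[of "_ - 1"] in auto)
  have bir_z: "\<beta> - e / 2 \<le> birkhoff left_shift f p (z j)" for j
    using best S_const[of j] T_z[of _ j] T_z[of _ 0] by (simp add: birkhoff_def S_def z_def)
  obtain n where n: "\<And>x y. x \<in> X \<Longrightarrow> y \<in> X \<Longrightarrow> (\<And>i. i \<in> window n \<Longrightarrow> x i = y i) \<Longrightarrow>
      \<bar>birkhoff left_shift f p x - birkhoff left_shift f p y\<bar> < e / 2"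
    by (rule uniformly_continuous_window[OF continuous_on_birkhoff[OF f, of p], of "e / 2"]) (use e in auto)
  define M where "M = max memory p"
  have M: "memory \<le> M" "1 \<le> M" "p \<le> M" using memory_ge by (auto simp: M_def)
  define b where "b j = block M (z j) 0" for j
  have b_nth: "b j ! k = c (j + int k)" if "k < M" for j k
    using that by (simp add: b_def z_def of_nat_index add.commute)
  have b_hd: "hd (b j) = c j" for j by (simp add: b_def hd_block[OF M(2)] z_def zero)
  have b_states: "b j \<in> states M" for j using cX[of j] by (simp add: b_def z_def block_in_states)
  have b_edge: "(b j, b (j + 1)) \<in> edges M" for j
  proof -
    have "\<iota> 1 = 1" using of_nat_index[of 1] by simp
    hence "block M (z j) 1 = b (j + 1)"
      by (simp add: b_def block_def z_def add_of_nat of_nat_index ac_simps)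
    thus ?thesis using block_edge[of "z j" M 0] cX[of j] by (simp add: b_def z_def)
  qed
  \<comment> \<open>since \<open>p \<le> M\<close>, a block of the periodic word determines its continuation\<close>
  have b_det: "b (j + 1) = b (j' + 1)" if eq: "b j = b j'" for j j'
  proof -
    have c_mod: "c (j + int k) = c (j + int (k mod p))" for j k
    proof -
      have "c (j + int l + int (m * p)) = c (j + int l)" for m l
      proof (induction m)
        case (Suc m)
        have "j + int l + int (Suc m * p) = (j + int l + int (m * p)) + int p" by (simp add: algebra_simps)
        thus ?case using per Suc by metis
      qed simp
      moreover have "j + int k = j + int (k mod p) + int (k div p * p)"
        unfolding add.assoc of_nat_add[symmetric] mod_div_mult_eq ..
      ultimately show ?thesis by metis
    qed
    have "c (j + int k) = c (j' + int k)" for k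
    proof -
      have "k mod p < M" using p M(3) by (intro order_less_le_trans[OF mod_less_divisor]) auto
      thus ?thesis using b_nth[of "k mod p" j] b_nth[of "k mod p" j'] eq c_mod[of j k] c_mod[of j' k] by simp
    qed
    hence "c (j + 1 + int k) = c (j' + 1 + int k)" for k
      by (metis add.assoc of_nat_Suc)
    thus ?thesis
      by (intro nth_equalityI) (simp_all add: b_nth length_states[OF b_states])
  qed
  define C where "C = range b"
  obtain K where K: "\<And>u v. u \<in> states M \<Longrightarrow> v \<in> states M \<Longrightarrow> (u, v) \<in> edges M ^^ K"
    using edges_mixing by blast
  define near where "near k u \<longleftrightarrow> (\<exists>v\<in>C. (u, v) \<in> edges M ^^ k)" for k u
  define dst where "dst u = (LEAST k. near k u)" for u
  have near_ex: "near K u" if "u \<in> states M" for u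
    using K[OF that b_states[of 0]] by (auto simp: near_def C_def)
  have near_dst: "near (dst u) u" if "u \<in> states M" for u
    unfolding dst_def by (rule LeastI[of "\<lambda>k. near k u", OF near_ex[OF that]])
  have dst_le: "dst u \<le> k" if "near k u" for u k
    unfolding dst_def using that by (rule Least_le)
  have step: "\<exists>v. (u, v) \<in> edges M \<and> (u \<in> C \<longrightarrow> (\<forall>j. u = b j \<longrightarrow> v = b (j + 1))) \<and> (u \<notin> C \<longrightarrow> dst v < dst u)"
    if u: "u \<in> states M" for u
  proof (cases "u \<in> C")
    case True
    then obtain j where j: "u = b j" by (auto simp: C_def)
    have "b (j + 1) = b (i + 1)" if "u = b i" for i using b_det[of j i] that j by simp
    thus ?thesis using True b_edge[of j, folded j] by blast
  next
    case False
    have nd: "near (dst u) u" by (rule near_dst[OF u])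
    moreover have "dst u \<noteq> 0"
    proof
      assume "dst u = 0"
      thus False using nd False by (simp add: near_def)
    qed
    then obtain k where k: "dst u = Suc k" using not0_implies_Suc by blast
    ultimately obtain w where w: "(u, w) \<in> edges M ^^ Suc k" "w \<in> C"
      unfolding near_def by metis
    obtain v where "(u, v) \<in> edges M" "(v, w) \<in> edges M ^^ k"
      using relpow_Suc_D2[OF w(1)] by blast
    hence "(u, v) \<in> edges M" "dst v \<le> k" using dst_le w(2) by (auto simp: near_def)
    thus ?thesis using False k by (intro exI[of _ v]) auto
  qed
  define s where "s u = (SOME v. (u, v) \<in> edges M \<and> (u \<in> C \<longrightarrow> (\<forall>j. u = b j \<longrightarrow> v = b (j + 1))) \<and>
    (u \<notin> C \<longrightarrow> dst v < dst u))" for u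
  have s: "(u, s u) \<in> edges M" "\<And>j. u = b j \<Longrightarrow> s u = b (j + 1)" "u \<notin> C \<Longrightarrow> dst (s u) < dst u"
    if "u \<in> states M" for u
    using someI_ex[OF step[OF that]] unfolding s_def[symmetric] by (auto simp: C_def)
  \<comment> \<open>K steps bring the path into C by time -n; from there it follows the orbit
    throughout the window of radius n.\<close>
  have "steers M s (K + n) n (\<lambda>x. max_mean X left_shift f - e \<le> birkhoff left_shift f p x)"
    unfolding steers_def
  proof (intro ballI allI impI)
    fix x y
    assume x: "x \<in> X" and y0: "y (- int (K + n)) \<in> states M"
      and "\<forall>j. - int (K + n) \<le> j \<and> j < int n \<longrightarrow> y (j + 1) = s (y j)"
      and "\<forall>i\<in>window n. x i = hd (y (\<iota> i))"
    hence y: "\<And>j. - int (K + n) \<le> j \<Longrightarrow> j < int n \<Longrightarrow> y (j + 1) = s (y j)"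
      and xy: "\<And>i. i \<in> window n \<Longrightarrow> x i = hd (y (\<iota> i))" by blast+
    have y1: "y (- int (K + n) + int (Suc k)) = s (y (- int (K + n) + int k))" if "k < K + 2 * n" for k
      using y[of "- int (K + n) + int k"] that by (simp add: ac_simps)
    have y_states: "y (- int (K + n) + int k) \<in> states M" if "k \<le> K + 2 * n" for k
      using that
    proof (induction k)
      case (Suc k)
      thus ?case using s(1)[of "y (- int (K + n) + int k)"] y1[of k] by (auto simp: edges_def)
    qed (use y0 in simp)
    have reach: "y (- int (K + n) + int k) \<in> C \<or> dst (y (- int (K + n) + int k)) + k \<le> K" if "k \<le> K" for k
      using that
    proof (induction k)
      case 0
      show ?case using dst_le[OF near_ex[OF y0]] by simp
    next
      case (Suc k)
      let ?u = "y (- int (K + n) + int k)"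
      have u: "?u \<in> states M" using y_states[of k] Suc.prems by simp
      have su: "y (- int (K + n) + int (Suc k)) = s ?u" using y1[of k] Suc.prems by simp
      show ?case
      proof (cases "?u \<in> C")
        case True
        then obtain j where "?u = b j" by (auto simp: C_def)
        thus ?thesis using s(2)[OF u] su by (auto simp: C_def)
      next
        case False
        thus ?thesis using s(3)[OF u False] su Suc by (simp del: of_nat_Suc of_nat_add)
      qed
    qed
    have "y (- int n) \<in> C"
    proof (rule ccontr)
      assume neg: "y (- int n) \<notin> C"
      hence "dst (y (- int n)) = 0" using reach[of K] by simp
      moreover have "y (- int n) \<in> states M" using y_states[of K] by simp
      ultimately have "near 0 (y (- int n))" using near_dst by metis
      thus False using neg by (auto simp: near_def)
    qed
    then obtain j where j: "y (- int n) = b j" by (auto simp: C_def)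
    have follow: "y (- int n + int k) = b (j + int k)" if "k \<le> 2 * n" for k
      using that
    proof (induction k)
      case (Suc k)
      have "y (- int n + int (Suc k)) = s (y (- int n + int k))"
        using y1[of "K + k"] Suc.prems by (simp add: ac_simps)
      also have "\<dots> = b (j + int k + 1)"
        using s(2)[OF y_states[of "K + k"]] Suc by (simp add: ac_simps)
      finally show ?case by (simp add: ac_simps)
    qed (simp add: j)
    have "x i = z (j + int n) i" if i: "i \<in> window n" for i
    proof -
      define k where "k = nat (\<iota> i + int n)"
      have k: "\<iota> i = - int n + int k" "k \<le> 2 * n" using i by (auto simp: window_def k_def)
      show ?thesis using xy[OF i] follow[OF k(2)] by (simp add: k(1) b_hd z_def add.commute)
    qed
    hence "\<bar>birkhoff left_shift f p x - birkhoff left_shift f p (z (j + int n))\<bar> < e / 2"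
      using x cX by (intro n) (auto simp: z_def)
    thus "max_mean X left_shift f - e \<le> birkhoff left_shift f p x"
      using bir_z[of "j + int n"] unfolding \<beta>_def[symmetric] by linarith
  qed
  from that[OF M(1) s(1) p this] show thesis .
qed

end

section \<open>Markov measures on the subshift\<close>

lemma measurable_left_shift:
  fixes X :: "('i::semiring_1 \<Rightarrow> 'a::discrete_topology) set"
  assumes "\<And>x. x \<in> X \<Longrightarrow> left_shift x \<in> X"
  shows "left_shift \<in> measurable (restrict_space borel X) (restrict_space borel X)"
proof (rule measurable_restrict_space3)
  have "continuous_on UNIV (left_shift :: ('i \<Rightarrow> 'a) \<Rightarrow> _)"
    unfolding left_shift_def[abs_def]
    by (intro continuous_on_coordinatewise_then_product continuous_on_subset[OF continuous_on_product_coordinates]) auto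
  thus "left_shift \<in> borel_measurable (borel :: ('i \<Rightarrow> 'a) measure)" by (rule borel_measurable_continuous_onI)
qed (use assms in auto)

text \<open>
  A random letter is a pair \<open>(r, g)\<close>; with probability \<open>t\<close> the chain moves along the random
  successor map \<open>g\<close>, otherwise along the preferred map \<open>s\<close>.
\<close>

locale markov_coding = mixing_sft \<iota> A X
  for \<iota> :: "'i::semiring_1 \<Rightarrow> int" and A :: "'a::discrete_topology set" and X +
  fixes M :: nat and s :: "'a list \<Rightarrow> 'a list"
  assumes memory_le: "memory \<le> M" and s_edge: "\<And>u. u \<in> states M \<Longrightarrow> (u, s u) \<in> edges M"
begin

abbreviation V :: "'a list set" where "V \<equiv> states M"
abbreviation E :: "('a list \<times> 'a list) set" where "E \<equiv> edges M"

definition succs :: "('a list \<Rightarrow> 'a list) set" where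
  "succs = (\<Pi>\<^sub>E u\<in>V. E `` {u})"

definition letters :: "(real \<times> ('a list \<Rightarrow> 'a list)) measure" where
  "letters = uniform_measure lborel {0..1} \<Otimes>\<^sub>M measure_pmf (pmf_of_set succs)"

text \<open>The test \<open>snd l \<in> succs\<close> holds almost surely. With it every letter
  moves along an edge, so that the properties of moves hold everywhere and not only almost
  everywhere.\<close>

definition move :: "real \<Rightarrow> real \<times> ('a list \<Rightarrow> 'a list) \<Rightarrow> 'a list \<Rightarrow> 'a list" where
  "move t l u = (if fst l < t \<and> snd l \<in> succs then snd l u else s u)"

text \<open>The default value is a point of X, so that the coding maps into X even where the states
  do not settle.\<close>

definition point :: "(int \<Rightarrow> 'a list \<Rightarrow> 'a list) \<Rightarrow> 'i \<Rightarrow> 'a" where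
  "point g = (if \<forall>n. \<exists>v. settled V g n v then (\<lambda>i. hd (state V g (\<iota> i))) else (SOME x. x \<in> X))"

definition \<mu> :: "real \<Rightarrow> ('i \<Rightarrow> 'a) measure" where
  "\<mu> t = distr (PiM (UNIV :: int set) (\<lambda>_. letters)) (restrict_space borel X) (\<lambda>\<omega>. point (\<lambda>n. move t (\<omega> n)))"

lemma M_pos: "1 \<le> M" using memory_le memory_ge by simp

lemma edges_states: "(u, v) \<in> E \<Longrightarrow> u \<in> V \<and> v \<in> V"
  by (auto simp: edges_def)

lemma finite_succs: "finite succs"
proof -
  have "finite (E `` {u})" for u
    using finite_states edges_states by (auto intro: finite_subset[of _ "V"])
  thus ?thesis unfolding succs_def using finite_states by (intro finite_PiE) auto
qed

lemma restrict_succs: "(\<And>u. u \<in> V \<Longrightarrow> (u, g u) \<in> E) \<Longrightarrow> restrict g (V) \<in> succs"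
  by (auto simp: succs_def)

lemma succs_nonempty: "succs \<noteq> {}"
  using restrict_succs[of s] s_edge by blast

lemma move_edge: "u \<in> V \<Longrightarrow> (u, move t l u) \<in> E"
  using s_edge by (auto simp: move_def succs_def)

lemma move_in: "u \<in> V \<Longrightarrow> move t l u \<in> V"
  using move_edge edges_states by blast

lemma space_letters [simp]: "space letters = UNIV"
  by (simp add: letters_def space_pair_measure)

sublocale U: prob_space "uniform_measure lborel {0..1::real}"
  by (rule prob_space_uniform_measure) auto

sublocale letters: pair_prob_space "uniform_measure lborel {0..1::real}" "measure_pmf (pmf_of_set succs)"
  by unfold_locales

lemma prob_space_letters: "prob_space letters"
  unfolding letters_def by (rule letters.P.prob_space_axioms)

lemma fst_letters [measurable]: "fst \<in> borel_measurable letters"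
  by (simp add: letters_def)

lemma snd_letters [measurable]: "snd \<in> measurable letters (count_space UNIV)"
  by (simp add: letters_def)

lemma measure_letters_rect:
  assumes "0 \<le> t" "t \<le> 1"
  shows "measure letters ({..<t} \<times> S) = t * measure (pmf_of_set succs) S"
proof -
  have "measure letters ({..<t} \<times> S) = measure (uniform_measure lborel {0..1::real}) {..<t} * measure (pmf_of_set succs) S"
    unfolding letters_def by (simp add: measure_def measure_pmf.emeasure_pair_measure_Times enn2real_mult)
  also have "measure (uniform_measure lborel {0..1::real}) {..<t} = t"
  proof -
    have "{0..1} \<inter> {..<t} = {0..<t}" using assms by auto
    thus ?thesis using assms by (simp add: measure_uniform_measure)
  qed
  finally show ?thesis .
qed

text \<open>The threshold may depend on z: it is constant for a single measure \<mu> t and variable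
  when measurability in the parameter is shown.\<close>

lemma sets_move:
  assumes [measurable]: "f \<in> measurable Z letters" "\<theta> \<in> borel_measurable Z"
  shows "{z \<in> space Z. move (\<theta> z) (f z) u = v} \<in> sets Z"
proof -
  have [measurable]: "Measurable.pred Z (\<lambda>z. snd (f z) \<in> S)" for S
    using measurable_compose[OF assms(1) snd_letters] by (rule measurable_compose) simp
  have eq: "move (\<theta> z) (f z) u = v \<longleftrightarrow> (fst (f z) < \<theta> z \<and> snd (f z) \<in> {g \<in> succs. g u = v}) \<or>
      (\<not> (fst (f z) < \<theta> z \<and> snd (f z) \<in> succs) \<and> s u = v)" for z
    by (auto simp: move_def)
  show ?thesis unfolding eq by measurable
qed

lemma point_in:
  assumes g: "\<And>j u. u \<in> V \<Longrightarrow> (u, g j u) \<in> E"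
  shows "point g \<in> X"
    and "(\<And>n. \<exists>v. settled V g n v) \<Longrightarrow> block M (point g) i = state V g (\<iota> i)"
proof -
  interpret map_sequence "V" g
    using g edges_states states_nonempty by unfold_locales blast+
  have edge: "(state V g n, state V g (n + 1)) \<in> E"
    if "\<And>n. \<exists>v. settled V g n v" for n
  proof -
    obtain v where v: "settled V g n v" using \<open>\<And>n. \<exists>v. settled V g n v\<close> by blast
    show ?thesis
      using state_eq[OF v] state_eq[OF settled_Suc[OF v]] g[OF settled_in[OF v]] by simp
  qed
  show "block M (point g) i = state V g (\<iota> i)" if "\<And>n. \<exists>v. settled V g n v"
    using path_point(1)[OF memory_le, of "state V g"] edge[OF that] that by (simp add: point_def)
  show "point g \<in> X"
  proof (cases "\<forall>n. \<exists>v. settled V g n v")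
    case True
    thus ?thesis using path_point(2)[OF memory_le, of "state V g"] edge by (simp add: point_def)
  next
    case False
    hence "point g = (SOME x. x \<in> X)" unfolding point_def by (rule if_not_P)
    thus ?thesis using X_nonempty by (simp add: some_in_eq)
  qed
qed

text \<open>A coordinate of the point is decided by countably many events of being settled. The
  space Z is left open so as to include products with a parameter space.\<close>

lemma point_measurable:
  fixes K :: "'z \<Rightarrow> int \<Rightarrow> 'a list \<Rightarrow> 'a list"
  assumes edge: "\<And>z j u. z \<in> space Z \<Longrightarrow> u \<in> V \<Longrightarrow> (u, K z j u) \<in> E"
    and sets: "\<And>j u v. u \<in> V \<Longrightarrow> v \<in> V \<Longrightarrow> {z \<in> space Z. K z j u = v} \<in> sets Z"
  shows "(\<lambda>z. point (K z)) \<in> measurable Z (restrict_space borel X)"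
proof (rule measurable_to_subshift[OF finite_alphabet range_subset])
  show "point (K z) \<in> X" if "z \<in> space Z" for z
    using point_in(1)[of "K z"] edge[OF that] by blast
  fix i a
  have seq: "map_sequence (V) (K z)" if "z \<in> space Z" for z
    using edge[OF that] edges_states states_nonempty by unfold_locales blast+
  have [measurable]: "Measurable.pred Z (\<lambda>z. settled V (K z) n v)" if "v \<in> V" for n v
    unfolding pred_def using sets edge edges_states
    by (intro settled_sets[OF finite_states that]) blast+
  define All where "All z \<longleftrightarrow> (\<forall>n. \<exists>v\<in>V. settled V (K z) n v)" for z
  define Co where "Co z \<longleftrightarrow> (\<exists>v\<in>V. hd v = a \<and> settled V (K z) (\<iota> i) v)" for z
  have [measurable]: "Measurable.pred Z All" "Measurable.pred Z Co"
    unfolding All_def[abs_def] Co_def[abs_def] using finite_states by measurable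
  have "{z \<in> space Z. point (K z) i = a} =
    {z \<in> space Z. if All z then Co z else (SOME x. x \<in> X) i = a}"
  proof -
    have pt: "point (K z) i = a \<longleftrightarrow> (if All z then Co z else (SOME x. x \<in> X) i = a)"
      if z: "z \<in> space Z" for z
    proof -
      note sz = seq[OF z]
      have all_iff: "All z \<longleftrightarrow> (\<forall>n. \<exists>v. settled V (K z) n v)"
        unfolding All_def using map_sequence.settled_in[OF sz] by blast
      show ?thesis
      proof (cases "\<forall>n. \<exists>v. settled V (K z) n v")
        case True
        then obtain v where v: "settled V (K z) (\<iota> i) v" by blast
        have "point (K z) i = hd v"
          unfolding point_def using True map_sequence.state_eq[OF sz v] by simp
        moreover have "v' = v" if "settled V (K z) (\<iota> i) v'" for v'
          by (rule map_sequence.settled_unique[OF sz that v])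
        hence "Co z \<longleftrightarrow> hd v = a"
          unfolding Co_def using v map_sequence.settled_in[OF sz v] by blast
        moreover have "All z" unfolding all_iff by (rule True)
        ultimately show ?thesis by (simp only: if_True)
      next
        case False
        hence "point (K z) = (SOME x. x \<in> X)" unfolding point_def by (rule if_not_P)
        moreover have "\<not> All z" unfolding all_iff by (rule False)
        ultimately show ?thesis by (simp only: if_False)
      qed
    qed
    show ?thesis using pt by blast
  qed
  also have "\<dots> \<in> sets Z" by measurable
  finally show "{z \<in> space Z. point (K z) i = a} \<in> sets Z" .
qed

end

section \<open>The coded measure for a fixed parameter\<close>

locale markov_coding_at = markov_coding \<iota> A X M s
  for \<iota> :: "'i::semiring_1 \<Rightarrow> int" and A :: "'a::discrete_topology set" and X M s +
  fixes t :: real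
  assumes t: "0 < t" "t \<le> 1"
begin

lemma prob_moves_pos:
  assumes g: "\<And>u. u \<in> V \<Longrightarrow> (u, g u) \<in> E"
  shows "0 < measure letters {l \<in> space letters. \<forall>u\<in>V. move t l u = g u}"
proof -
  interpret L: prob_space letters by (rule prob_space_letters)
  let ?g = "restrict g (V)"
  have "?g \<in> succs" using g by (rule restrict_succs)
  hence "0 < t * measure (pmf_of_set succs) {?g}"
    using t finite_succs succs_nonempty by (simp add: measure_pmf_single card_gt_0_iff)
  also have "\<dots> = measure letters ({..<t} \<times> {?g})"
    using t by (simp add: measure_letters_rect)
  also have "\<dots> \<le> measure letters {l \<in> space letters. \<forall>u\<in>V. move t l u = g u}"
  proof (rule L.finite_measure_mono)
    show "{..<t} \<times> {?g} \<subseteq> {l \<in> space letters. \<forall>u\<in>V. move t l u = g u}"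
      using \<open>?g \<in> succs\<close> by (auto simp: move_def)
    have "{l \<in> space letters. \<forall>u\<in>V. move t l u = g u} =
       (\<Inter>u\<in>V. {l \<in> space letters. move t l u = g u})" using states_nonempty by auto
    also have "\<dots> \<in> sets letters"
      using sets_move[of "\<lambda>l. l" letters "\<lambda>_. t"] finite_states states_nonempty
      by (intro sets.finite_INT) auto
    finally show "{l \<in> space letters. \<forall>u\<in>V. move t l u = g u} \<in> sets letters" .
  qed
  finally show ?thesis .
qed

text \<open>For a length N at which every state has a walk to w, the time-dependent map chooses a
  successor from which w can still be reached in the remaining steps. All walks then arrive at w
  together.\<close>

lemma moves_coalesce:
  "\<exists>N g o'. (\<forall>j\<in>{0<..int N}. 0 < measure letters {l \<in> space letters. \<forall>u\<in>V. move t l u = g j u}) \<and>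
    (\<forall>u\<in>V. fwd g 0 N u = o')"
proof -
  obtain N where N: "\<And>u v. u \<in> V \<Longrightarrow> v \<in> V \<Longrightarrow> (u, v) \<in> E ^^ N"
    using edges_mixing by blast
  obtain w where w: "w \<in> V" using states_nonempty by auto
  \<comment> \<open>The j-th map leaves N - j steps to go.\<close>
  define P where "P j u v \<longleftrightarrow> (u, v) \<in> E \<and> (v, w) \<in> E ^^ (N - nat j)" for j :: int and u v
  define g where "g j u = (if \<exists>v. P j u v then (SOME v. P j u v) else s u)" for j u
  have gP: "P j u (g j u)" if "P j u v" for j u v
    using someI[of "P j u", OF that] that by (auto simp: g_def)
  have g_edge: "(u, g j u) \<in> E" if "u \<in> V" for j u
    using gP[of j u] s_edge[OF that] by (cases "\<exists>v. P j u v") (auto simp: P_def g_def)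
  have "(fwd g 0 k u, w) \<in> E ^^ (N - k)" if "u \<in> V" "k \<le> N" for u k
    using that(2)
  proof (induction k)
    case 0
    thus ?case using N[OF that(1) w] by simp
  next
    case (Suc k)
    let ?u = "fwd g 0 k u"
    have eq: "N - k = Suc (N - Suc k)" using Suc.prems by simp
    have "(?u, w) \<in> E ^^ Suc (N - Suc k)" using Suc unfolding eq by simp
    from relpow_Suc_D2[OF this] obtain v where "(?u, v) \<in> E" "(v, w) \<in> E ^^ (N - Suc k)" by blast
    hence "P (int k + 1) ?u v" by (simp add: P_def nat_add_distrib)
    from gP[OF this] show ?case by (simp add: P_def nat_add_distrib)
  qed
  from this[of _ N] have "fwd g 0 N u = w" if "u \<in> V" for u using that by simp
  thus ?thesis
    by (intro exI[of _ N] exI[of _ g] exI[of _ w] conjI ballI prob_moves_pos g_edge)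
qed

sublocale random_maps letters "V" "move t"
proof -
  interpret L: prob_space letters by (rule prob_space_letters)
  show "random_maps letters (V) (move t)"
  proof
    show "{l \<in> space letters. move t l u = v} \<in> L.events" for u v
      using sets_move[of "\<lambda>l. l" letters "\<lambda>_. t"] by simp
  qed (use finite_states states_nonempty move_in moves_coalesce in auto)
qed

lemma trans_pos:
  assumes "(u, v) \<in> E" shows "0 < trans u v"
proof -
  have "0 < measure letters {l \<in> space letters. \<forall>u'\<in>V. move t l u' = (s(u := v)) u'}"
    using assms s_edge by (intro prob_moves_pos) auto
  also have "\<dots> \<le> trans u v"
    unfolding trans_def using assms edges_states[OF assms] sets_move[of "\<lambda>l. l" letters "\<lambda>_. t" u v]
    by (intro finite_measure_mono) auto
  finally show ?thesis .
qed

text \<open>The preferred map contributes nothing here, so the probability is proportional to t with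
  a factor free of t. This is how t is recovered from \<mu> t.\<close>

lemma trans_not_preferred:
  assumes "v \<noteq> s u" shows "trans u v = t * measure (pmf_of_set succs) {g \<in> succs. g u = v}"
proof -
  have "{l \<in> space letters. move t l u = v} = {..<t} \<times> {g \<in> succs. g u = v}"
    using assms by (auto simp: move_def)
  thus ?thesis using t by (simp add: trans_def measure_letters_rect)
qed

lemma stat_state_pos:
  assumes "v \<in> V" shows "0 < stat v"
proof (rule stat_pos[OF _ _ assms, of "E"])
  show "(u, v) \<in> E\<^sup>*" if "u \<in> V" "v \<in> V" for u v
    using edges_mixing that relpow_imp_rtrancl by blast
qed (use edges_states trans_pos in blast)

abbreviation code :: "(int \<Rightarrow> real \<times> ('a list \<Rightarrow> 'a list)) \<Rightarrow> 'i \<Rightarrow> 'a" where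
  "code \<omega> \<equiv> point (\<lambda>n. move t (\<omega> n))"

lemma code_in: "code \<omega> \<in> X"
  by (rule point_in(1)) (rule move_edge)

lemma block_code: "\<omega> \<in> coupled \<Longrightarrow> block M (code \<omega>) i = path \<omega> (\<iota> i)"
  by (rule point_in(2)) (auto simp: coupled_def intro: move_edge)

lemma code_nth: "\<omega> \<in> coupled \<Longrightarrow> code \<omega> i = hd (path \<omega> (\<iota> i))"
  by (auto simp: coupled_def point_def)

lemma code_measurable [measurable]: "code \<in> measurable W (restrict_space borel X)"
proof (rule point_measurable)
  have "(\<lambda>\<omega>. \<omega> j) \<in> measurable W letters" for j :: int
    by (rule measurable_component_singleton) simp
  thus "{z \<in> space W. move t (z j) u = v} \<in> W.events" for j u v
    by (intro sets_move) auto
qed (rule move_edge)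

lemma code_shift:
  assumes "\<omega> \<in> coupled" shows "code (left_shift \<omega>) = left_shift (code \<omega>)"
proof
  fix i
  have "left_shift \<omega> \<in> coupled" using coupled_shift[OF assms, of 1] by (simp add: left_shift_def)
  thus "code (left_shift \<omega>) i = left_shift (code \<omega>) i"
    using assms state_shift_maps[of \<omega> 1 "\<iota> i"] by (simp add: code_nth left_shift_def add_one)
qed

lemma code_funpow:
  assumes "\<omega> \<in> coupled" shows "code ((left_shift ^^ n) \<omega>) = (left_shift ^^ n) (code \<omega>)"
proof (induction n)
  case (Suc n)
  have "(left_shift ^^ n) \<omega> \<in> coupled"
    using coupled_shift[OF assms, of "int n"] by (simp add: funpow_left_shift)
  thus ?case using Suc code_shift by simp
qed simp

lemma sets_\<mu>: "sets (\<mu> t) = sets (restrict_space borel X)" and space_\<mu>: "space (\<mu> t) = X"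
  by (simp_all add: \<mu>_def space_restrict_space)

lemma prob_space_\<mu>: "prob_space (\<mu> t)"
  unfolding \<mu>_def by (rule W.prob_space_distr) measurable

lemma measure_\<mu>:
  assumes "B \<in> sets (\<mu> t)"
  shows "{\<omega> \<in> coupled. code \<omega> \<in> B} \<in> sets W" "measure (\<mu> t) B = measure W {\<omega> \<in> coupled. code \<omega> \<in> B}"
proof -
  have pre: "code -` B \<inter> space W \<in> sets W"
    using measurable_sets[OF code_measurable] assms by (simp add: sets_\<mu>)
  moreover have eq: "{\<omega> \<in> coupled. code \<omega> \<in> B} = coupled \<inter> (code -` B \<inter> space W)" by (auto simp: coupled_def)
  ultimately show sets: "{\<omega> \<in> coupled. code \<omega> \<in> B} \<in> sets W" using coupled_sets by simp
  have "measure (\<mu> t) B = measure W (code -` B \<inter> space W)"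
    unfolding \<mu>_def using assms by (intro measure_distr) (auto simp: sets_\<mu>)
  also have "\<dots> = measure W {\<omega> \<in> coupled. code \<omega> \<in> B}"
    using AE_coupled pre sets by (intro W.finite_measure_eq_AE) (auto simp: coupled_def elim!: eventually_mono)
  finally show "measure (\<mu> t) B = measure W {\<omega> \<in> coupled. code \<omega> \<in> B}" .
qed

lemma left_shift_\<mu> [measurable]: "left_shift \<in> measurable (\<mu> t) (\<mu> t)"
  unfolding measurable_cong_sets[OF sets_\<mu> sets_\<mu>] by (rule measurable_left_shift) (rule T_into)

lemma \<mu>_invariant: "\<mu> t \<in> invariant_measures X left_shift"
proof -
  have "distr (\<mu> t) (\<mu> t) left_shift = \<mu> t"
  proof (rule measure_eqI)
    fix B assume "B \<in> sets (distr (\<mu> t) (\<mu> t) left_shift)"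
    hence B: "B \<in> sets (\<mu> t)" by simp
    interpret \<mu>: prob_space "\<mu> t" by (rule prob_space_\<mu>)
    have pre: "left_shift -` B \<inter> space (\<mu> t) \<in> sets (\<mu> t)" using B by (rule measurable_sets[OF left_shift_\<mu>])
    let ?B = "{\<omega> \<in> coupled. code \<omega> \<in> B}"
    have "measure (\<mu> t) (left_shift -` B \<inter> space (\<mu> t)) = measure W {\<omega> \<in> coupled. left_shift (code \<omega>) \<in> B}"
      using measure_\<mu>(2)[OF pre] by (simp add: space_\<mu> code_in)
    also have "{\<omega> \<in> coupled. left_shift (code \<omega>) \<in> B} = {\<omega> \<in> coupled. code (left_shift \<omega>) \<in> B}"
      using code_shift by auto
    also have "{\<omega> \<in> coupled. code (left_shift \<omega>) \<in> B} = {\<omega> \<in> space W. (left_shift ^^ 1) \<omega> \<in> ?B}"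
    proof -
      \<comment> \<open>The driving sequences are two-sided, so one may also shift back by
        one.\<close>
      have "\<omega> \<in> coupled \<longleftrightarrow> left_shift \<omega> \<in> coupled" if "\<omega> \<in> space W" for \<omega>
        using coupled_shift[of \<omega> 1] coupled_shift[of "left_shift \<omega>" "-1"] by (auto simp: left_shift_def)
      thus ?thesis by (auto simp: coupled_def)
    qed
    also have "measure W \<dots> = measure W ?B" by (rule W.prob_funpow[OF measure_\<mu>(1)[OF B]])
    also have "\<dots> = measure (\<mu> t) B" by (rule measure_\<mu>(2)[OF B, symmetric])
    finally show "emeasure (distr (\<mu> t) (\<mu> t) left_shift) B = emeasure (\<mu> t) B"
      using B by (simp add: emeasure_distr \<mu>.emeasure_eq_measure)
  qed simp
  thus ?thesis using prob_space_\<mu> sets_\<mu> left_shift_\<mu> unfolding invariant_measures_def by blast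
qed

lemma \<mu>_ergodic: "ergodic left_shift (\<mu> t)"
  unfolding ergodic_def
proof (intro ballI impI)
  fix B assume B: "B \<in> sets (\<mu> t)" and inv: "left_shift -` B \<inter> space (\<mu> t) = B"
  have "left_shift \<omega> \<in> {\<omega> \<in> coupled. code \<omega> \<in> B}" if "\<omega> \<in> {\<omega> \<in> coupled. code \<omega> \<in> B}" for \<omega>
  proof -
    have "code \<omega> \<in> left_shift -` B" using inv that by auto
    thus ?thesis using that coupled_shift[of \<omega> 1] code_shift[of \<omega>] by (simp add: left_shift_def)
  qed
  from W.prob_forward_invariant[OF measure_\<mu>(1)[OF B] this]
  show "measure (\<mu> t) B = 0 \<or> measure (\<mu> t) B = 1" by (simp add: measure_\<mu>(2)[OF B])
qed

lemma integral_\<mu>: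
  fixes f :: "('i \<Rightarrow> 'a) \<Rightarrow> real"
  assumes "f \<in> borel_measurable (restrict_space borel X)"
  shows "(\<integral>x. f x \<partial>\<mu> t) = (\<integral>\<omega>. f (code \<omega>) \<partial>W)"
  unfolding \<mu>_def using assms by (intro integral_distr) measurable

lemma \<mu>_mean_ergodic:
  fixes f :: "('i \<Rightarrow> 'a) \<Rightarrow> real"
  assumes f: "continuous_on X f"
  shows "(\<lambda>n. \<integral>x. \<bar>birkhoff left_shift f n x - (\<integral>y. f y \<partial>\<mu> t)\<bar> \<partial>\<mu> t) \<longlonglongrightarrow> 0"
proof -
  obtain B where B: "\<And>x. x \<in> X \<Longrightarrow> \<bar>f x\<bar> \<le> B" using continuous_bounded[OF f] by metis
  have f_meas: "f \<in> borel_measurable (restrict_space borel X)"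
    using f by (rule borel_measurable_continuous_on_restrict)
  have fc: "(\<lambda>\<omega>. f (code \<omega>)) \<in> borel_measurable W"
    by (rule measurable_compose[OF code_measurable f_meas])
  have "(\<integral>x. \<bar>birkhoff left_shift f n x - (\<integral>y. f y \<partial>\<mu> t)\<bar> \<partial>\<mu> t) =
      (\<integral>\<omega>. \<bar>birkhoff left_shift (\<lambda>\<omega>. f (code \<omega>)) n \<omega> - (\<integral>\<omega>. f (code \<omega>) \<partial>W)\<bar> \<partial>W)" for n
  proof -
    have bm: "birkhoff left_shift f n \<in> borel_measurable (restrict_space borel X)"
      by (intro borel_measurable_continuous_on_restrict continuous_on_birkhoff f)
    hence "(\<integral>x. \<bar>birkhoff left_shift f n x - (\<integral>y. f y \<partial>\<mu> t)\<bar> \<partial>\<mu> t) =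
      (\<integral>\<omega>. \<bar>birkhoff left_shift f n (code \<omega>) - (\<integral>\<omega>. f (code \<omega>) \<partial>W)\<bar> \<partial>W)"
      using integral_\<mu>[OF f_meas] by (subst integral_\<mu>) auto
    also have "\<dots> = (\<integral>\<omega>. \<bar>birkhoff left_shift (\<lambda>\<omega>. f (code \<omega>)) n \<omega> - (\<integral>\<omega>. f (code \<omega>) \<partial>W)\<bar> \<partial>W)"
    proof (rule integral_cong_AE)
      show "AE \<omega> in W. \<bar>birkhoff left_shift f n (code \<omega>) - (\<integral>\<omega>. f (code \<omega>) \<partial>W)\<bar> =
          \<bar>birkhoff left_shift (\<lambda>\<omega>. f (code \<omega>)) n \<omega> - (\<integral>\<omega>. f (code \<omega>) \<partial>W)\<bar>"
        using AE_coupled by eventually_elim (simp add: birkhoff_def code_funpow)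
    qed (use measurable_compose[OF code_measurable bm] W.birkhoff_measurable[OF fc] in \<open>auto simp: abs_real_def\<close>)
    finally show ?thesis .
  qed
  thus ?thesis using W.mean_ergodic[OF fc, of B] B code_in by simp
qed

lemma \<mu>_cylinder:
  assumes "\<And>k. k \<le> n \<Longrightarrow> w k \<in> V"
  shows "{x \<in> X. \<forall>k\<le>n. block M x (i0 + of_nat k) = w k} \<in> sets (\<mu> t)" (is "?C \<in> _")
    and "measure (\<mu> t) {x \<in> X. \<forall>k\<le>n. block M x (i0 + of_nat k) = w k} =
      stat (w 0) * (\<Prod>k<n. trans (w k) (w (Suc k)))"
proof -
  let ?J = "(\<lambda>(k, l). i0 + of_nat k + of_nat l) ` ({..n} \<times> {..<M})"
  let ?S = "{x :: 'i \<Rightarrow> 'a. \<forall>k\<le>n. block M x (i0 + of_nat k) = w k}"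
  have "y \<in> ?S" if "x \<in> ?S" "\<forall>i\<in>?J. y i = x i" for x y
  proof -
    have "block M y (i0 + of_nat k) = block M x (i0 + of_nat k)" if "k \<le> n" for k
      using \<open>\<forall>i\<in>?J. y i = x i\<close> that by (auto simp: block_def)
    thus ?thesis using that(1) by simp
  qed
  hence "?S = (\<Union>x\<in>?S. {y. \<forall>i\<in>?J. y i = x i})" by blast
  moreover have "open (\<Union>x\<in>?S. {y :: 'i \<Rightarrow> 'a. \<forall>i\<in>?J. y i = x i})"
    by (intro open_UN ballI open_cylinder) simp
  ultimately have "open ?S" by metis
  hence "X \<inter> ?S \<in> sets (restrict_space borel X)"
    unfolding sets_restrict_space by (intro imageI borel_open)
  moreover have "?C = X \<inter> ?S" by blast
  ultimately show sets: "?C \<in> sets (\<mu> t)" by (simp only: sets_\<mu>)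
  have "{\<omega> \<in> coupled. code \<omega> \<in> ?C} =
      {\<omega> \<in> coupled. \<forall>k\<le>n. path \<omega> (\<iota> i0 + int k) = w k}"
    by (intro Collect_cong conj_cong refl) (simp add: code_in block_code add_of_nat)
  thus "measure (\<mu> t) ?C = stat (w 0) * (\<Prod>k<n. trans (w k) (w (Suc k)))"
    using measure_\<mu>(2)[OF sets] prob_path[of n w "\<iota> i0"] assms by simp
qed

text \<open>By \<open>window_start\<close> a window lies in a ray \<open>i0 + of_nat k\<close>. A
  neighbourhood of x therefore contains the cylinder of finitely many consecutive blocks of x; these
  form a walk, whose probability is a product of positive numbers.\<close>

lemma \<mu>_fully_supported: "fully_supported X (\<mu> t)"
proof -
  interpret \<mu>: prob_space "\<mu> t" by (rule prob_space_\<mu>)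
  have "0 < emeasure (\<mu> t) (U \<inter> X)" if x: "x \<in> X" and U: "open U" "x \<in> U" for x U
  proof -
    obtain n where n: "{y. \<forall>i\<in>window n. y i = x i} \<subseteq> U" using open_contains_cylinder[OF U] by blast
    obtain i0 where i0: "\<And>i. i \<in> window n \<Longrightarrow> \<exists>k. i = i0 + of_nat k"
      using window_start[of n] by (auto simp: window_def)
    obtain q where q: "\<And>i. i \<in> window n \<Longrightarrow> i = i0 + of_nat (q i)" using i0 by metis
    define L where "L = Max (insert 0 (q ` window n))"
    have L: "q i \<le> L" if "i \<in> window n" for i
      unfolding L_def using finite_window that by (intro Max_ge) auto
    define w where "w k = block M x (i0 + of_nat k)" for k
    have w: "w k \<in> V" for k using block_in_states[OF x] by (simp add: w_def)
    have w_edge: "(w k, w (Suc k)) \<in> E" for k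
      using block_edge[OF x, of M "i0 + of_nat k"] by (simp add: w_def ac_simps)
    let ?C = "{y \<in> X. \<forall>k\<le>L. block M y (i0 + of_nat k) = w k}"
    have "?C \<subseteq> U \<inter> X"
    proof safe
      fix y assume y: "\<forall>k\<le>L. block M y (i0 + of_nat k) = w k"
      have "y i = x i" if i: "i \<in> window n" for i
      proof -
        have "block M y (i0 + of_nat (q i)) = block M x (i0 + of_nat (q i))"
          using y L[OF i] by (simp add: w_def)
        hence "block M y i = block M x i" by (simp add: q[OF i, symmetric])
        thus ?thesis using hd_block[OF M_pos] by metis
      qed
      thus "y \<in> U" using n by blast
    qed
    moreover have "0 < measure (\<mu> t) ?C"
      unfolding \<mu>_cylinder(2)[OF w] using stat_state_pos[OF w] trans_pos[OF w_edge]
      by (intro mult_pos_pos prod_pos) auto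
    moreover have "U \<inter> X \<in> sets (\<mu> t)" using U unfolding sets_\<mu> sets_restrict_space
      by (subst Int_commute) (intro imageI borel_open)
    ultimately show ?thesis
      using \<mu>.finite_measure_mono[of ?C "U \<inter> X"] by (simp add: \<mu>.emeasure_eq_measure)
  qed
  thus ?thesis by (auto simp: fully_supported_def measure_support_def space_\<mu>)
qed

end

section \<open>Entropy of the Markov measures\<close>

lemma mult_ln_mult: "0 \<le> x \<Longrightarrow> 0 \<le> y \<Longrightarrow> (x * y) * ln (x * y) = y * (x * ln x) + x * (y * ln (y :: real))"
  by (cases "x = 0"; cases "y = 0") (auto simp: ln_mult algebra_simps)

context markov_coding_at
begin

definition words :: "nat \<Rightarrow> 'a list list set" where
  "words n = {w. set w \<subseteq> V \<and> length w = n}"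

definition cell :: "'a list list \<Rightarrow> ('i \<Rightarrow> 'a) set" where
  "cell w = {x \<in> X. \<forall>k<length w. block M x (of_nat k) = w ! k}"

definition weight :: "'a list list \<Rightarrow> real" where
  "weight w = stat (w ! 0) * (\<Prod>k<length w - 1. trans (w ! k) (w ! Suc k))"

definition row_entropy :: "'a list \<Rightarrow> real" where
  "row_entropy u = - (\<Sum>v\<in>V. trans u v * ln (trans u v))"

lemma finite_words: "finite (words n)"
  unfolding words_def by (rule finite_lists_length_eq[OF finite_states])

lemma words_0: "words 0 = {[]}" by (auto simp: words_def)

lemma words_Suc: "words (Suc n) = (\<lambda>(w, v). w @ [v]) ` (words n \<times> V)"
proof (intro equalityI subsetI)
  fix w assume "w \<in> words (Suc n)"
  thus "w \<in> (\<lambda>(w, v). w @ [v]) ` (words n \<times> V)"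
    by (cases w rule: rev_cases) (auto simp: words_def)
qed (auto simp: words_def)

lemma sum_words_Suc: "(\<Sum>w\<in>words (Suc n). f w) = (\<Sum>w\<in>words n. \<Sum>v\<in>V. f (w @ [v]))"
  unfolding words_Suc
  by (subst sum.reindex) (auto simp: inj_on_def sum.cartesian_product intro!: sum.cong)

lemma weight_snoc:
  assumes "w \<in> words (Suc n)" shows "weight (w @ [v]) = weight w * trans (last w) v"
proof -
  have len: "length w = Suc n" using assms by (simp add: words_def)
  hence "w \<noteq> []" by auto
  hence last: "last w = w ! n" using len by (simp add: last_conv_nth)
  have "(\<Prod>k<n. trans ((w @ [v]) ! k) ((w @ [v]) ! Suc k)) = (\<Prod>k<n. trans (w ! k) (w ! Suc k))"
    using len by (intro prod.cong) (auto simp: nth_append)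
  thus ?thesis using len by (simp add: weight_def last nth_append)
qed

lemma weight_nonneg: "0 \<le> weight w"
  unfolding weight_def using stat_nonneg trans_nonneg by (intro mult_nonneg_nonneg prod_nonneg) auto

lemma measure_cell:
  assumes "w \<in> words (Suc n)"
  shows "measure (\<mu> t) (cell w) = weight w" "cell w \<in> sets (\<mu> t)"
proof -
  have len: "length w = Suc n" and sub: "set w \<subseteq> V" using assms by (auto simp: words_def)
  have w: "w ! k \<in> V" if "k \<le> n" for k using len sub that nth_mem[of k w] by auto
  have C: "cell w = {x \<in> X. \<forall>k\<le>n. block M x (0 + of_nat k) = w ! k}"
    by (simp add: cell_def len less_Suc_eq_le)
  have "weight w = stat (w ! 0) * (\<Prod>k<n. trans (w ! k) (w ! Suc k))"
    by (simp add: weight_def len)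
  thus "measure (\<mu> t) (cell w) = weight w"
    unfolding C by (subst \<mu>_cylinder(2)[OF w]) simp_all
  show "cell w \<in> sets (\<mu> t)" unfolding C by (rule \<mu>_cylinder(1)[OF w])
qed

text \<open>By stationarity the last state of a random word is distributed according to
  \<open>stat\<close>, whatever its length.\<close>

lemma sum_weight_last:
  "(\<Sum>w\<in>words (Suc n). weight w * f (last w)) = (\<Sum>u\<in>V. stat u * f u)"
proof (induction n arbitrary: f)
  case 0
  show ?case by (subst sum_words_Suc) (simp add: words_0 weight_def)
next
  case (Suc n)
  have "(\<Sum>w\<in>words (Suc (Suc n)). weight w * f (last w)) =
      (\<Sum>w\<in>words (Suc n). weight w * (\<Sum>v\<in>V. trans (last w) v * f v))"
    by (subst sum_words_Suc) (simp add: weight_snoc sum_distrib_left mult.assoc)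
  also have "\<dots> = (\<Sum>u\<in>V. stat u * (\<Sum>v\<in>V. trans u v * f v))"
    by (rule Suc.IH)
  also have "\<dots> = (\<Sum>v\<in>V. (\<Sum>u\<in>V. stat u * trans u v) * f v)"
    unfolding sum_distrib_left sum_distrib_right by (subst sum.swap) (simp add: mult.assoc)
  also have "\<dots> = (\<Sum>v\<in>V. stat v * f v)"
    by (intro sum.cong refl) (simp add: stat_stationary)
  finally show ?case .
qed

definition state_partition :: "('i \<Rightarrow> 'a) set set" where
  "state_partition = (\<lambda>u. {x \<in> X. block M x 0 = u}) ` V"

lemma state_partition_finite_partition: "finite_partition (\<mu> t) state_partition"
  unfolding finite_partition_def
proof (intro conjI)
  show "finite state_partition" unfolding state_partition_def using finite_states by simp
  show "state_partition \<subseteq> sets (\<mu> t)"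
  proof (unfold state_partition_def, safe)
    fix u assume "u \<in> V"
    hence "[u] \<in> words (Suc 0)" by (simp add: words_def)
    from measure_cell(2)[OF this] show "{x \<in> X. block M x 0 = u} \<in> sets (\<mu> t)"
      by (simp add: cell_def)
  qed
  show "partition_on (space (\<mu> t)) state_partition"
    unfolding space_\<mu> state_partition_def partition_on_def disjoint_def
  proof (intro conjI)
    show "(\<Union>u\<in>V. {x \<in> X. block M x 0 = u}) = X" using block_in_states by blast
    show "{} \<notin> (\<lambda>u. {x \<in> X. block M x 0 = u}) ` V" by (auto simp: states_def)
  qed auto
qed

lemma iterated_join_cells: "iterated_join left_shift (\<mu> t) state_partition n = cell ` words n"
proof (induction n)
  case 0
  show ?case by (simp add: words_0 cell_def space_\<mu>)
next
  case (Suc n)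
  have step: "cell w \<inter> ((left_shift ^^ n) -` {x \<in> X. block M x 0 = u} \<inter> X) = cell (w @ [u])"
    if "w \<in> words n" for w u
  proof -
    have "length w = n" using that by (simp add: words_def)
    moreover have "block M ((left_shift ^^ n) x) 0 = block M x (of_nat n)" for x :: "'i \<Rightarrow> 'a"
      unfolding funpow_left_shift by (simp add: block_def add.commute)
    moreover have "(left_shift ^^ n) x \<in> X" if "x \<in> X" for x using funpow_into[OF that] .
    ultimately show ?thesis by (auto simp: cell_def nth_append less_Suc_eq)
  qed
  have "iterated_join left_shift (\<mu> t) state_partition (Suc n) =
      (\<Union>w\<in>words n. \<Union>u\<in>V. {cell w \<inter> ((left_shift ^^ n) -` {x \<in> X. block M x 0 = u} \<inter> X)})"
    unfolding iterated_join.simps Suc space_\<mu> unfolding state_partition_def by blast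
  also have "\<dots> = (\<Union>w\<in>words n. \<Union>u\<in>V. {cell (w @ [u])})"
    using step by auto
  also have "\<dots> = cell ` words (Suc n)" unfolding words_Suc by auto
  finally show ?case .
qed

lemma partition_entropy_Suc:
  "partition_entropy (\<mu> t) (iterated_join left_shift (\<mu> t) state_partition (Suc n)) =
    - (\<Sum>w\<in>words (Suc n). weight w * ln (weight w))"
proof -
  have "(\<Sum>B\<in>cell ` words (Suc n). measure (\<mu> t) B * ln (measure (\<mu> t) B)) =
      (\<Sum>w\<in>words (Suc n). measure (\<mu> t) (cell w) * ln (measure (\<mu> t) (cell w)))"
  proof (subst sum.reindex_nontrivial[OF finite_words])
    \<comment> \<open>Different words share a cell only if it is empty, and then it contributes
      nothing to the entropy.\<close>
    fix w w' assume w: "w \<in> words (Suc n)" "w' \<in> words (Suc n)" "w \<noteq> w'" "cell w = cell w'"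
    have "cell w = {}"
    proof (rule ccontr)
      assume "cell w \<noteq> {}"
      then obtain x where "x \<in> cell w" "x \<in> cell w'" using w(4) by auto
      hence "w = w'" using w(1,2) by (intro nth_equalityI) (auto simp: cell_def words_def)
      thus False using w(3) by simp
    qed
    thus "measure (\<mu> t) (cell w) * ln (measure (\<mu> t) (cell w)) = 0" by simp
  qed simp
  thus ?thesis by (simp add: partition_entropy_def iterated_join_cells measure_cell(1) del: iterated_join.simps)
qed

text \<open>The logarithm of a weight is additive, and by stationarity each further state adds the
  same mean row entropy. The entropies of the joins are thus exactly affine in n.\<close>

lemma partition_entropy_linear:
  "partition_entropy (\<mu> t) (iterated_join left_shift (\<mu> t) state_partition (Suc n)) =
    partition_entropy (\<mu> t) (iterated_join left_shift (\<mu> t) state_partition (Suc 0)) +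
    real n * (\<Sum>u\<in>V. stat u * row_entropy u)"
proof (induction n)
  case (Suc n)
  have "(\<Sum>w\<in>words (Suc (Suc n)). weight w * ln (weight w)) =
      (\<Sum>w\<in>words (Suc n). \<Sum>v\<in>V. trans (last w) v * (weight w * ln (weight w)) +
        weight w * (trans (last w) v * ln (trans (last w) v)))"
    by (subst sum_words_Suc) (intro sum.cong refl, simp add: weight_snoc mult_ln_mult weight_nonneg trans_nonneg)
  also have "\<dots> = (\<Sum>w\<in>words (Suc n). weight w * ln (weight w) - weight w * row_entropy (last w))"
  proof (rule sum.cong[OF refl])
    fix w assume w: "w \<in> words (Suc n)"
    hence "last w \<in> V" using last_in_set[of w] by (cases "w = []") (auto simp: words_def)
    thus "(\<Sum>v\<in>V. trans (last w) v * (weight w * ln (weight w)) +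
        weight w * (trans (last w) v * ln (trans (last w) v))) = weight w * ln (weight w) - weight w * row_entropy (last w)"
      by (simp add: sum.distrib row_entropy_def sum_trans flip: sum_distrib_left sum_distrib_right)
  qed
  also have "\<dots> = (\<Sum>w\<in>words (Suc n). weight w * ln (weight w)) - (\<Sum>u\<in>V. stat u * row_entropy u)"
    by (simp add: sum_subtractf sum_weight_last)
  finally show ?case using Suc by (simp add: partition_entropy_Suc algebra_simps del: iterated_join.simps)
qed simp

lemma row_entropy_nonneg_pos:
  assumes u: "u \<in> V"
  shows "0 \<le> row_entropy u"
    and "(u, v) \<in> E \<Longrightarrow> (u, v') \<in> E \<Longrightarrow> v \<noteq> v' \<Longrightarrow> 0 < row_entropy u"
proof -
  have le1: "trans u v \<le> 1" for v by (simp add: trans_def)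
  have term_nonneg: "0 \<le> - (trans u v * ln (trans u v))" for v
    using le1[of v] trans_nonneg[of u v] by (cases "trans u v = 0") (auto simp: mult_le_0_iff)
  have eq: "row_entropy u = (\<Sum>v\<in>V. - (trans u v * ln (trans u v)))"
    by (simp add: row_entropy_def sum_negf)
  show "0 \<le> row_entropy u" unfolding eq by (intro sum_nonneg term_nonneg)
  assume v: "(u, v) \<in> E" "(u, v') \<in> E" "v \<noteq> v'"
  have in_states: "v \<in> V" "v' \<in> V" using v edges_states by blast+
  have "trans u v + trans u v' = (\<Sum>x\<in>{v, v'}. trans u x)" using v(3) by simp
  also have "\<dots> \<le> (\<Sum>x\<in>V. trans u x)"
    using in_states finite_states trans_nonneg by (intro sum_mono2) auto
  finally have "trans u v < 1" using trans_pos[OF v(2)] sum_trans[OF u] by simp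
  hence "0 < - (trans u v * ln (trans u v))"
    using trans_pos[OF v(1)] by (simp add: mult_pos_neg ln_less_zero)
  thus "0 < row_entropy u"
    unfolding eq using in_states finite_states term_nonneg by (intro sum_pos2[of _ v]) auto
qed

text \<open>A lower bound is enough, so one partition does, that by the block at 0. Its entropy is
  the stationary mean of the row entropies, to which a branching state contributes a positive
  amount.\<close>

lemma \<mu>_entropy_pos: "0 < KS_entropy left_shift (\<mu> t)"
proof -
  define h where "h = (\<Sum>u\<in>V. stat u * row_entropy u)"
  define H where "H n = partition_entropy (\<mu> t) (iterated_join left_shift (\<mu> t) state_partition n)" for n
  obtain u v v' where uv: "(u, v) \<in> E" "(u, v') \<in> E" "v \<noteq> v'"
    using edges_branching[OF M_pos] by blast
  have u: "u \<in> V" using uv(1) edges_states by blast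
  have h_pos: "0 < h" unfolding h_def
    using u finite_states stat_state_pos[OF u] row_entropy_nonneg_pos(2)[OF u uv]
      row_entropy_nonneg_pos(1) stat_nonneg
    by (intro sum_pos2[of _ u]) auto
  have "(\<lambda>n. H (Suc n) / real (Suc n)) \<longlonglongrightarrow> h"
  proof -
    have "(\<lambda>n. (H 1 - h) * inverse (real (Suc n)) + h) \<longlonglongrightarrow> (H 1 - h) * 0 + h"
      by (intro tendsto_intros LIMSEQ_inverse_real_of_nat)
    moreover have "H (Suc n) / real (Suc n) = (H 1 - h) * inverse (real (Suc n)) + h" for n
      using partition_entropy_linear[of n, folded H_def h_def] by (simp add: field_simps)
    ultimately show ?thesis by simp
  qed
  hence "(\<lambda>n. H n / real n) \<longlonglongrightarrow> h" by (rule LIMSEQ_imp_Suc)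
  hence "entropy_wrt_partition left_shift (\<mu> t) state_partition = h"
    unfolding entropy_wrt_partition_def H_def by (rule limI)
  hence "ereal h \<le> KS_entropy left_shift (\<mu> t)"
    unfolding KS_entropy_def using state_partition_finite_partition
    by (intro SUP_upper2[of state_partition]) auto
  thus ?thesis using h_pos less_le_trans[of 0 "ereal h"] by simp
qed

end

section \<open>Uncountably many maximizing measures\<close>

context markov_coding_at
begin

text \<open>The formula determines t from the measure alone, since the two other factors on the
  right are positive and the one from \<open>succs\<close> does not involve t.\<close>

lemma \<mu>_two_blocks:
  assumes e: "(u, v) \<in> E" and v: "v \<noteq> s u"
  shows "measure (\<mu> t) {x \<in> X. block M x 0 = u \<and> block M x 1 = v} =
      t * measure (pmf_of_set succs) {g \<in> succs. g u = v} * measure (\<mu> t) {x \<in> X. block M x 0 = u}"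
    and "0 < measure (\<mu> t) {x \<in> X. block M x 0 = u}"
    and "0 < measure (pmf_of_set succs) {g \<in> succs. g u = v}"
proof -
  have uv: "u \<in> V" "v \<in> V" using edges_states[OF e] by auto
  have C0: "{x \<in> X. block M x 0 = u} = {x \<in> X. \<forall>k\<le>0. block M x (0 + of_nat k) = u}" by simp
  have m0: "measure (\<mu> t) {x \<in> X. block M x 0 = u} = stat u"
    unfolding C0 by (subst \<mu>_cylinder(2)) (use uv in auto)
  let ?w = "\<lambda>k::nat. if k = 0 then u else v"
  have C1: "{x \<in> X. block M x 0 = u \<and> block M x 1 = v} = {x \<in> X. \<forall>k\<le>1. block M x (0 + of_nat k) = ?w k}"
    by (auto simp: le_Suc_eq)
  have m1: "measure (\<mu> t) {x \<in> X. block M x 0 = u \<and> block M x 1 = v} = stat u * trans u v"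
    unfolding C1 by (subst \<mu>_cylinder(2)) (use uv in auto)
  show "measure (\<mu> t) {x \<in> X. block M x 0 = u \<and> block M x 1 = v} =
      t * measure (pmf_of_set succs) {g \<in> succs. g u = v} * measure (\<mu> t) {x \<in> X. block M x 0 = u}"
    unfolding m0 m1 trans_not_preferred[OF v] by simp
  show "0 < measure (\<mu> t) {x \<in> X. block M x 0 = u}" unfolding m0 by (rule stat_state_pos[OF uv(1)])
  show "0 < measure (pmf_of_set succs) {g \<in> succs. g u = v}"
    using trans_pos[OF e] t unfolding trans_not_preferred[OF v] by (simp add: zero_less_mult_iff)
qed

lemma prob_deviation:
  "measure W {\<omega> \<in> space W. \<exists>j\<in>{a<..b}. fst (\<omega> j) < t} \<le> real (nat (b - a)) * t"
proof -
  have comp: "(\<lambda>\<omega>. fst (\<omega> j)) \<in> borel_measurable W" for j :: int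
    by (rule measurable_compose[OF _ fst_letters], rule measurable_component_singleton) simp
  have sets: "{\<omega> \<in> space W. fst (\<omega> j) < t} \<in> sets W" for j
    using comp[of j] by measurable
  have single: "measure W {\<omega> \<in> space W. fst (\<omega> j) < t} = t" for j
  proof -
    interpret product_prob_space "\<lambda>_. letters" "UNIV :: int set" by unfold_locales
    have "{..<t} \<times> UNIV = {l \<in> space letters. fst l < t}" by auto
    also have "\<dots> \<in> sets letters" by measurable
    finally have "measure W {\<omega> \<in> space W. \<omega> j \<in> {..<t} \<times> UNIV} = measure letters ({..<t} \<times> UNIV)"
      by (simp add: measure_def emeasure_PiM_Collect_single del: space_PiM)
    moreover have "{\<omega> \<in> space W. \<omega> j \<in> {..<t} \<times> UNIV} = {\<omega> \<in> space W. fst (\<omega> j) < t}"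
      by (auto simp: mem_Times_iff)
    ultimately show ?thesis using t measure_letters_rect[of t UNIV] by simp
  qed
  have "{\<omega> \<in> space W. \<exists>j\<in>{a<..b}. fst (\<omega> j) < t} = (\<Union>j\<in>{a<..b}. {\<omega> \<in> space W. fst (\<omega> j) < t})" by auto
  also have "measure W \<dots> \<le> (\<Sum>j\<in>{a<..b}. measure W {\<omega> \<in> space W. fst (\<omega> j) < t})"
    using sets by (intro W.finite_measure_subadditive_finite) auto
  also have "\<dots> = real (nat (b - a)) * t" by (simp add: single)
  finally show ?thesis .
qed

text \<open>Unless one of L + n letters deviates, the coded point is steered and its Birkhoff mean
  is almost maximal; otherwise at most 2 B is lost. Invariance turns the integral of the mean into
  that of f.\<close>

lemma integral_near_max_mean:
  fixes f :: "('i \<Rightarrow> 'a) \<Rightarrow> real"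
  assumes f: "continuous_on X f" and B: "\<And>x. x \<in> X \<Longrightarrow> \<bar>f x\<bar> \<le> B" "0 \<le> B" and e: "0 \<le> e" and p: "1 \<le> p"
    and follow: "steers M s L n (\<lambda>x. max_mean X left_shift f - e \<le> birkhoff left_shift f p x)"
  shows "max_mean X left_shift f - e - 2 * B * (real (L + n) * t) \<le> (\<integral>x. f x \<partial>\<mu> t)"
proof -
  define m where "m = max_mean X left_shift f"
  \<comment> \<open>The move from j to j + 1 uses the letter at j + 1, so the interval is open on
    the left.\<close>
  define G where "G = {\<omega> \<in> space W. \<exists>j\<in>{- int L<..int n}. fst (\<omega> j) < t}"
  have G_sets: "G \<in> sets W"
  proof -
    have [measurable]: "(\<lambda>\<omega>. fst (\<omega> j)) \<in> borel_measurable W" for j :: int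
      by (rule measurable_compose[OF _ fst_letters], rule measurable_component_singleton) simp
    show ?thesis unfolding G_def by measurable
  qed
  have bf: "continuous_on X (birkhoff left_shift f p)" by (rule continuous_on_birkhoff[OF f])
  have bm: "birkhoff left_shift f p \<in> borel_measurable (restrict_space borel X)"
    by (rule borel_measurable_continuous_on_restrict[OF bf])
  have bcm: "(\<lambda>\<omega>. birkhoff left_shift f p (code \<omega>)) \<in> borel_measurable W"
    by (rule measurable_compose[OF code_measurable bm])
  have bB: "\<bar>birkhoff left_shift f p x\<bar> \<le> B" if "x \<in> X" for x
    by (rule birkhoff_bounded[OF B(1) that B(2)])
  have mB: "m \<le> B" using max_mean_abs_le[OF f B] by (simp add: m_def)
  have low: "m - e - 2 * B * indicator G \<omega> \<le> birkhoff left_shift f p (code \<omega>)" if \<omega>: "\<omega> \<in> coupled" for \<omega>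
  proof (cases "\<omega> \<in> G")
    case True
    thus ?thesis using bB[OF code_in[of \<omega>]] mB e by (simp add: abs_le_iff)
  next
    case False
    let ?y = "path \<omega>"
    have "?y (j + 1) = s (?y j)" if j: "- int L \<le> j" "j < int n" for j
    proof -
      have "\<not> fst (\<omega> (j + 1)) < t" using j False \<omega> by (auto simp: G_def coupled_def)
      thus ?thesis by (simp add: state_Suc[OF \<omega>] move_def)
    qed
    hence "m - e \<le> birkhoff left_shift f p (code \<omega>)"
      using follow code_in state_in[OF \<omega>] code_nth[OF \<omega>] unfolding m_def steers_def by blast
    thus ?thesis using False by simp
  qed
  have "m - e - 2 * B * measure W G = (\<integral>\<omega>. m - e - 2 * B * indicator G \<omega> \<partial>W)"
    using W.integrable_indicator_set[OF G_sets] sets.sets_into_space[OF G_sets]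
    by (simp add: W.prob_space Int_absorb2)
  also have "\<dots> \<le> (\<integral>\<omega>. birkhoff left_shift f p (code \<omega>) \<partial>W)"
  proof (rule integral_mono_AE)
    show "integrable W (\<lambda>\<omega>. m - e - 2 * B * indicator G \<omega>)"
      using W.integrable_indicator_set[OF G_sets] by simp
    show "integrable W (\<lambda>\<omega>. birkhoff left_shift f p (code \<omega>))"
      using bB code_in by (intro W.integrable_bounded[OF bcm]) auto
    show "AE \<omega> in W. m - e - 2 * B * indicator G \<omega> \<le> birkhoff left_shift f p (code \<omega>)"
      using AE_coupled by eventually_elim (rule low)
  qed
  also have "\<dots> = (\<integral>x. birkhoff left_shift f p x \<partial>\<mu> t)" by (rule integral_\<mu>[OF bm, symmetric])
  also have "\<dots> = (\<integral>x. f x \<partial>\<mu> t)" by (rule integral_birkhoff[OF f \<mu>_invariant p])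
  finally have "m - e - 2 * B * measure W G \<le> (\<integral>x. f x \<partial>\<mu> t)" .
  moreover have "2 * B * measure W G \<le> 2 * B * (real (L + n) * t)"
    using prob_deviation[of "- int L" "int n"] B(2) unfolding G_def
    by (intro mult_left_mono) (auto simp: nat_add_distrib add.commute)
  ultimately show ?thesis by (simp add: m_def)
qed

end

section \<open>Dependence of the measures on the parameter\<close>

context markov_coding
begin

lemma markov_coding_atI: "0 < t \<Longrightarrow> t \<le> 1 \<Longrightarrow> markov_coding_at \<iota> A X M s t"
  by unfold_locales

lemma inj_on_\<mu>: "inj_on \<mu> {0<..1}"
proof (rule inj_onI)
  fix t t' assume t: "t \<in> {0<..1}" "t' \<in> {0<..1}" and eq: "\<mu> t = \<mu> t'"
  interpret a: markov_coding_at \<iota> A X M s t using t by (intro markov_coding_atI) auto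
  interpret b: markov_coding_at \<iota> A X M s t' using t by (intro markov_coding_atI) auto
  \<comment> \<open>A branching state has an edge other than the preferred one.\<close>
  obtain u v where uv: "(u, v) \<in> E" "v \<noteq> s u" using edges_branching[OF M_pos] by metis
  note A = a.\<mu>_two_blocks[OF uv] and B = b.\<mu>_two_blocks[OF uv]
  show "t = t'" using A(1) B(1) A(2,3) unfolding eq by simp
qed

text \<open>The integrals are taken over the fixed space of letter sequences, on which the integrand
  is jointly measurable in q and \<omega>.\<close>

lemma integral_\<mu>_measurable:
  fixes f :: "('i \<Rightarrow> 'a) \<Rightarrow> real"
  assumes f: "continuous_on X f" and \<theta>: "\<theta> \<in> borel_measurable Q" and range: "\<And>q. q \<in> space Q \<Longrightarrow> 0 < \<theta> q \<and> \<theta> q \<le> 1"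
  shows "(\<lambda>q. \<integral>x. f x \<partial>\<mu> (\<theta> q)) \<in> borel_measurable Q"
proof -
  let ?W = "PiM (UNIV :: int set) (\<lambda>_. letters)"
  interpret W: prob_space ?W by (intro prob_space_PiM prob_space_letters)
  have f_meas: "f \<in> borel_measurable (restrict_space borel X)"
    by (rule borel_measurable_continuous_on_restrict[OF f])
  have "(\<lambda>z. point (\<lambda>n. move (\<theta> (fst z)) (snd z n))) \<in> measurable (Q \<Otimes>\<^sub>M ?W) (restrict_space borel X)"
  proof (rule point_measurable)
    have "(\<lambda>z. snd z j) \<in> measurable (Q \<Otimes>\<^sub>M ?W) letters" for j
      by (rule measurable_compose[OF measurable_snd measurable_component_singleton]) simp
    moreover have "(\<lambda>z. \<theta> (fst z)) \<in> borel_measurable (Q \<Otimes>\<^sub>M ?W)"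
      by (rule measurable_compose[OF measurable_fst \<theta>])
    ultimately show "{z \<in> space (Q \<Otimes>\<^sub>M ?W). move (\<theta> (fst z)) (snd z j) u = v} \<in> sets (Q \<Otimes>\<^sub>M ?W)" for j u v
      by (rule sets_move)
  qed (rule move_edge)
  from measurable_compose[OF this f_meas]
  have "(\<lambda>(q, \<omega>). f (point (\<lambda>n. move (\<theta> q) (\<omega> n)))) \<in> borel_measurable (Q \<Otimes>\<^sub>M ?W)"
    by (simp add: case_prod_beta')
  hence "(\<lambda>q. \<integral>\<omega>. f (point (\<lambda>n. move (\<theta> q) (\<omega> n))) \<partial>?W) \<in> borel_measurable Q"
    by (rule W.borel_measurable_lebesgue_integral)
  moreover have "(\<integral>x. f x \<partial>\<mu> (\<theta> q)) = (\<integral>\<omega>. f (point (\<lambda>n. move (\<theta> q) (\<omega> n))) \<partial>?W)" if "q \<in> space Q" for q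
  proof -
    interpret markov_coding_at \<iota> A X M s "\<theta> q" using range[OF that] by (intro markov_coding_atI) auto
    show ?thesis by (rule integral_\<mu>[OF f_meas])
  qed
  ultimately show ?thesis by (simp cong: measurable_cong)
qed

text \<open>The affine map sends [0, 1] onto [\<tau> / 2, \<tau>], keeping t positive and at most
  \<tau>.\<close>

lemma ergodic_family_\<mu>:
  assumes \<tau>: "0 < \<tau>" "\<tau> \<le> 1"
  shows "ergodic_family X left_shift (restrict_space lborel {0..1::real}) (\<lambda>q. \<mu> (\<tau> * (1 + q) / 2))"
proof -
  have range: "0 < \<tau> * (1 + q) / 2 \<and> \<tau> * (1 + q) / 2 \<le> 1" if "q \<in> {0..1}" for q
    using \<tau> that mult_mono[of \<tau> 1 "1 + q" 2] by auto
  have space: "space (restrict_space lborel {0..1::real}) = {0..1}" by (simp add: space_restrict_space)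
  show ?thesis
  proof (intro ergodic_family.intro ergodic_family_axioms.intro topological_system_axioms)
    show "prob_space (restrict_space lborel {0..1::real})"
      by (intro prob_space_restrict_space) auto
    show "B \<in> null_sets (restrict_space lborel {0..1::real})"
      if "countable B" "B \<subseteq> space (restrict_space lborel {0..1::real})" for B
      using that unfolding space by (subst null_sets_restrict_space) (auto intro: countable_imp_null_set_lborel)
    show "\<mu> (\<tau> * (1 + q) / 2) \<in> invariant_measures X left_shift"
      if "q \<in> space (restrict_space lborel {0..1::real})" for q
    proof -
      interpret markov_coding_at \<iota> A X M s "\<tau> * (1 + q) / 2" using range that unfolding space by (intro markov_coding_atI) auto
      show ?thesis by (rule \<mu>_invariant)
    qed
    show "(\<lambda>q. \<integral>x. f x \<partial>\<mu> (\<tau> * (1 + q) / 2)) \<in> borel_measurable (restrict_space lborel {0..1})"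
      if "continuous_on X f" for f :: "('i \<Rightarrow> 'a) \<Rightarrow> real"
    proof (rule integral_\<mu>_measurable[OF that])
      show "(\<lambda>q. \<tau> * (1 + q) / 2) \<in> borel_measurable (restrict_space lborel {0..1})"
        by (rule measurable_restrict_space1) measurable
    qed (use range in \<open>simp add: space\<close>)
    show "(\<lambda>n. \<integral>x. \<bar>birkhoff left_shift f n x - (\<integral>y. f y \<partial>\<mu> (\<tau> * (1 + q) / 2))\<bar> \<partial>\<mu> (\<tau> * (1 + q) / 2)) \<longlonglongrightarrow> 0"
      if "q \<in> space (restrict_space lborel {0..1::real})" "continuous_on X f" for q and f :: "('i \<Rightarrow> 'a) \<Rightarrow> real"
    proof -
      interpret markov_coding_at \<iota> A X M s "\<tau> * (1 + q) / 2" using range that unfolding space by (intro markov_coding_atI) auto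
      show ?thesis by (rule \<mu>_mean_ergodic[OF that(2)])
    qed
  qed
qed

end

section \<open>Density of the potentials with uncountably many such measures\<close>

context mixing_sft
begin

abbreviation rich_maximizing :: "(('i \<Rightarrow> 'a) \<Rightarrow> real) \<Rightarrow> ('i \<Rightarrow> 'a) measure set" where
  "rich_maximizing \<phi> \<equiv> {\<mu> \<in> maximizing_measures X left_shift \<phi>.
      ergodic left_shift \<mu> \<and> fully_supported X \<mu> \<and> KS_entropy left_shift \<mu> > 0}"

lemma perturbation_with_uncountably_many:
  assumes \<phi>0: "\<phi>0 \<in> mspace (C_space X)" and e: "0 < e"
  shows "\<exists>\<phi>\<in>mspace (C_space X). mdist (C_space X) \<phi>0 \<phi> < e \<and>
    uncountable (rich_maximizing \<phi>)"
proof -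
  have cont: "continuous_on X \<phi>0" using \<phi>0 by (simp add: mspace_C_space)
  \<comment> \<open>The perturbation moves by at most 4 \<delta> = e / 2, which is below e.\<close>
  define \<delta> where "\<delta> = e / 8"
  have \<delta>: "0 < \<delta>" and \<delta>2: "0 < \<delta> / 2" using e by (simp_all add: \<delta>_def)
  obtain M s p n L where M: "memory \<le> M" and s: "\<And>u. u \<in> states M \<Longrightarrow> (u, s u) \<in> edges M" and p: "1 \<le> p"
    and follow: "steers M s L n (\<lambda>x. max_mean X left_shift \<phi>0 - \<delta> / 2 \<le> birkhoff left_shift \<phi>0 p x)"
    using preferred_successor[OF cont \<delta>2] by metis
  interpret markov_coding \<iota> A X M s using M s by unfold_locales
  obtain B where B: "0 \<le> B" "\<And>x. x \<in> X \<Longrightarrow> \<bar>\<phi>0 x\<bar> \<le> B" using continuous_bounded[OF cont] by metis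
  define K where "K = 2 * B * real (L + n)"
  have K: "0 \<le> K" using B(1) by (simp add: K_def)
  \<comment> \<open>Half of \<delta> pays for the steering, the other half for the deviations, K
    times the parameter. The summand 1 avoids a division by zero.\<close>
  define \<tau> where "\<tau> = min 1 (\<delta> / 2 / (K + 1))"
  have \<tau>: "0 < \<tau>" "\<tau> \<le> 1" using \<delta> K by (auto simp: \<tau>_def)
  have "K * \<tau> \<le> (K + 1) * (\<delta> / 2 / (K + 1))" using K \<delta> by (intro mult_mono) (auto simp: \<tau>_def)
  also have "\<dots> = \<delta> / 2"
  proof -
    have "c * (d / c) = d" if "c \<noteq> 0" for c d :: real using that by simp
    from this[of "K + 1" "\<delta> / 2"] show ?thesis using K by linarith
  qed
  finally have K\<tau>: "K * \<tau> \<le> \<delta> / 2" .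
  define Q where "Q = restrict_space lborel {0..1::real}"
  define \<theta> where "\<theta> q = \<tau> * (1 + q) / 2" for q :: real
  have space_Q: "space Q = {0..1}" by (simp add: Q_def space_restrict_space)
  have \<theta>: "0 < \<theta> q" "\<theta> q \<le> \<tau>" "\<theta> q \<le> 1" if "q \<in> {0..1}" for q
  proof -
    show "0 < \<theta> q" using \<tau> that by (simp add: \<theta>_def)
    have "\<tau> * (1 + q) \<le> \<tau> * 2" using \<tau> that by (intro mult_left_mono) auto
    thus "\<theta> q \<le> \<tau>" by (simp add: \<theta>_def)
    thus "\<theta> q \<le> 1" using \<tau> by simp
  qed
  have at: "markov_coding_at \<iota> A X M s (\<theta> q)" if "q \<in> {0..1}" for q
    using \<theta>[OF that] by (intro markov_coding_atI)
  interpret F: ergodic_family X left_shift Q "\<lambda>q. \<mu> (\<theta> q)"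
    unfolding Q_def \<theta>_def by (rule ergodic_family_\<mu>[OF \<tau>])
  have "max_mean X left_shift \<phi>0 - \<delta> \<le> (\<integral>x. \<phi>0 x \<partial>\<mu> (\<theta> q))" if q: "q \<in> space Q" for q
  proof -
    have q01: "q \<in> {0..1}" using q by (simp add: space_Q)
    interpret markov_coding_at \<iota> A X M s "\<theta> q" by (rule at[OF q01])
    have "max_mean X left_shift \<phi>0 - \<delta> / 2 - 2 * B * (real (L + n) * \<theta> q) \<le> (\<integral>x. \<phi>0 x \<partial>\<mu> (\<theta> q))"
      using \<delta> by (intro integral_near_max_mean[OF cont B(2,1) _ p follow]) auto
    moreover have "2 * B * (real (L + n) * \<theta> q) \<le> K * \<tau>"
      using mult_left_mono[OF \<theta>(2)[OF q01] K] by (simp add: K_def mult.assoc)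
    ultimately show ?thesis using K\<tau> by linarith
  qed
  from F.perturbation[OF \<phi>0 \<delta> this] obtain \<phi> where \<phi>: "\<phi> \<in> mspace (C_space X)"
      "mdist (C_space X) \<phi>0 \<phi> \<le> 4 * \<delta>"
    and unc: "uncountable {q \<in> space Q. (\<integral>x. \<phi> x \<partial>\<mu> (\<theta> q)) = max_mean X left_shift \<phi>}" (is "uncountable ?S")
    by blast
  let ?R = "rich_maximizing \<phi>"
  have sub: "(\<lambda>q. \<mu> (\<theta> q)) ` ?S \<subseteq> ?R"
  proof (rule image_subsetI)
    fix q assume q: "q \<in> ?S"
    hence q01: "q \<in> {0..1}" by (simp add: space_Q)
    interpret markov_coding_at \<iota> A X M s "\<theta> q" by (rule at[OF q01])
    have "\<mu> (\<theta> q) \<in> maximizing_measures X left_shift \<phi>"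
      using \<phi>(1) q by (intro maximizing_measureI \<mu>_invariant) (auto simp: mspace_C_space)
    thus "\<mu> (\<theta> q) \<in> ?R" using \<mu>_ergodic \<mu>_fully_supported \<mu>_entropy_pos by simp
  qed
  have inj: "inj_on (\<lambda>q. \<mu> (\<theta> q)) ?S"
  proof (rule inj_onI)
    fix q q' assume q: "q \<in> ?S" "q' \<in> ?S" "\<mu> (\<theta> q) = \<mu> (\<theta> q')"
    hence "\<theta> q = \<theta> q'" using inj_onD[OF inj_on_\<mu> q(3)] \<theta> by (simp add: space_Q)
    thus "q = q'" using \<tau> by (simp add: \<theta>_def)
  qed
  have "uncountable ?R"
    using countable_subset[OF sub] countable_image_inj_on[OF _ inj] unc by blast
  moreover have "mdist (C_space X) \<phi>0 \<phi> < e" using \<phi>(2) e by (simp add: \<delta>_def)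
  ultimately show ?thesis using \<phi>(1) by blast
qed

theorem dense_uncountably_many_maximizing:
  "\<exists>D \<subseteq> mspace (C_space X).
     mtopology_of (C_space X) closure_of D = mspace (C_space X) \<and>
     (\<forall>\<phi>\<in>D. uncountable (rich_maximizing \<phi>))"
proof -
  define D where "D = {\<phi> \<in> mspace (C_space X). uncountable (rich_maximizing \<phi>)}"
  interpret C: Metric_space "mspace (C_space X) :: (('i \<Rightarrow> 'a) \<Rightarrow> real) set" "mdist (C_space X)" by simp
  have "C.mtopology closure_of D = mspace (C_space X)"
    unfolding C.metric_closure_of
    using perturbation_with_uncountably_many by (fastforce simp: D_def C.in_mball)
  hence "mtopology_of (C_space X) closure_of D = mspace (C_space X)" by (simp add: mtopology_of_def)
  thus ?thesis by (intro exI[of _ D]) (auto simp: D_def)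
qed

end

theorem theoremB:
  fixes A :: "'a::discrete_topology set"
    and X :: "(nat \<Rightarrow> 'a) set"
    and Y :: "(int \<Rightarrow> 'a) set"
  shows
    "(subshift_of_finite_type A X \<and> topologically_mixing X left_shift \<and>
      (\<exists>x\<in>X. \<exists>y\<in>X. x \<noteq> y) \<longrightarrow>
      (\<exists>D \<subseteq> mspace (C_space X).
         mtopology_of (C_space X) closure_of D = mspace (C_space X) \<and>
         (\<forall>\<phi>\<in>D. uncountable
            {\<mu> \<in> maximizing_measures X left_shift \<phi>.
               ergodic left_shift \<mu> \<and> fully_supported X \<mu> \<and> KS_entropy left_shift \<mu> > 0})))
     \<and>
     (subshift_of_finite_type A Y \<and> topologically_mixing Y left_shift \<and>
      (\<exists>x\<in>Y. \<exists>y\<in>Y. x \<noteq> y) \<longrightarrow>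
      (\<exists>D \<subseteq> mspace (C_space Y).
         mtopology_of (C_space Y) closure_of D = mspace (C_space Y) \<and>
         (\<forall>\<phi>\<in>D. uncountable
            {\<mu> \<in> maximizing_measures Y left_shift \<phi>.
               ergodic left_shift \<mu> \<and> fully_supported Y \<mu> \<and> KS_entropy left_shift \<mu> > 0})))"
proof -
  have one_sided: "mixing_sft int A X"
    if "subshift_of_finite_type A X" "topologically_mixing X left_shift" "\<exists>x\<in>X. \<exists>y\<in>X. x \<noteq> y"
    using that by (intro mixing_sft.intro mixing_sft_axioms.intro nat_index.shift_index_axioms)
  have two_sided: "mixing_sft (\<lambda>i. i) A Y"
    if "subshift_of_finite_type A Y" "topologically_mixing Y left_shift" "\<exists>x\<in>Y. \<exists>y\<in>Y. x \<noteq> y"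
    using that by (intro mixing_sft.intro mixing_sft_axioms.intro int_index.shift_index_axioms)
  show ?thesis
    by (intro conjI impI; elim conjE)
      (rule mixing_sft.dense_uncountably_many_maximizing[OF one_sided]
            mixing_sft.dense_uncountably_many_maximizing[OF two_sided]; assumption)+
qed

end
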